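(* Let $B_1=\prod_{i=1}^{n}(-a_i,a_i)$ and $B_2=\prod_{i=1}^{n}(-b_i,b_i)$ (with $a_i,b_i\in(0,\infty)$) be two boxes in $\mathbb{R}^n$ with $B_1\subseteq B_2$. Let $U\subseteq\mathbb{R}^n$ denote an arbitrary domain with $B_1\subseteq U\subseteq B_2$. For constants $C_1>0$, $C_2>1$, consider the conditions $$\text{(i)}\quad \frac{1}{a_i^2}-\frac{1}{b_i^2}\le \frac{C_1}{\max_{j} b_j^2}\ \text{ for all } i\in\{1,\dots,n\};\qquad \text{(ii)}\quad a_i\ge \frac{1}{C_2}b_i\ \text{ for all } i\in\{1,\dots,n\}.$$ 1. Suppose (i) holds. Then $\varphi_U(x)\lesssim\varphi_{B_2}(x)$ for all $x\in U$, where the implied constant depends only on $n$ and an upper bound on $C_1$. 2. Fix $C_1>0$. For all $C_2>1$ sufficiently close to $1$ depending only on $C_1$ and $n$, if both (i) and (ii) hold, then $\varphi_U(x)\gtrsim\varphi_{B_1}(x)$ for all $x\in B_1$, where the implied constant depends only on $n$ and $C_1$.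
   Context: A domain is a nonempty connected open set. For a bounded domain $U\subseteq\mathbb{R}^n$, $\varphi_U>0$ denotes the principal Dirichlet Laplacian eigenfunction of $U$, i.e. the positive eigenfunction of $-\Delta$ with Dirichlet boundary condition on $U$ corresponding to the smallest eigenvalue $\lambda(U)>0$, normalized so that $\|\varphi_U\|_{L^2(U)}=1$ (Lebesgue measure). $A\lesssim B$ (equivalently $B\gtrsim A$) means $A\le CB$ for a constant $C>0$ (the implied constant) depending only on the stated parameters. *)

theory Defs
  imports "HOL-Analysis.Analysis"
begin

definition is_domain :: "(real^'n) set \<Rightarrow> bool" where
  "is_domain U \<longleftrightarrow> U \<noteq> {} \<and> connected U \<and> open U"

definition partial_deriv :: "'n::finite \<Rightarrow> (real^'n \<Rightarrow> real) \<Rightarrow> real^'n \<Rightarrow> real" where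
  "partial_deriv i f x = deriv (\<lambda>t. f (x + t *\<^sub>R axis i 1)) 0"

definition grad :: "(real^'n \<Rightarrow> real) \<Rightarrow> real^'n \<Rightarrow> real^'n" where
  "grad f x = (\<chi> i. partial_deriv i f x)"

definition laplacian :: "(real^'n \<Rightarrow> real) \<Rightarrow> real^'n \<Rightarrow> real" where
  "laplacian f x = (\<Sum>i\<in>UNIV. partial_deriv i (partial_deriv i f) x)"

text \<open>Meant for open \<open>U\<close> only.\<close>

primrec Ck_on :: "nat \<Rightarrow> (real^'n) set \<Rightarrow> (real^'n \<Rightarrow> real) \<Rightarrow> bool" where
  "Ck_on 0 U f \<longleftrightarrow> continuous_on U f"
| "Ck_on (Suc k) U f \<longleftrightarrow> f differentiable_on U \<and> (\<forall>i. Ck_on k U (partial_deriv i f))"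

definition test_function :: "(real^'n) set \<Rightarrow> (real^'n \<Rightarrow> real) \<Rightarrow> bool" where
  "test_function U \<psi> \<longleftrightarrow>
     (\<forall>k. Ck_on k UNIV \<psi>) \<and> compact (closure {x. \<psi> x \<noteq> 0}) \<and> closure {x. \<psi> x \<noteq> 0} \<subseteq> U"

definition L2_on :: "(real^'n) set \<Rightarrow> (real^'n \<Rightarrow> 'b::euclidean_space) \<Rightarrow> bool" where
  "L2_on U f \<longleftrightarrow> f \<in> borel_measurable (lebesgue_on U) \<and>
     integrable (lebesgue_on U) (\<lambda>x. (norm (f x))\<^sup>2)"

definition L2_norm_on :: "(real^'n) set \<Rightarrow> (real^'n \<Rightarrow> 'b::euclidean_space) \<Rightarrow> real" where
  "L2_norm_on U f = sqrt (LINT x|lebesgue_on U. (norm (f x))\<^sup>2)"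

text \<open>The Sobolev space \<open>H\<^sup>1\<^sub>0(U)\<close>: the closure of the test functions on \<open>U\<close> in the
  \<open>H\<^sup>1\<close> norm. The function \<open>g\<close> is the weak gradient of \<open>u\<close>.\<close>

definition H10_on :: "(real^'n) set \<Rightarrow> (real^'n \<Rightarrow> real) \<Rightarrow> bool" where
  "H10_on U u \<longleftrightarrow> L2_on U u \<and>
     (\<exists>g \<psi>. L2_on U g \<and> (\<forall>k::nat. test_function U (\<psi> k)) \<and>
       (\<lambda>k. L2_norm_on U (\<lambda>x. \<psi> k x - u x)) \<longlonglongrightarrow> 0 \<and>
       (\<lambda>k. L2_norm_on U (\<lambda>x. grad (\<psi> k) x - g x)) \<longlonglongrightarrow> 0)"

text \<open>The boundary of \<open>U\<close> is arbitrary, so the Dirichlet condition is membership in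
  \<open>H\<^sup>1\<^sub>0(U)\<close>. By interior elliptic regularity every weak eigenfunction has a
  \<open>C\<^sup>2\<close> (indeed smooth) representative on \<open>U\<close>, which is the one meant by pointwise
  values; the equation is stated for it. Values outside \<open>U\<close> are irrelevant.\<close>

definition dirichlet_eigenfunction :: "(real^'n) set \<Rightarrow> real \<Rightarrow> (real^'n \<Rightarrow> real) \<Rightarrow> bool" where
  "dirichlet_eigenfunction U \<mu> u \<longleftrightarrow>
     Ck_on 2 U u \<and> H10_on U u \<and> (\<exists>x\<in>U. u x \<noteq> 0) \<and> (\<forall>x\<in>U. - laplacian u x = \<mu> * u x)"

definition dirichlet_eigenvalue :: "(real^'n) set \<Rightarrow> real \<Rightarrow> bool" where
  "dirichlet_eigenvalue U \<mu> \<longleftrightarrow> (\<exists>u. dirichlet_eigenfunction U \<mu> u)"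

definition principal_eigenvalue :: "(real^'n) set \<Rightarrow> real \<Rightarrow> bool" where
  "principal_eigenvalue U l \<longleftrightarrow>
     dirichlet_eigenvalue U l \<and> (\<forall>\<mu>. dirichlet_eigenvalue U \<mu> \<longrightarrow> l \<le> \<mu>)"

text \<open>On a bounded domain \<open>U\<close> such a \<open>\<phi>\<close> exists and its values on \<open>U\<close> are uniquely determined.\<close>

definition principal_eigenfunction :: "(real^'n) set \<Rightarrow> (real^'n \<Rightarrow> real) \<Rightarrow> bool" where
  "principal_eigenfunction U \<phi> \<longleftrightarrow>
     (\<exists>l. principal_eigenvalue U l \<and> dirichlet_eigenfunction U l \<phi>) \<and>
     (\<forall>x\<in>U. \<phi> x > 0) \<and> L2_norm_on U \<phi> = 1"

definition cond_i :: "real \<Rightarrow> real^'n \<Rightarrow> real^'n \<Rightarrow> bool" where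
  "cond_i C1 a b \<longleftrightarrow>
     (\<forall>i. 1 / (a $ i)\<^sup>2 - 1 / (b $ i)\<^sup>2 \<le> C1 / Max (range (\<lambda>j. (b $ j)\<^sup>2)))"

definition cond_ii :: "real \<Rightarrow> real^'n \<Rightarrow> real^'n \<Rightarrow> bool" where
  "cond_ii C2 a b \<longleftrightarrow> (\<forall>i. a $ i \<ge> 1 / C2 * b $ i)"

text \<open>\<open>box (- a) a\<close> is the open box with sides \<open>(-a\<^sub>i, a\<^sub>i)\<close>.\<close>

definition between_boxes :: "real^'n \<Rightarrow> real^'n \<Rightarrow> (real^'n) set \<Rightarrow> bool" where
  "between_boxes a b U \<longleftrightarrow>
     (\<forall>i. a $ i > 0 \<and> b $ i > 0) \<and> box (- a) a \<subseteq> box (- b) b \<and>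
     is_domain U \<and> box (- a) a \<subseteq> U \<and> U \<subseteq> box (- b) b"

end

theory Submission
  imports Defs
begin

text \<open>
  The idea is to compare the eigenfunction \<open>u\<close> of \<open>U\<close>, with eigenvalue \<open>l\<close>, with the Dirichlet heat
  kernel \<open>p\<close> of a box, which factorises over the coordinates and is explicit there. For the outer box,
  \<open>u\<close> extended by zero is a subsolution of \<open>- \<Delta>u = l u\<close>, so that
  \<open>t \<mapsto> e\<^sup>l\<^sup>t \<integral> p(t,x,y) u(y) dy\<close> is nondecreasing; it starts at \<open>u x\<close>. For the inner box, \<open>u\<close> is nonnegative
  on the boundary, where \<open>p\<close> vanishes; so \<open>u\<close> acts as a supersolution and the same quantity is nonincreasing. At a time \<open>T\<close> comparable
  with the square of the longest side, every one-dimensional factor of \<open>p\<close> is dominated by its first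
  mode, so that \<open>p(T,x,y)\<close> is comparable, with constants depending only on the dimension, with
  \<open>e\<^sup>-\<^sup>\<Lambda>\<^sup>T G x G y\<close> up to the volume of the box, where \<open>G\<close> and \<open>\<Lambda>\<close> are the explicit
  ground state and eigenvalue of the box (\<open>hker_large_time\<close>). This yields
  \<^item> \<open>u x \<lesssim> e\<^sup>(\<^sup>l\<^sup>-\<^sup>\<Lambda>\<^sup>)\<^sup>T G x\<close> for the outer box (\<open>upper_bound\<close>), and
  \<^item> \<open>u x \<gtrsim> e\<^sup>(\<^sup>l\<^sup>-\<^sup>\<Lambda>\<^sup>)\<^sup>T G x \<integral> u G\<close> for the inner box (\<open>lower_bound\<close>).

  The eigenvalue \<open>l\<close> lies between the eigenvalues of the two boxes, and by the first condition
  these differ by \<open>O(1/T)\<close>; hence the exponentials are bounded (\<open>eigenvalue_gap\<close>). Applied to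
  a box itself, the two bounds show that its principal eigenfunction is comparable with \<open>G\<close>
  (\<open>box_eigenfunction_comparison\<close>), which proves the first part. For the second part it remains to bound
  \<open>\<integral> u G\<close> over the inner box from below. By the first part \<open>u\<close> is at most a constant times the ground
  state of the outer box, whose square has little mass outside a slightly shrunk inner box once the boxes are nearly equal;
  so half of the unit mass of \<open>u\<^sup>2\<close> sits in this core, where \<open>G\<close> is not small (\<open>ground_pairing_ge_core\<close>).

  The boundary of \<open>U\<close> is arbitrary, and \<open>u\<close> need not vanish on it pointwise. The subsolution property
  (\<open>weak_subsolution\<close>) therefore uses only that \<open>u\<close> is a limit of test functions \<open>\<psi> k\<close>: the weak equation
  is tested against \<open>p arctan (m \<psi> k)\<close>. In place of the exact heat kernel the heat flow
  is started from the trigonometric polynomial proportional to \<open>cos\<^sup>2\<^sup>N (\<theta>/2)\<close>, reflected oddly, which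
  is nonnegative and concentrates at the diagonal as \<open>N\<close> grows. All sums are then finite, and the derivative in
  time of the pairing with \<open>u\<close> is elementary.
\<close>

section \<open>Partial derivatives and integration by parts\<close>

text \<open>
  An explicit derivative relation, in contrast to \<open>partial_deriv\<close>, which is
  \<open>deriv\<close> along the axis and hence arbitrary where the derivative does not exist.
\<close>
definition has_partial :: "'n::finite \<Rightarrow> (real^'n \<Rightarrow> real) \<Rightarrow> real \<Rightarrow> real^'n \<Rightarrow> bool" where
  "has_partial i f d x \<longleftrightarrow> ((\<lambda>t. f (x + t *\<^sub>R axis i 1)) has_real_derivative d) (at 0)"

text \<open>
  The pure second derivatives \<open>p2 i\<close> are enough to write down the Laplacian, as
  \<open>\<Sum>i\<in>UNIV. p2 i x\<close>. The conditions are on partial derivatives because these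
  are checked line by line for functions glued with zero outside an open set.
\<close>
definition C2_jet :: "(real^'n \<Rightarrow> real) \<Rightarrow> ('n \<Rightarrow> real^'n \<Rightarrow> real) \<Rightarrow> ('n \<Rightarrow> real^'n \<Rightarrow> real) \<Rightarrow> bool"
  where "C2_jet p p1 p2 \<longleftrightarrow> continuous_on UNIV p \<and>
    (\<forall>i. continuous_on UNIV (p1 i) \<and> continuous_on UNIV (p2 i) \<and>
      (\<forall>x. has_partial i p (p1 i x) x \<and> has_partial i (p1 i) (p2 i x) x))"

lemma has_partial_of_differentiable:
  fixes f :: "real^'n \<Rightarrow> real"
  assumes "f differentiable (at x)"
  shows "has_partial i f (partial_deriv i f x) x"
proof -
  obtain D where D: "(f has_derivative D) (at x)" using assms unfolding differentiable_def by blast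
  have "((\<lambda>t::real. x + t *\<^sub>R axis i 1) has_derivative (\<lambda>t. t *\<^sub>R axis i 1)) (at 0)"
    by (auto intro!: derivative_eq_intros)
  then have "((\<lambda>t::real. f (x + t *\<^sub>R axis i 1)) has_derivative (\<lambda>t. D (t *\<^sub>R axis i 1))) (at 0)"
    by (rule has_derivative_compose[of _ _ 0 UNIV f D]) (use D in simp)
  then have "(\<lambda>t::real. f (x + t *\<^sub>R axis i 1)) differentiable (at 0)"
    unfolding differentiable_def by blast
  then show ?thesis
    unfolding has_partial_def partial_deriv_def
    by (simp add: DERIV_deriv_iff_real_differentiable)
qed

lemma has_partial_mult:
  "has_partial i f a x \<Longrightarrow> has_partial i g b x \<Longrightarrow> has_partial i (\<lambda>x. f x * g x) (a * g x + f x * b) x"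
  unfolding has_partial_def by (auto intro!: derivative_eq_intros)

lemma has_partial_add:
  "has_partial i f a x \<Longrightarrow> has_partial i g b x \<Longrightarrow> has_partial i (\<lambda>x. f x + g x) (a + b) x"
  unfolding has_partial_def by (auto intro!: derivative_eq_intros)

lemma has_partial_diff:
  "has_partial i f a x \<Longrightarrow> has_partial i g b x \<Longrightarrow> has_partial i (\<lambda>x. f x - g x) (a - b) x"
  unfolding has_partial_def by (auto intro!: derivative_eq_intros)

lemma has_partial_const: "has_partial i (\<lambda>x. c) 0 x"
  unfolding has_partial_def by (auto intro!: derivative_eq_intros)

lemma has_partial_chain:
  assumes "has_partial i f a x" "(h has_real_derivative b) (at (f x))"
  shows "has_partial i (\<lambda>x. h (f x)) (b * a) x"
  using DERIV_chain2[of h b "\<lambda>t. f (x + t *\<^sub>R axis i 1)" 0 a UNIV] assms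
  unfolding has_partial_def by simp

lemma has_partial_line:
  assumes "\<And>y. has_partial i f (d y) y"
  shows "((\<lambda>s. f (x + s *\<^sub>R axis i 1)) has_real_derivative d (x + s *\<^sub>R axis i 1)) (at s)"
proof -
  have "((\<lambda>t. f ((x + s *\<^sub>R axis i 1) + t *\<^sub>R axis i 1)) has_real_derivative d (x + s *\<^sub>R axis i 1)) (at 0)"
    using assms unfolding has_partial_def by blast
  then have "((\<lambda>t. f (x + (t + s) *\<^sub>R axis i 1)) has_real_derivative d (x + s *\<^sub>R axis i 1)) (at 0)"
    by (simp only: scaleR_add_left add.commute add.left_commute add.assoc)
  then show ?thesis
    using DERIV_shift[of "\<lambda>s. f (x + s *\<^sub>R axis i 1)" "d (x + s *\<^sub>R axis i 1)" 0 s] by simp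
qed

lemma has_partial_cong_open:
  assumes "has_partial i f d x" "open S" "x \<in> S" "\<And>y. y \<in> S \<Longrightarrow> f y = g y"
  shows "has_partial i g d x"
proof -
  have "open ((\<lambda>t::real. x + t *\<^sub>R axis i 1) -` S)"
    by (rule open_vimage[OF assms(2)]) (intro continuous_intros)
  then have ev: "\<forall>\<^sub>F t in nhds 0. x + t *\<^sub>R axis i 1 \<in> S"
    using assms(3) eventually_nhds_in_open[of "(\<lambda>t::real. x + t *\<^sub>R axis i 1) -` S" 0] by auto
  have "((\<lambda>t. f (x + t *\<^sub>R axis i 1)) has_real_derivative d) (at 0) =
        ((\<lambda>t. g (x + t *\<^sub>R axis i 1)) has_real_derivative d) (at 0)"
    by (rule DERIV_cong_ev) (use ev assms(4) in \<open>auto elim: eventually_mono\<close>)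
  then show ?thesis using assms(1) unfolding has_partial_def by blast
qed

lemma has_partial_unique: "has_partial i f d x \<Longrightarrow> has_partial i f e x \<Longrightarrow> d = e"
  unfolding has_partial_def by (rule DERIV_unique)

lemma continuous_vanishing_outside_integrable:
  fixes f :: "'a::euclidean_space \<Rightarrow> real"
  assumes f: "continuous_on UNIV f" and K: "bounded K" "\<And>x. x \<notin> K \<Longrightarrow> f x = 0"
  shows "integrable lborel f"
proof -
  obtain R where R: "\<And>x. norm x > R \<Longrightarrow> f x = 0"
    using K unfolding bounded_iff by (metis linorder_not_le)
  have "integrable lborel (\<lambda>x. indicator (cball 0 R) x *\<^sub>R f x)"
    by (rule borel_integrable_compact) (auto intro: continuous_on_subset[OF f])
  moreover have "(\<lambda>x. indicator (cball 0 R) x *\<^sub>R f x) = f"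
    using R by (auto simp: fun_eq_iff indicator_def)
  ultimately show ?thesis by simp
qed

text \<open>
  Translation invariance makes the integral of every difference quotient of \<open>f\<close> zero;
  the mean value theorem bounds the quotients uniformly, so dominated convergence applies. All
  integrations by parts below come from this lemma.
\<close>
lemma integral_has_partial_eq_0:
  fixes f d :: "real^'n \<Rightarrow> real"
  assumes f: "continuous_on UNIV f" and d: "continuous_on UNIV d"
    and K: "bounded K" "\<And>x. x \<notin> K \<Longrightarrow> f x = 0"
    and D: "\<And>x. has_partial i f (d x) x"
  shows "integral\<^sup>L lborel d = 0"
proof -
  define e :: "real^'n" where "e = axis i 1"
  have ne: "norm e = 1" by (simp add: e_def)
  obtain R where R: "\<And>x. norm x > R \<Longrightarrow> f x = 0"
    using K unfolding bounded_iff by (metis linorder_not_le)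
  obtain B where B: "\<And>x. x \<in> cball 0 (R+2) \<Longrightarrow> \<bar>d x\<bar> \<le> B"
    using compact_imp_bounded[OF compact_continuous_image[OF continuous_on_subset[OF d] compact_cball]]
    by (metis UNIV_I bounded_iff image_eqI real_norm_def subsetI)
  define t where "t m = 1 / real (Suc m)" for m
  define q where "q m x = (f (x + t m *\<^sub>R e) - f x) / t m" for m x
  have tpos: "0 < t m" "t m \<le> 1" for m by (auto simp: t_def)
  have fb: "f \<in> borel_measurable borel" using f by (rule borel_measurable_continuous_onI)
  have intf: "integrable lborel f" by (rule continuous_vanishing_outside_integrable[OF f K])
  have shift: "integral\<^sup>L lborel (\<lambda>x. f (x + c)) = integral\<^sup>L lborel f \<and> integrable lborel (\<lambda>x. f (x + c))" for c
  proof
    have "integral\<^sup>L (distr lborel borel ((+) c)) f = integral\<^sup>L lborel (\<lambda>x. f (c + x))"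
      by (rule integral_distr) (use fb in simp_all)
    then show "integral\<^sup>L lborel (\<lambda>x. f (x + c)) = integral\<^sup>L lborel f"
      by (simp add: lborel_distr_plus add.commute)
    have "integrable (distr lborel borel ((+) c)) f \<longleftrightarrow> integrable lborel (\<lambda>x. f (c + x))"
      by (rule integrable_distr_eq) (use fb in simp_all)
    then show "integrable lborel (\<lambda>x. f (x + c))"
      using intf by (simp add: lborel_distr_plus add.commute)
  qed
  have q0: "integral\<^sup>L lborel (q m) = 0" for m
    unfolding q_def using shift[of "t m *\<^sub>R e"] intf by (simp add: Bochner_Integration.integral_diff)
  have "(\<lambda>m. integral\<^sup>L lborel (q m)) \<longlonglongrightarrow> integral\<^sup>L lborel d"
  proof (rule integral_dominated_convergence[where w="\<lambda>x. B * indicator (cball 0 (R+1)) x"])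
    show "d \<in> borel_measurable lborel" using borel_measurable_continuous_onI[OF d] by simp
    show "q m \<in> borel_measurable lborel" for m
      unfolding q_def using fb by measurable
    show "integrable lborel (\<lambda>x. B * indicator (cball 0 (R+1)) (x::real^'n))"
    proof -
      have "integrable lborel (\<lambda>x. indicator (cball (0::real^'n) (R+1)) x *\<^sub>R B)"
        by (rule borel_integrable_compact) auto
      moreover have "(\<lambda>x. indicator (cball (0::real^'n) (R+1)) x *\<^sub>R B) = (\<lambda>x. B * indicator (cball 0 (R+1)) x)"
        by (auto simp: fun_eq_iff)
      ultimately show ?thesis by (simp only:)
    qed
    have tl: "t \<longlonglongrightarrow> 0" unfolding t_def using LIMSEQ_inverse_real_of_nat by (simp add: inverse_eq_divide)
    have "(\<lambda>m. q m x) \<longlonglongrightarrow> d x" for x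
    proof -
      have "((\<lambda>h. (f (x + h *\<^sub>R e) - f x) / h) \<longlongrightarrow> d x) (at 0)"
        using D[of x] unfolding has_partial_def DERIV_def e_def by simp
      moreover have "filterlim t (at 0) sequentially"
        unfolding filterlim_at using tl tpos(1) by (auto simp: less_imp_neq[symmetric])
      ultimately show ?thesis unfolding q_def by (rule filterlim_compose)
    qed
    then show "AE x in lborel. (\<lambda>m. q m x) \<longlonglongrightarrow> d x" by simp
    have "\<bar>q m x\<bar> \<le> B * indicator (cball 0 (R+1)) x" for m x
    proof (cases "norm x \<le> R + 1")
      case True
      have "\<exists>z>0. z < t m \<and> f (x + t m *\<^sub>R e) - f (x + 0 *\<^sub>R e) = (t m - 0) * d (x + z *\<^sub>R e)"
        by (rule MVT2) (use tpos has_partial_line[OF D] in \<open>auto simp: e_def\<close>)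
      then obtain z where z: "0 < z" "z < t m" "f (x + t m *\<^sub>R e) - f x = t m * d (x + z *\<^sub>R e)" by auto
      have "norm (x + z *\<^sub>R e) \<le> norm x + z" using norm_triangle_ineq[of x "z *\<^sub>R e"] z ne by simp
      then have "x + z *\<^sub>R e \<in> cball 0 (R+2)" using True z tpos[of m] by auto
      then show ?thesis using z B[of "x + z *\<^sub>R e"] True tpos[of m] unfolding q_def by simp
    next
      case False
      have "norm x \<le> norm (x + t m *\<^sub>R e) + norm (t m *\<^sub>R e)"
        using norm_triangle_ineq4[of "x + t m *\<^sub>R e" "t m *\<^sub>R e"] by simp
      then have "norm (x + t m *\<^sub>R e) > R" using False ne tpos[of m] by simp
      then show ?thesis using False R unfolding q_def by simp
    qed
    then show "AE x in lborel. norm (q m x) \<le> B * indicator (cball 0 (R+1)) x" for m by simp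
  qed
  then show ?thesis using q0 by (simp add: LIMSEQ_const_iff)
qed

lemma C2_jet_D:
  assumes "C2_jet p p1 p2"
  shows "continuous_on UNIV p" "continuous_on UNIV (p1 i)" "continuous_on UNIV (p2 i)"
    "has_partial i p (p1 i x) x" "has_partial i (p1 i) (p2 i x) x"
  using assms unfolding C2_jet_def by auto

lemma has_partial_vanish:
  assumes "closed K" "\<And>x. x \<notin> K \<Longrightarrow> f x = 0" "x \<notin> K"
  shows "has_partial i f 0 x"
  by (rule has_partial_cong_open[where S="- K" and f="\<lambda>_. 0"])
     (use assms has_partial_const in auto)

lemma C2_jet_vanish:
  assumes "C2_jet p p1 p2" "closed K" "\<And>x. x \<notin> K \<Longrightarrow> p x = 0" "x \<notin> K"
  shows "p1 i x = 0" "p2 i x = 0"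
proof -
  have *: "p1 i y = 0" if "y \<notin> K" for y
    by (rule has_partial_unique[OF C2_jet_D(4)[OF assms(1)] has_partial_vanish[OF assms(2,3) that]])
  then show "p1 i x = 0" using assms(4) .
  show "p2 i x = 0"
    by (rule has_partial_unique[OF C2_jet_D(5)[OF assms(1)] has_partial_vanish[OF assms(2) * assms(4)]])
qed

lemma Ck2_on_D:
  fixes u :: "real^'n \<Rightarrow> real"
  assumes "Ck_on 2 U u" "open U"
  shows "continuous_on U u" "continuous_on U (partial_deriv i u)"
    "continuous_on U (partial_deriv i (partial_deriv i u))"
    "\<And>x. x \<in> U \<Longrightarrow> has_partial i u (partial_deriv i u x) x"
    "\<And>x. x \<in> U \<Longrightarrow> has_partial i (partial_deriv i u) (partial_deriv i (partial_deriv i u) x) x"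
proof -
  have d: "u differentiable_on U" "partial_deriv i u differentiable_on U"
    and c: "continuous_on U (partial_deriv i (partial_deriv i u))"
    using assms(1) unfolding numeral_2_eq_2 by auto
  show "continuous_on U u" "continuous_on U (partial_deriv i u)"
    using d by (auto intro: differentiable_imp_continuous_on)
  show "continuous_on U (partial_deriv i (partial_deriv i u))" by (rule c)
  show "has_partial i u (partial_deriv i u x) x" if "x \<in> U" for x
    using d(1) that assms(2) by (intro has_partial_of_differentiable)
      (auto simp: differentiable_on_eq_differentiable_at)
  show "has_partial i (partial_deriv i u) (partial_deriv i (partial_deriv i u) x) x" if "x \<in> U" for x
    using d(2) that assms(2) by (intro has_partial_of_differentiable)
      (auto simp: differentiable_on_eq_differentiable_at)
qed

lemma continuous_on_extend_zero:
  fixes f :: "'a::topological_space \<Rightarrow> real"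
  assumes "open U" "closed K" "K \<subseteq> U" "continuous_on U f" "\<And>x. x \<in> U \<Longrightarrow> x \<notin> K \<Longrightarrow> f x = 0"
  shows "continuous_on UNIV (\<lambda>x. if x \<in> U then f x else 0)"
proof -
  have "continuous_on (U \<union> - K) (\<lambda>x. if x \<in> U then f x else 0)"
  proof (rule continuous_on_open_Un)
    show "continuous_on U (\<lambda>x. if x \<in> U then f x else 0)"
      using assms(4) by (rule continuous_on_eq) simp
    show "continuous_on (- K) (\<lambda>x. if x \<in> U then f x else 0)"
      by (rule continuous_on_eq[OF continuous_on_const[of _ 0]]) (use assms(5) in auto)
  qed (use assms in auto)
  moreover have "U \<union> - K = UNIV" using assms(3) by blast
  ultimately show ?thesis by simp
qed

abbreviation integral_on :: "(real^'n) set \<Rightarrow> (real^'n \<Rightarrow> real) \<Rightarrow> real" where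
  "integral_on V f \<equiv> integral\<^sup>L (lebesgue_on V) f"

lemma integral_lebesgue_on_eq_lborel:
  fixes f :: "real^'n \<Rightarrow> real"
  assumes "open U" "(\<lambda>x. if x \<in> U then f x else 0) \<in> borel_measurable borel"
  shows "integral_on U f = integral\<^sup>L lborel (\<lambda>x. if x \<in> U then f x else 0)"
    and "integrable (lebesgue_on U) f \<longleftrightarrow> integrable lborel (\<lambda>x. if x \<in> U then f x else 0)"
proof -
  have eq: "(\<lambda>x. indicator U x *\<^sub>R f x) = (\<lambda>x. if x \<in> U then f x else 0)"
    by (auto simp: fun_eq_iff)
  have U: "U \<in> sets lebesgue" using assms(1) by auto
  show "integral_on U f = integral\<^sup>L lborel (\<lambda>x. if x \<in> U then f x else 0)"
    using U integral_completion[of "\<lambda>x. if x \<in> U then f x else 0" lborel] assms(2)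
    by (subst integral_restrict_space) (simp_all add: eq del: real_scaleR_def)
  show "integrable (lebesgue_on U) f \<longleftrightarrow> integrable lborel (\<lambda>x. if x \<in> U then f x else 0)"
    using U integrable_completion[of "\<lambda>x. if x \<in> U then f x else 0" lborel] assms(2)
    by (subst integrable_restrict_space) (simp_all add: eq del: real_scaleR_def)
qed

text \<open>
  Green's formula without boundary terms: the field with components \<open>u \<partial>\<^sub>i p -
  p \<partial>\<^sub>i u\<close>, extended by zero, has compact support in \<open>U\<close>, so its
  divergence integrates to zero.
\<close>
lemma green_compact_support:
  fixes u :: "real^'n \<Rightarrow> real"
  assumes U: "open U" and u: "Ck_on 2 U u" and p: "C2_jet p p1 p2"
    and K: "compact K" "K \<subseteq> U" "\<And>x. x \<notin> K \<Longrightarrow> p x = 0"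
  shows "integral_on U (\<lambda>x. u x * (\<Sum>i\<in>UNIV. p2 i x) - p x * laplacian u x) = 0"
proof -
  note uD = Ck2_on_D[OF u U]
  have cl: "closed K" using K(1) by (rule compact_imp_closed)
  note v = C2_jet_vanish[OF p cl K(3)]
  have pc: "continuous_on UNIV p" "continuous_on UNIV (p1 i)" "continuous_on UNIV (p2 i)"
    and pd: "has_partial i p (p1 i x) x" "has_partial i (p1 i) (p2 i x) x" for i x
    using p unfolding C2_jet_def by auto
  define f where "f i x = u x * p1 i x - p x * partial_deriv i u x" for i x
  define d where "d i x = u x * p2 i x - p x * partial_deriv i (partial_deriv i u) x" for i x
  define f' where "f' i x = (if x \<in> U then f i x else 0)" for i x
  define d' where "d' i x = (if x \<in> U then d i x else 0)" for i x
  have fc: "continuous_on UNIV (f' i)" for i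
    unfolding f'_def f_def using K(3) v
    by (intro continuous_on_extend_zero[OF U cl K(2)])
       (auto intro!: continuous_intros uD continuous_on_subset[OF pc(1)] continuous_on_subset[OF pc(2)])
  have dc: "continuous_on UNIV (d' i)" for i
    unfolding d'_def d_def using K(3) v
    by (intro continuous_on_extend_zero[OF U cl K(2)])
       (auto intro!: continuous_intros uD continuous_on_subset[OF pc(1)] continuous_on_subset[OF pc(3)])
  have z: "f' i x = 0" "d' i x = 0" if "x \<notin> K" for i x
    using that v K(3) by (auto simp: f'_def d'_def f_def d_def)
  have part: "has_partial i (f' i) (d' i x) x" for i x
  proof (cases "x \<in> U")
    case True
    have "has_partial i (f i) (d i x) x"
    proof -
      have "has_partial i (f i) ((partial_deriv i u x * p1 i x + u x * p2 i x) -
          (p1 i x * partial_deriv i u x + p x * partial_deriv i (partial_deriv i u) x)) x"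
        unfolding f_def by (intro has_partial_diff has_partial_mult pd uD True)
      then show ?thesis by (simp add: d_def algebra_simps)
    qed
    then have "has_partial i (f' i) (d i x) x"
      by (rule has_partial_cong_open[OF _ U True]) (simp add: f'_def)
    then show ?thesis using True by (simp add: d'_def)
  next
    case False
    then have "x \<in> - K" using K(2) by blast
    then have "has_partial i (f' i) 0 x"
      by (intro has_partial_vanish[OF cl]) (use z in auto)
    then show ?thesis using False by (simp add: d'_def)
  qed
  have bK: "bounded K" using K(1) by (rule compact_imp_bounded)
  have I0: "integral\<^sup>L lborel (d' i) = 0" for i
    by (rule integral_has_partial_eq_0[OF fc dc bK z(1) part])
  have Ii: "integrable lborel (d' i)" for i
    by (rule continuous_vanishing_outside_integrable[OF dc bK z(2)])
  have bm: "(\<lambda>x. if x \<in> U then d i x else 0) \<in> borel_measurable borel" for i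
    using borel_measurable_continuous_onI[OF dc[of i]] unfolding d'_def .
  have J: "integral_on U (d i) = 0" "integrable (lebesgue_on U) (d i)" for i
    using integral_lebesgue_on_eq_lborel[OF U bm] I0[of i] Ii[of i] unfolding d'_def by auto
  have "integral_on U (\<lambda>x. \<Sum>i\<in>UNIV. d i x) = 0"
    by (subst Bochner_Integration.integral_sum) (use J in auto)
  then show ?thesis
    by (simp add: d_def laplacian_def sum_subtractf sum_distrib_left)
qed

section \<open>Square-integrable functions and weak limits\<close>

lemma bounded_on_bounded:
  fixes f :: "real^'n \<Rightarrow> real"
  assumes "bounded U" "continuous_on UNIV f"
  obtains B where "B \<ge> 0" "\<And>x. x \<in> U \<Longrightarrow> \<bar>f x\<bar> \<le> B"
proof -
  have "compact (closure U)" using assms(1) by simp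
  then have "bounded (f ` closure U)"
    by (intro compact_imp_bounded compact_continuous_image continuous_on_subset[OF assms(2)]) auto
  then obtain B where B: "\<And>y. y \<in> f ` closure U \<Longrightarrow> norm y \<le> B" unfolding bounded_iff by blast
  show thesis
  proof (rule that[of "max 0 B"])
    fix x assume "x \<in> U"
    then have "f x \<in> f ` closure U" using closure_subset by blast
    from B[OF this] show "\<bar>f x\<bar> \<le> max 0 B" by simp
  qed simp
qed

lemma continuous_borel_lebesgue_on:
  fixes f :: "real^'n \<Rightarrow> 'b::euclidean_space"
  assumes "continuous_on UNIV f"
  shows "f \<in> borel_measurable (lebesgue_on U)"
proof -
  have "f \<in> borel_measurable lebesgue"
    using borel_measurable_continuous_onI[OF assms] by (intro measurable_completion) simp
  then show ?thesis by (rule measurable_restrict_space1)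
qed

lemma L2_onD:
  "L2_on U f \<Longrightarrow> f \<in> borel_measurable (lebesgue_on U)"
  "L2_on U f \<Longrightarrow> integrable (lebesgue_on U) (\<lambda>x. (norm (f x))\<^sup>2)"
  unfolding L2_on_def by auto

lemma finite_measure_lebesgue_on_bounded:
  fixes U :: "(real^'n) set"
  assumes "open U" "bounded U" shows "finite_measure (lebesgue_on U)"
  using assms by (intro finite_measure_lebesgue_on bounded_set_imp_lmeasurable) auto

lemma L2_on_bounded:
  fixes f :: "real^'n \<Rightarrow> 'b::euclidean_space"
  assumes "open U" "bounded U" "f \<in> borel_measurable (lebesgue_on U)" "\<And>x. x \<in> U \<Longrightarrow> norm (f x) \<le> B"
  shows "L2_on U f"
proof -
  interpret finite_measure "lebesgue_on U" by (rule finite_measure_lebesgue_on_bounded) fact+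
  note [measurable] = assms(3)
  have "integrable (lebesgue_on U) (\<lambda>x. (norm (f x))\<^sup>2)"
    by (rule integrable_const_bound[of _ "B\<^sup>2"]) (use assms(4) in \<open>auto intro!: AE_I2 power_mono\<close>)
  then show ?thesis using assms(3) unfolding L2_on_def by blast
qed

lemma L2_on_continuous:
  fixes f :: "real^'n \<Rightarrow> 'b::euclidean_space"
  assumes "open U" "bounded U" "continuous_on UNIV f"
  shows "L2_on U f"
proof -
  obtain B where "\<And>x. x \<in> U \<Longrightarrow> \<bar>norm (f x)\<bar> \<le> B"
    using bounded_on_bounded[OF assms(2), of "\<lambda>x. norm (f x)"] continuous_on_norm[OF assms(3)] by metis
  then show ?thesis
    by (intro L2_on_bounded[OF assms(1,2)] continuous_borel_lebesgue_on assms(3)) auto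
qed

lemma L2_on_diff:
  fixes f g :: "real^'n \<Rightarrow> 'b::euclidean_space"
  assumes f: "L2_on U f" and g: "L2_on U g"
  shows "L2_on U (\<lambda>x. f x - g x)"
proof -
  note [measurable] = L2_onD(1)[OF f] L2_onD(1)[OF g]
  have "integrable (lebesgue_on U) (\<lambda>x. (norm (f x - g x))\<^sup>2)"
  proof (rule Bochner_Integration.integrable_bound)
    show "integrable (lebesgue_on U) (\<lambda>x. 2 * (norm (f x))\<^sup>2 + 2 * (norm (g x))\<^sup>2)"
      using L2_onD(2)[OF f] L2_onD(2)[OF g] by simp
    have "(norm (f x - g x))\<^sup>2 \<le> 2 * (norm (f x))\<^sup>2 + 2 * (norm (g x))\<^sup>2" for x
    proof -
      have "(norm (f x - g x))\<^sup>2 \<le> (norm (f x) + norm (g x))\<^sup>2"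
        by (intro power_mono norm_triangle_ineq4) auto
      also have "\<dots> \<le> 2 * (norm (f x))\<^sup>2 + 2 * (norm (g x))\<^sup>2"
        using sum_squares_bound[of "norm (f x)" "norm (g x)"] by (simp add: power2_sum)
      finally show ?thesis .
    qed
    then show "AE x in lebesgue_on U. norm ((norm (f x - g x))\<^sup>2) \<le> norm (2 * (norm (f x))\<^sup>2 + 2 * (norm (g x))\<^sup>2)"
      by (auto intro!: AE_I2)
  qed measurable
  then show ?thesis unfolding L2_on_def by auto
qed

lemma young_mult:
  fixes a b e :: real
  assumes "e > 0" shows "a * b \<le> e * a\<^sup>2 + b\<^sup>2 / e"
proof -
  have "0 \<le> (e * a - b)\<^sup>2 / e" using assms by simp
  also have "\<dots> = e * a\<^sup>2 - 2 * (a * b) + b\<^sup>2 / e"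
    using assms by (simp add: power2_eq_square field_simps)
  finally have 1: "2 * (a * b) \<le> e * a\<^sup>2 + b\<^sup>2 / e" by simp
  have "0 \<le> e * a\<^sup>2 + b\<^sup>2 / e" using assms by simp
  then show ?thesis using 1 by linarith
qed

lemma integrable_L2_product:
  fixes f :: "real^'n \<Rightarrow> 'b::euclidean_space" and h :: "real^'n \<Rightarrow> 'c::euclidean_space" and w :: "real^'n \<Rightarrow> real"
  assumes "L2_on U f" "L2_on U h" "w \<in> borel_measurable (lebesgue_on U)"
    and b: "\<And>x. x \<in> U \<Longrightarrow> \<bar>w x\<bar> \<le> C * (norm (f x) * norm (h x))"
  shows "integrable (lebesgue_on U) w"
proof (rule Bochner_Integration.integrable_bound)
  show "integrable (lebesgue_on U) (\<lambda>x. \<bar>C\<bar> * ((norm (f x))\<^sup>2 + (norm (h x))\<^sup>2))"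
    using assms(1,2) unfolding L2_on_def by auto
  have "\<bar>w x\<bar> \<le> \<bar>C\<bar> * ((norm (f x))\<^sup>2 + (norm (h x))\<^sup>2)" if "x \<in> U" for x
  proof -
    have "\<bar>w x\<bar> \<le> \<bar>C\<bar> * (norm (f x) * norm (h x))"
      using b[OF that] by (smt (verit) mult_nonneg_nonneg mult_right_mono norm_ge_zero)
    also have "\<dots> \<le> \<bar>C\<bar> * ((norm (f x))\<^sup>2 + (norm (h x))\<^sup>2)"
      using young_mult[of 1 "norm (f x)" "norm (h x)"] by (intro mult_left_mono) auto
    finally show ?thesis .
  qed
  then show "AE x in lebesgue_on U. norm (w x) \<le> norm (\<bar>C\<bar> * ((norm (f x))\<^sup>2 + (norm (h x))\<^sup>2))"
    by (auto intro!: AE_I2 simp: abs_mult)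
qed (rule assms(3))

text \<open>
  This plays the role of the Cauchy--Schwarz inequality: Young's inequality with a free weight
  bounds the integral by a small multiple of \<open>\<integral> \<bar>f\<bar>\<^sup>2\<close> and a
  large multiple of \<open>\<integral> \<bar>h k\<bar>\<^sup>2\<close>, which tends to zero.
\<close>
lemma L2_pairing_tendsto_0:
  fixes f :: "real^'n \<Rightarrow> 'b::euclidean_space" and h :: "nat \<Rightarrow> real^'n \<Rightarrow> 'c::euclidean_space"
    and w :: "nat \<Rightarrow> real^'n \<Rightarrow> real"
  assumes f: "L2_on U f" and h: "\<And>k. L2_on U (h k)" and lim: "(\<lambda>k. L2_norm_on U (h k)) \<longlonglongrightarrow> 0"
    and w: "\<And>k. w k \<in> borel_measurable (lebesgue_on U)" and C: "C \<ge> 0"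
    and b: "\<And>k x. x \<in> U \<Longrightarrow> \<bar>w k x\<bar> \<le> C * (norm (f x) * norm (h k x))"
  shows "(\<lambda>k. integral_on U (w k)) \<longlonglongrightarrow> 0"
proof -
  let ?I = "integral_on U"
  define A where "A = ?I (\<lambda>x. (norm (f x))\<^sup>2)"
  define a where "a k = ?I (\<lambda>x. (norm (h k x))\<^sup>2)" for k
  have A0: "A \<ge> 0" and a0: "a k \<ge> 0" for k unfolding A_def a_def by auto
  have "(\<lambda>k. (L2_norm_on U (h k))\<^sup>2) \<longlonglongrightarrow> 0\<^sup>2" by (intro tendsto_power lim)
  then have al: "a \<longlonglongrightarrow> 0" using a0 unfolding L2_norm_on_def a_def by simp
  have bd: "\<bar>?I (w k)\<bar> \<le> C * (e * A + a k / e)" if e: "e > 0" for e k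
  proof -
    have "\<bar>?I (w k)\<bar> \<le> ?I (\<lambda>x. \<bar>w k x\<bar>)" by (rule integral_abs_bound)
    also have "\<dots> \<le> ?I (\<lambda>x. C * (e * (norm (f x))\<^sup>2 + (norm (h k x))\<^sup>2 / e))"
    proof (rule integral_mono)
      show "integrable (lebesgue_on U) (\<lambda>x. \<bar>w k x\<bar>)"
        by (intro integrable_abs integrable_L2_product[OF f h w b])
      show "integrable (lebesgue_on U) (\<lambda>x. C * (e * (norm (f x))\<^sup>2 + (norm (h k x))\<^sup>2 / e))"
        using L2_onD(2)[OF f] L2_onD(2)[OF h[of k]] by simp
      fix x assume "x \<in> space (lebesgue_on U)"
      then have "\<bar>w k x\<bar> \<le> C * (norm (f x) * norm (h k x))" using b by simp
      also have "\<dots> \<le> C * (e * (norm (f x))\<^sup>2 + (norm (h k x))\<^sup>2 / e)"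
        by (intro mult_left_mono young_mult e C)
      finally show "\<bar>w k x\<bar> \<le> C * (e * (norm (f x))\<^sup>2 + (norm (h k x))\<^sup>2 / e)" .
    qed
    also have "\<dots> = C * (e * A + a k / e)"
      using L2_onD(2)[OF f] L2_onD(2)[OF h[of k]] unfolding A_def a_def by simp
    finally show ?thesis .
  qed
  show ?thesis
  proof (rule LIMSEQ_I)
    fix r :: real assume r: "r > 0"
    define e where "e = r / (2 * (C * A + 1))"
    have CA: "C * A \<ge> 0" using C A0 by simp
    then have e: "e > 0" using r by (simp add: e_def)
    have "C * A / (2 * (C * A + 1)) < 1 / 2" using CA by (simp add: field_simps)
    then have "r * (C * A / (2 * (C * A + 1))) < r * (1 / 2)" using r by (intro mult_strict_left_mono)
    moreover have "C * (e * A) = r * (C * A / (2 * (C * A + 1)))" by (simp add: e_def)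
    ultimately have eA: "C * (e * A) < r / 2" by simp
    have "(\<lambda>k. C * (a k / e)) \<longlonglongrightarrow> C * (0 / e)" by (intro tendsto_intros al) (use e in auto)
    then have "\<forall>\<^sub>F k in sequentially. C * (a k / e) < r / 2"
      using r by (intro order_tendstoD) auto
    then obtain N where N: "\<And>k. k \<ge> N \<Longrightarrow> C * (a k / e) < r / 2" unfolding eventually_sequentially by blast
    have "norm (?I (w k) - 0) < r" if "k \<ge> N" for k
    proof -
      have "\<bar>?I (w k)\<bar> \<le> C * (e * A) + C * (a k / e)" using bd[OF e, of k] by (simp only: distrib_left)
      then show ?thesis using eA N[OF that] unfolding real_norm_def diff_0_right by linarith
    qed
    then show "\<exists>N. \<forall>k\<ge>N. norm (?I (w k) - 0) < r" by blast
  qed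
qed

lemma arctan_lipschitz: "\<bar>arctan x - arctan y\<bar> \<le> \<bar>x - y\<bar>"
proof -
  have "norm (arctan x - arctan y) \<le> 1 * norm (x - y)"
  proof (rule field_differentiable_bound[of UNIV arctan "\<lambda>z. inverse (1 + z\<^sup>2)"])
    fix z :: real
    show "(arctan has_field_derivative inverse (1 + z\<^sup>2)) (at z within UNIV)"
      using DERIV_arctan by simp
    have "inverse (1 + z\<^sup>2) \<le> 1" by (simp add: inverse_le_1_iff add_pos_nonneg)
    moreover have "1 + z\<^sup>2 > 0" by (simp add: add_pos_nonneg)
    ultimately show "norm (inverse (1 + z\<^sup>2)) \<le> 1" by simp
  qed auto
  then show ?thesis by simp
qed

lemma test_function_jet:
  fixes \<psi> :: "real^'n \<Rightarrow> real"
  assumes "test_function U \<psi>"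
  shows "C2_jet \<psi> (\<lambda>i. partial_deriv i \<psi>) (\<lambda>i. partial_deriv i (partial_deriv i \<psi>))"
    and "compact (closure {x. \<psi> x \<noteq> 0})" "closure {x. \<psi> x \<noteq> 0} \<subseteq> U"
    and "x \<notin> closure {x. \<psi> x \<noteq> 0} \<Longrightarrow> \<psi> x = 0"
proof -
  have C: "Ck_on 2 UNIV \<psi>" using assms unfolding test_function_def by blast
  show "C2_jet \<psi> (\<lambda>i. partial_deriv i \<psi>) (\<lambda>i. partial_deriv i (partial_deriv i \<psi>))"
    unfolding C2_jet_def using Ck2_on_D[OF C open_UNIV] by blast
  show "compact (closure {x. \<psi> x \<noteq> 0})" "closure {x. \<psi> x \<noteq> 0} \<subseteq> U"
    using assms unfolding test_function_def by auto
  show "\<psi> x = 0" if "x \<notin> closure {x. \<psi> x \<noteq> 0}"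
    using that closure_subset[of "{x. \<psi> x \<noteq> 0}"] by blast
qed

text \<open>
  Here \<open>p\<close> is arbitrary at the boundary of \<open>U\<close>; the support of the test
  function provides the compactness.
\<close>
lemma by_parts_test_function:
  fixes p :: "real^'n \<Rightarrow> real"
  assumes U: "open U" and psi: "test_function U \<psi>" and p: "C2_jet p p1 p2"
  shows "integral_on U (\<lambda>x. \<Sum>i\<in>UNIV. partial_deriv i \<psi> x * p1 i x + \<psi> x * p2 i x) = 0"
proof -
  let ?K = "closure {x. \<psi> x \<noteq> 0}"
  note T = test_function_jet[OF psi]
  note tD = C2_jet_D[OF T(1)] and pD = C2_jet_D[OF p]
  have cl: "closed ?K" by simp
  have v: "partial_deriv i \<psi> x = 0" if "x \<notin> ?K" for i x
    by (rule C2_jet_vanish(1)[OF T(1) cl _ that]) (rule T(4))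
  define d where "d i x = partial_deriv i \<psi> x * p1 i x + \<psi> x * p2 i x" for i x
  have dc: "continuous_on UNIV (d i)" for i
    unfolding d_def by (intro continuous_intros tD pD)
  have fc: "continuous_on UNIV (\<lambda>x. \<psi> x * p1 i x)" for i by (intro continuous_intros tD pD)
  have z: "d i x = 0" "\<psi> x * p1 i x = 0" if "x \<notin> ?K" for i x
    using v[OF that] T(4)[OF that] by (simp_all add: d_def)
  have bK: "bounded ?K" using T(2) by (rule compact_imp_bounded)
  have I0: "integral\<^sup>L lborel (d i) = 0" for i
  proof (rule integral_has_partial_eq_0[OF fc dc bK z(2)])
    show "has_partial i (\<lambda>x. \<psi> x * p1 i x) (d i x) x" for x
      unfolding d_def by (intro has_partial_mult tD pD)
  qed
  have Ii: "integrable lborel (d i)" for i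
    by (rule continuous_vanishing_outside_integrable[OF dc bK z(1)])
  have e: "(\<lambda>x. if x \<in> U then d i x else 0) = d i" for i
    using z(1) T(3) by (auto simp: fun_eq_iff)
  have J: "integral_on U (d i) = 0" "integrable (lebesgue_on U) (d i)" for i
    using integral_lebesgue_on_eq_lborel[OF U, of "d i"] I0[of i] Ii[of i]
      borel_measurable_continuous_onI[OF dc[of i]] unfolding e by auto
  have "integral_on U (\<lambda>x. \<Sum>i\<in>UNIV. d i x) = 0"
    by (subst Bochner_Integration.integral_sum) (use J in auto)
  then show ?thesis by (simp add: d_def)
qed

section \<open>The eigenfunction extended by zero is a weak subsolution\<close>

locale positive_eigenfunction =
  fixes U :: "(real^'n) set" and l :: real and u :: "real^'n \<Rightarrow> real"
  assumes open_U: "open U" and bounded_U: "bounded U"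
    and eigen: "dirichlet_eigenfunction U l u"
    and pos: "\<And>x. x \<in> U \<Longrightarrow> 0 < u x"
    and normalized: "L2_norm_on U u = 1"
begin

lemma u_facts:
  shows "Ck_on 2 U u" "L2_on U u" "\<And>x. x \<in> U \<Longrightarrow> laplacian u x = - l * u x"
    "u \<in> borel_measurable (lebesgue_on U)"
  using eigen unfolding dirichlet_eigenfunction_def H10_on_def L2_on_def
  by (auto simp: minus_equation_iff[of "laplacian _ _"])

lemma integrable_u_mult:
  assumes "continuous_on UNIV p"
  shows "integrable (lebesgue_on U) (\<lambda>x. u x * p x)"
proof (rule integrable_L2_product[OF u_facts(2) L2_on_continuous[OF open_U bounded_U assms], of _ 1])
  note [measurable] = u_facts(4) continuous_borel_lebesgue_on[OF assms, of U]
  show "(\<lambda>x. u x * p x) \<in> borel_measurable (lebesgue_on U)" by measurable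
qed (simp add: abs_mult)

text \<open>
  Formally \<open>\<integral> \<nabla>u \<bullet> \<nabla>p \<le> l \<integral> u p\<close>, because
  the boundary term has the sign of the outer normal derivative of \<open>u\<close>, which is at
  most zero. The proof tests the equation with \<open>p \<theta>(\<psi> k)\<close>, where
  \<open>\<theta> = arctan (m \<cdot>)\<close> and the \<open>\<psi> k\<close> are test functions
  converging to \<open>u\<close>. Up to an error that tends to zero, the term \<open>p
  \<theta>'(\<psi> k) \<nabla>u \<bullet> \<nabla>\<psi> k\<close> is nonnegative since
  \<open>\<theta>\<close> is increasing, and as \<open>m\<close> grows \<open>\<theta>(u)\<close>
  tends to the constant \<open>pi / 2\<close> on \<open>U\<close>. The arctangent is chosen because
  it is smooth, bounded, Lipschitz, increasing and vanishes at zero.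
\<close>
lemma weak_subsolution:
  assumes p: "C2_jet p p1 p2" and p0: "\<And>x. x \<in> U \<Longrightarrow> 0 \<le> p x"
  shows "- integral_on U (\<lambda>x. u x * (\<Sum>i\<in>UNIV. p2 i x))
     \<le> l * integral_on U (\<lambda>x. u x * p x)"
proof -
  let ?M = "lebesgue_on U"
  let ?I = "integral\<^sup>L ?M"
  obtain g \<psi> where g: "L2_on U g" and psi: "\<And>k::nat. test_function U (\<psi> k)"
    and lim0: "(\<lambda>k. L2_norm_on U (\<lambda>x. \<psi> k x - u x)) \<longlonglongrightarrow> 0"
    and lim1: "(\<lambda>k. L2_norm_on U (\<lambda>x. grad (\<psi> k) x - g x)) \<longlonglongrightarrow> 0"
    using eigen unfolding dirichlet_eigenfunction_def H10_on_def by blast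
  note T = test_function_jet[OF psi]
  note tD = C2_jet_D[OF T(1)]
  have gradc: "continuous_on UNIV (grad (\<psi> k))" for k
    unfolding grad_def by (intro continuous_intros tD)
  have L2psi: "L2_on U (\<psi> k)" "L2_on U (grad (\<psi> k))" for k
    by (intro L2_on_continuous open_U bounded_U tD gradc)+
  have L2d: "L2_on U (\<lambda>x. \<psi> k x - u x)" "L2_on U (\<lambda>x. grad (\<psi> k) x - g x)" for k
    by (intro L2_on_diff L2psi u_facts g)+
  have um[measurable]: "u \<in> borel_measurable ?M" and gm[measurable]: "g \<in> borel_measurable ?M"
    using u_facts(4) L2_onD(1)[OF g] by auto
  have psim[measurable]: "\<psi> k \<in> borel_measurable ?M" "grad (\<psi> k) \<in> borel_measurable ?M" for k
    by (intro continuous_borel_lebesgue_on tD gradc)+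

  \<comment> \<open>\<open>g\<close> is the weak gradient of \<open>u\<close>, tested against a field \<open>\<nabla>q\<close> that need not vanish at the boundary\<close>
  have weak: "?I (\<lambda>x. g x \<bullet> (\<chi> i. q1 i x)) = - ?I (\<lambda>x. u x * (\<Sum>i\<in>UNIV. q2 i x))"
    if q: "C2_jet q q1 q2" for q q1 q2
  proof -
    note qD = C2_jet_D[OF q]
    define G where "G x = (\<chi> i. q1 i x)" for x
    define L where "L x = (\<Sum>i\<in>UNIV. q2 i x)" for x
    have Gc: "continuous_on UNIV G" unfolding G_def by (intro continuous_intros qD)
    have Lc: "continuous_on UNIV L" unfolding L_def by (intro continuous_intros qD)
    have [measurable]: "G \<in> borel_measurable ?M" "L \<in> borel_measurable ?M"
      by (intro continuous_borel_lebesgue_on Gc Lc)+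
    have L2G: "L2_on U G" and L2L: "L2_on U L" by (intro L2_on_continuous open_U bounded_U Gc Lc)+
    have iG: "integrable ?M (\<lambda>x. f x \<bullet> G x)" if "L2_on U f" for f
      using Cauchy_Schwarz_ineq2[of "f _" "G _"] L2_onD(1)[OF that]
      by (intro integrable_L2_product[OF that L2G, of _ 1]) (auto intro!: borel_measurable_inner)
    have iL: "integrable ?M (\<lambda>x. f x * L x)" if "L2_on U f" for f
      using L2_onD(1)[OF that]
      by (intro integrable_L2_product[OF that L2L, of _ 1]) (auto simp: abs_mult)
    have parts: "?I (\<lambda>x. grad (\<psi> k) x \<bullet> G x) + ?I (\<lambda>x. \<psi> k x * L x) = 0" for k
    proof -
      have "?I (\<lambda>x. grad (\<psi> k) x \<bullet> G x) + ?I (\<lambda>x. \<psi> k x * L x) =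
            ?I (\<lambda>x. grad (\<psi> k) x \<bullet> G x + \<psi> k x * L x)"
        by (rule Bochner_Integration.integral_add[symmetric]) (intro iG iL L2psi)+
      also have "\<dots> = 0"
        using by_parts_test_function[OF open_U psi[of k] q]
        by (simp add: grad_def inner_vec_def G_def L_def sum.distrib sum_distrib_left)
      finally show ?thesis .
    qed
    have l1: "(\<lambda>k. ?I (\<lambda>x. (grad (\<psi> k) x - g x) \<bullet> G x)) \<longlonglongrightarrow> 0"
      by (rule L2_pairing_tendsto_0[OF L2G L2d(2) lim1, of _ 1])
         (use Cauchy_Schwarz_ineq2 in \<open>auto simp: mult.commute[of "norm (G _)"]\<close>)
    have l2: "(\<lambda>k. ?I (\<lambda>x. (\<psi> k x - u x) * L x)) \<longlonglongrightarrow> 0"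
      by (rule L2_pairing_tendsto_0[OF L2L L2d(1) lim0, of _ 1]) (auto simp: abs_mult)
    have e1: "?I (\<lambda>x. (grad (\<psi> k) x - g x) \<bullet> G x) = ?I (\<lambda>x. grad (\<psi> k) x \<bullet> G x) - ?I (\<lambda>x. g x \<bullet> G x)" for k
      by (simp add: inner_diff_left Bochner_Integration.integral_diff iG L2psi g)
    have e2: "?I (\<lambda>x. (\<psi> k x - u x) * L x) = ?I (\<lambda>x. \<psi> k x * L x) - ?I (\<lambda>x. u x * L x)" for k
      by (simp add: left_diff_distrib Bochner_Integration.integral_diff iL L2psi u_facts)
    have "(\<lambda>k. ?I (\<lambda>x. (grad (\<psi> k) x - g x) \<bullet> G x) + ?I (\<lambda>x. (\<psi> k x - u x) * L x)) \<longlonglongrightarrow> 0 + 0"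
      by (intro tendsto_add l1 l2)
    moreover have "?I (\<lambda>x. (grad (\<psi> k) x - g x) \<bullet> G x) + ?I (\<lambda>x. (\<psi> k x - u x) * L x)
        = - ?I (\<lambda>x. g x \<bullet> G x) - ?I (\<lambda>x. u x * L x)" for k
      using parts[of k] unfolding e1 e2 by linarith
    ultimately have "(\<lambda>k::nat. - ?I (\<lambda>x. g x \<bullet> G x) - ?I (\<lambda>x. u x * L x)) \<longlonglongrightarrow> 0"
      by simp
    then have "- ?I (\<lambda>x. g x \<bullet> G x) - ?I (\<lambda>x. u x * L x) = 0" by (simp only: LIMSEQ_const_iff)
    then show ?thesis by (simp add: G_def L_def)
  qed

  \<comment> \<open>for \<open>q\<close> with compact support in \<open>U\<close> the classical equation may be used\<close>
  have weak_eq: "?I (\<lambda>x. g x \<bullet> (\<chi> i. q1 i x)) = l * ?I (\<lambda>x. u x * q x)"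
    if q: "C2_jet q q1 q2" and K: "compact K" "K \<subseteq> U" "\<And>x. x \<notin> K \<Longrightarrow> q x = 0" for q q1 q2 K
  proof -
    note qD = C2_jet_D[OF q]
    have i1: "integrable ?M (\<lambda>x. u x * (\<Sum>i\<in>UNIV. q2 i x))" and i2: "integrable ?M (\<lambda>x. u x * q x)"
      by (intro integrable_u_mult continuous_intros qD)+
    have "0 = ?I (\<lambda>x. u x * (\<Sum>i\<in>UNIV. q2 i x) - q x * laplacian u x)"
      using green_compact_support[OF open_U u_facts(1) q K] by simp
    also have "\<dots> = ?I (\<lambda>x. u x * (\<Sum>i\<in>UNIV. q2 i x) + l * (u x * q x))"
      by (rule Bochner_Integration.integral_cong) (auto simp: u_facts(3) algebra_simps)
    also have "\<dots> = ?I (\<lambda>x. u x * (\<Sum>i\<in>UNIV. q2 i x)) + l * ?I (\<lambda>x. u x * q x)"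
      using i1 i2 by simp
    finally show ?thesis using weak[OF q] by linarith
  qed

  note pD = C2_jet_D[OF p]
  define G where "G x = (\<chi> i. p1 i x)" for x
  have Gc: "continuous_on UNIV G" unfolding G_def by (intro continuous_intros pD)
  obtain B where B: "B \<ge> 0" "\<And>x. x \<in> U \<Longrightarrow> \<bar>p x\<bar> \<le> B"
    using bounded_on_bounded[OF bounded_U pD(1)] by blast
  obtain B' where B': "B' \<ge> 0" "\<And>x. x \<in> U \<Longrightarrow> norm (G x) \<le> B'"
    using bounded_on_bounded[OF bounded_U continuous_on_norm[OF Gc]] by auto
  have pm[measurable]: "p \<in> borel_measurable ?M" and Gm[measurable]: "G \<in> borel_measurable ?M"
    by (intro continuous_borel_lebesgue_on pD Gc)+
  have L2p: "L2_on U p" and L2G: "L2_on U G" by (intro L2_on_continuous open_U bounded_U pD Gc)+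
  define R where "R x = g x \<bullet> G x" for x
  have Rm[measurable]: "R \<in> borel_measurable ?M" unfolding R_def by measurable
  have Rb: "\<bar>R x\<bar> \<le> norm (g x) * norm (G x)" for x unfolding R_def by (rule Cauchy_Schwarz_ineq2)
  have iR: "integrable ?M R" by (rule integrable_L2_product[OF g L2G, of _ 1]) (use Rb in auto)
  have iup: "integrable ?M (\<lambda>x. u x * p x)" by (intro integrable_u_mult pD)

  \<comment> \<open>the limit in \<open>k\<close> for a fixed steepness \<open>m\<close>\<close>
  have step_m: "?I (\<lambda>x. arctan (m * u x) * R x) \<le> l * ?I (\<lambda>x. arctan (m * u x) * (u x * p x))"
    if m: "m > 0" for m :: real
  proof -
    define A where "A k x = arctan (m * \<psi> k x)" for k x
    define A' where "A' x = arctan (m * u x)" for x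
    define D where "D k x = m / (1 + (m * \<psi> k x)\<^sup>2)" for k x
    have den: "1 + z\<^sup>2 > 0" for z :: real by (simp add: add_pos_nonneg)
    have D: "0 \<le> D k x" "D k x \<le> m" for k x
      using m den[of "m * \<psi> k x"] by (auto simp: D_def divide_le_eq)
    have Dc: "continuous_on UNIV (D k)" for k
      unfolding D_def using den by (intro continuous_intros tD) (auto simp: less_imp_neq[symmetric])
    have [measurable]: "D k \<in> borel_measurable ?M" "A k \<in> borel_measurable ?M" "A' \<in> borel_measurable ?M" for k
      unfolding A_def A'_def by (intro continuous_borel_lebesgue_on[OF Dc]) measurable
    define q where "q k x = p x * A k x" for k x
    define A1 where "A1 k i x = D k x * partial_deriv i (\<psi> k) x" for k i x
    define A2 where "A2 k i x = (- m * (2 * (m * \<psi> k x) * m) / (1 + (m * \<psi> k x)\<^sup>2)\<^sup>2 * partial_deriv i (\<psi> k) x) * partial_deriv i (\<psi> k) x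
       + D k x * partial_deriv i (partial_deriv i (\<psi> k)) x" for k i x
    define q1 where "q1 k i x = p1 i x * A k x + p x * A1 k i x" for k i x
    define q2 where "q2 k i x = (p2 i x * A k x + p1 i x * A1 k i x) + (p1 i x * A1 k i x + p x * A2 k i x)" for k i x
    have jet: "C2_jet (q k) (q1 k) (q2 k)" for k
      unfolding C2_jet_def
    proof (intro conjI allI)
      have Ac: "continuous_on UNIV (A k)" unfolding A_def by (intro continuous_intros tD)
      have A1c: "continuous_on UNIV (A1 k i)" for i unfolding A1_def by (intro continuous_intros tD Dc)
      have A2c: "continuous_on UNIV (A2 k i)" for i
        unfolding A2_def using den by (intro continuous_intros tD Dc) (auto simp: less_imp_neq[symmetric])
      show "continuous_on UNIV (q k)" unfolding q_def by (intro continuous_intros pD Ac)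
      fix i
      show "continuous_on UNIV (q1 k i)" "continuous_on UNIV (q2 k i)"
        unfolding q1_def q2_def by (intro continuous_intros pD Ac A1c A2c)+
      fix x
      have dA: "has_partial i (A k) (A1 k i x) x" for x
        unfolding A_def A1_def
      proof (rule has_partial_chain[OF tD(4)])
        show "((\<lambda>s. arctan (m * s)) has_real_derivative D k x) (at (\<psi> k x))"
          using den[of "m * \<psi> k x"] by (auto intro!: derivative_eq_intros simp: D_def divide_inverse)
      qed
      have dA1: "has_partial i (A1 k i) (A2 k i x) x"
        unfolding A1_def A2_def
      proof (intro has_partial_mult tD)
        show "has_partial i (D k) (- m * (2 * (m * \<psi> k x) * m) / (1 + (m * \<psi> k x)\<^sup>2)\<^sup>2 * partial_deriv i (\<psi> k) x) x"
          unfolding D_def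
        proof (rule has_partial_chain[OF tD(4)])
          show "((\<lambda>s. m / (1 + (m * s)\<^sup>2)) has_real_derivative - m * (2 * (m * \<psi> k x) * m) / (1 + (m * \<psi> k x)\<^sup>2)\<^sup>2) (at (\<psi> k x))"
            using den[of "m * \<psi> k x"] by (auto intro!: derivative_eq_intros simp: power2_eq_square)
        qed
      qed
      show "has_partial i (q k) (q1 k i x) x"
        unfolding q_def q1_def by (intro has_partial_mult pD dA)
      show "has_partial i (q1 k i) (q2 k i x) x"
        unfolding q1_def q2_def by (intro has_partial_add has_partial_mult pD dA dA1)
    qed
    have iA: "integrable ?M (\<lambda>x. a x * w x)"
      if "integrable ?M w" "a \<in> borel_measurable ?M" "\<And>x. \<bar>a x\<bar> \<le> pi / 2" for a w
    proof (rule Bochner_Integration.integrable_bound[where f="\<lambda>x. pi / 2 * \<bar>w x\<bar>"])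
      note [measurable] = borel_measurable_integrable[OF that(1)] that(2)
      show "integrable ?M (\<lambda>x. pi / 2 * \<bar>w x\<bar>)" using that(1) by auto
      show "(\<lambda>x. a x * w x) \<in> borel_measurable ?M" by measurable
      have "norm (a x * w x) \<le> norm (pi / 2 * \<bar>w x\<bar>)" for x
        using mult_right_mono[OF that(3)[of x] abs_ge_zero[of "w x"]] by (simp add: abs_mult)
      then show "AE x in ?M. norm (a x * w x) \<le> norm (pi / 2 * \<bar>w x\<bar>)" by (intro AE_I2)
    qed
    have Ab: "\<bar>A k x\<bar> \<le> pi / 2" "\<bar>A' x\<bar> \<le> pi / 2" for k x
      using arctan_bounded[of "m * \<psi> k x"] arctan_bounded[of "m * u x"] unfolding A_def A'_def by auto
    have main: "?I (\<lambda>x. A k x * R x) + ?I (\<lambda>x. p x * D k x * (g x \<bullet> (grad (\<psi> k) x - g x)))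
        \<le> l * ?I (\<lambda>x. A k x * (u x * p x))" for k
    proof -
      have e: "?I (\<lambda>x. g x \<bullet> (\<chi> i. q1 k i x)) = l * ?I (\<lambda>x. u x * q k x)"
      proof (rule weak_eq[OF jet T(2)[of k] T(3)])
        show "q k x = 0" if "x \<notin> closure {x. \<psi> k x \<noteq> 0}" for x
          using T(4)[OF that] by (simp add: q_def A_def)
      qed
      have q1e: "g x \<bullet> (\<chi> i. q1 k i x) = A k x * R x + p x * D k x * (g x \<bullet> grad (\<psi> k) x)" for x
      proof -
        have "(\<chi> i. q1 k i x) = A k x *\<^sub>R G x + (p x * D k x) *\<^sub>R grad (\<psi> k) x"
          by (simp add: vec_eq_iff q1_def A1_def G_def grad_def mult.commute)
        then show ?thesis by (simp add: R_def inner_add_right)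
      qed
      have i1: "integrable ?M (\<lambda>x. A k x * R x)" by (rule iA[OF iR _ Ab(1)]) measurable
      have PD: "\<bar>p x * D k x\<bar> \<le> B * m" if "x \<in> U" for x
        using B(2)[OF that] D(1)[of k x] D(2)[of k x] B(1) by (simp add: abs_mult mult_mono)
      have i2: "integrable ?M (\<lambda>x. p x * D k x * (g x \<bullet> v x))" if v: "L2_on U v" for v
      proof (rule integrable_L2_product[OF g v, of _ "B * m"])
        have [measurable]: "v \<in> borel_measurable ?M" using L2_onD(1)[OF v] .
        show "(\<lambda>x. p x * D k x * (g x \<bullet> v x)) \<in> borel_measurable ?M" by measurable
        show "\<bar>p x * D k x * (g x \<bullet> v x)\<bar> \<le> B * m * (norm (g x) * norm (v x))" if "x \<in> U" for x
          using PD[OF that] Cauchy_Schwarz_ineq2[of "g x" "v x"] B(1) m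
          by (subst abs_mult) (intro mult_mono, auto)
      qed
      have "?I (\<lambda>x. A k x * R x) + ?I (\<lambda>x. p x * D k x * (g x \<bullet> (grad (\<psi> k) x - g x))) =
        ?I (\<lambda>x. A k x * R x + p x * D k x * (g x \<bullet> (grad (\<psi> k) x - g x)))"
        by (rule Bochner_Integration.integral_add[symmetric]) (intro i1 i2 L2d)+
      also have "\<dots> \<le> ?I (\<lambda>x. A k x * R x + p x * D k x * (g x \<bullet> grad (\<psi> k) x))"
      proof (rule integral_mono)
        show "integrable ?M (\<lambda>x. A k x * R x + p x * D k x * (g x \<bullet> (grad (\<psi> k) x - g x)))"
          "integrable ?M (\<lambda>x. A k x * R x + p x * D k x * (g x \<bullet> grad (\<psi> k) x))"
          by (intro Bochner_Integration.integrable_add i1 i2 L2d L2psi)+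
        fix x assume "x \<in> space ?M"
        then have "0 \<le> p x * D k x * (g x \<bullet> g x)" using p0 D by (intro mult_nonneg_nonneg) auto
        then show "A k x * R x + p x * D k x * (g x \<bullet> (grad (\<psi> k) x - g x)) \<le>
            A k x * R x + p x * D k x * (g x \<bullet> grad (\<psi> k) x)"
          by (simp add: inner_diff_right right_diff_distrib)
      qed
      also have "\<dots> = l * ?I (\<lambda>x. A k x * (u x * p x))"
      proof -
        have "(\<lambda>x. u x * q k x) = (\<lambda>x. A k x * (u x * p x))" by (simp add: q_def fun_eq_iff)
        then show ?thesis using e unfolding q1e by simp
      qed
      finally show ?thesis .
    qed
    have Ad: "\<bar>A k x - A' x\<bar> \<le> m * \<bar>\<psi> k x - u x\<bar>" for k x
    proof -
      have "\<bar>A k x - A' x\<bar> \<le> \<bar>m * \<psi> k x - m * u x\<bar>" unfolding A_def A'_def by (rule arctan_lipschitz)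
      also have "\<dots> = m * \<bar>\<psi> k x - u x\<bar>" using m by (simp add: abs_mult flip: right_diff_distrib)
      finally show ?thesis .
    qed
    have lim: "(\<lambda>k. ?I (\<lambda>x. A k x * w x)) \<longlonglongrightarrow> ?I (\<lambda>x. A' x * w x)"
      if w: "integrable ?M w" and f: "L2_on U f" and C: "C \<ge> 0" and
        b: "\<And>x. x \<in> U \<Longrightarrow> \<bar>w x\<bar> \<le> C * norm (f x)" for w and f :: "real^'n \<Rightarrow> real" and C
    proof -
      note [measurable] = borel_measurable_integrable[OF w]
      have "(\<lambda>k. ?I (\<lambda>x. (A k x - A' x) * w x)) \<longlonglongrightarrow> 0"
      proof (rule L2_pairing_tendsto_0[OF f L2d(1) lim0, of _ "m * C"])
        show "(\<lambda>x. (A k x - A' x) * w x) \<in> borel_measurable ?M" for k by measurable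
        show "0 \<le> m * C" using m C by simp
        show "\<bar>(A k x - A' x) * w x\<bar> \<le> m * C * (norm (f x) * norm (\<psi> k x - u x))" if "x \<in> U" for k x
        proof -
          have "\<bar>(A k x - A' x) * w x\<bar> \<le> (m * \<bar>\<psi> k x - u x\<bar>) * (C * norm (f x))"
            unfolding abs_mult using m by (intro mult_mono Ad b that) auto
          then show ?thesis by (simp add: ac_simps)
        qed
      qed
      moreover have "?I (\<lambda>x. (A k x - A' x) * w x) = ?I (\<lambda>x. A k x * w x) - ?I (\<lambda>x. A' x * w x)" for k
        using iA[OF w, of "A k"] iA[OF w, of A'] Ab
        by (simp add: left_diff_distrib Bochner_Integration.integral_diff)
      ultimately show ?thesis by (simp add: LIM_zero_iff)
    qed
    have lR: "(\<lambda>k. ?I (\<lambda>x. A k x * R x)) \<longlonglongrightarrow> ?I (\<lambda>x. A' x * R x)"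
    proof (rule lim[OF iR _ B'(1), of "\<lambda>x. norm (g x)"])
      show "L2_on U (\<lambda>x. norm (g x))" using g unfolding L2_on_def by auto
      fix x assume "x \<in> U"
      then show "\<bar>R x\<bar> \<le> B' * norm (norm (g x))"
        using Rb[of x] B'(2)[of x] mult_left_mono[of "norm (G x)" B' "norm (g x)"] by (simp add: mult.commute)
    qed
    have lu: "(\<lambda>k. ?I (\<lambda>x. A k x * (u x * p x))) \<longlonglongrightarrow> ?I (\<lambda>x. A' x * (u x * p x))"
    proof (rule lim[OF iup u_facts(2) B(1)])
      fix x assume "x \<in> U"
      then show "\<bar>u x * p x\<bar> \<le> B * norm (u x)"
        using B(2)[of x] mult_left_mono[of "\<bar>p x\<bar>" B "\<bar>u x\<bar>"] by (simp add: abs_mult mult.commute)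
    qed
    have lr: "(\<lambda>k. ?I (\<lambda>x. p x * D k x * (g x \<bullet> (grad (\<psi> k) x - g x)))) \<longlonglongrightarrow> 0"
    proof (rule L2_pairing_tendsto_0[OF g L2d(2) lim1, of _ "B * m"])
      show "(\<lambda>x. p x * D k x * (g x \<bullet> (grad (\<psi> k) x - g x))) \<in> borel_measurable ?M" for k by measurable
      show "0 \<le> B * m" using B m by simp
      show "\<bar>p x * D k x * (g x \<bullet> (grad (\<psi> k) x - g x))\<bar> \<le> B * m * (norm (g x) * norm (grad (\<psi> k) x - g x))"
        if "x \<in> U" for k x
      proof -
        have "\<bar>p x * D k x\<bar> \<le> B * m"
          using B(2)[OF that] D(1)[of k x] D(2)[of k x] B(1) by (simp add: abs_mult mult_mono)
        then show ?thesis
          using Cauchy_Schwarz_ineq2[of "g x" "grad (\<psi> k) x - g x"] B(1) m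
          by (subst abs_mult) (intro mult_mono, auto)
      qed
    qed
    have "?I (\<lambda>x. A' x * R x) + 0 \<le> l * ?I (\<lambda>x. A' x * (u x * p x))"
      by (rule LIMSEQ_le[OF tendsto_add[OF lR lr] tendsto_mult_left[OF lu]]) (use main in auto)
    then show ?thesis by (simp add: A'_def)
  qed

  \<comment> \<open>the limit in \<open>m\<close>\<close>
  have limm: "(\<lambda>m. ?I (\<lambda>x. arctan (real (Suc m) * u x) * w x)) \<longlonglongrightarrow> ?I (\<lambda>x. pi / 2 * w x)"
    if w: "integrable ?M w" for w
  proof (rule integral_dominated_convergence[where w="\<lambda>x. pi / 2 * \<bar>w x\<bar>"])
    note [measurable] = borel_measurable_integrable[OF w]
    show "(\<lambda>x. pi / 2 * w x) \<in> borel_measurable ?M" by measurable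
    show "(\<lambda>x. arctan (real (Suc m) * u x) * w x) \<in> borel_measurable ?M" for m by measurable
    show "integrable ?M (\<lambda>x. pi / 2 * \<bar>w x\<bar>)" using w by auto
    have "(\<lambda>m. arctan (real (Suc m) * u x) * w x) \<longlonglongrightarrow> pi / 2 * w x" if "x \<in> U" for x
    proof (intro tendsto_mult tendsto_const)
      have "filterlim (\<lambda>m. real (Suc m) * u x) at_top sequentially"
        using pos[OF that] filterlim_real_sequentially
        by (intro filterlim_at_top_mult_tendsto_pos[OF tendsto_const _ ] filterlim_compose[OF filterlim_real_sequentially filterlim_Suc]) auto
      then show "(\<lambda>m. arctan (real (Suc m) * u x)) \<longlonglongrightarrow> pi / 2"
        by (rule filterlim_compose[OF tendsto_arctan_at_top])
    qed
    then show "AE x in ?M. (\<lambda>m. arctan (real (Suc m) * u x) * w x) \<longlonglongrightarrow> pi / 2 * w x"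
      by (auto intro!: AE_I2)
    have at: "\<bar>arctan y\<bar> \<le> pi / 2" for y using arctan_bounded[of y] by auto
    have "norm (arctan (real (Suc m) * u x) * w x) \<le> pi / 2 * \<bar>w x\<bar>" for m x
      using mult_right_mono[OF at[of "real (Suc m) * u x"] abs_ge_zero[of "w x"]] by (simp only: real_norm_def abs_mult)
    then show "AE x in ?M. norm (arctan (real (Suc m) * u x) * w x) \<le> pi / 2 * \<bar>w x\<bar>" for m
      by (intro AE_I2)
  qed
  have "?I (\<lambda>x. pi / 2 * R x) \<le> l * ?I (\<lambda>x. pi / 2 * (u x * p x))"
    by (rule LIMSEQ_le[OF limm[OF iR] tendsto_mult_left[OF limm[OF iup]]]) (use step_m in auto)
  then have "pi / 2 * ?I R \<le> pi / 2 * (l * ?I (\<lambda>x. u x * p x))" by simp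
  then have "?I R \<le> l * ?I (\<lambda>x. u x * p x)"
    by (rule mult_left_le_imp_le) simp
  then show ?thesis using weak[OF p] unfolding R_def G_def by simp
qed

end

section \<open>The eigenfunction restricted to a subdomain is a weak supersolution\<close>

lemma DERIV_comp_max_0:
  fixes f f' :: "real \<Rightarrow> real"
  assumes d: "\<And>z. (f has_real_derivative f' z) (at z)" and z: "f 0 = 0" "f' 0 = 0"
  shows "((\<lambda>s. f (max 0 s)) has_real_derivative f' (max 0 s)) (at s)"
proof -
  consider "s > 0" | "s < 0" | "s = 0" by linarith
  then show ?thesis
  proof cases
    case 1
    have "(f has_real_derivative f' s) (at s)" by (rule d)
    then have "((\<lambda>s. f (max 0 s)) has_real_derivative f' s) (at s)"
      by (rule has_field_derivative_transform_within_open[where S="{0<..}"]) (use 1 in auto)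
    then show ?thesis using 1 by simp
  next
    case 2
    have "((\<lambda>s. 0) has_real_derivative 0) (at s)" by simp
    then have "((\<lambda>s. f (max 0 s)) has_real_derivative 0) (at s)"
      by (rule has_field_derivative_transform_within_open[where S="{..<0}"]) (use 2 z in auto)
    then show ?thesis using 2 z by simp
  next
    case 3
    have "((\<lambda>h. f h / h) \<longlongrightarrow> 0) (at 0)" using d[of 0] z unfolding DERIV_def by simp
    then have "((\<lambda>h. f (max 0 h) / h) \<longlongrightarrow> 0) (at 0)"
    proof (rule Lim_null_comparison[rotated, OF tendsto_norm_zero])
      have "norm (f (max 0 h) / h) \<le> norm (f h / h)" for h
        using z by (cases "h \<le> 0") (simp_all add: max_def divide_nonneg_nonneg flip: abs_divide)
      then show "\<forall>\<^sub>F h in at 0. norm (f (max 0 h) / h) \<le> norm (f h / h)" by simp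
    qed
    then show ?thesis using 3 z unfolding DERIV_def by simp
  qed
qed

text \<open>
  A convex \<open>C\<^sup>2\<close> function that vanishes up to \<open>e\<close> and tends to the
  identity on the positive reals as \<open>e\<close> tends to zero: \<open>z - e arctan (z /
  e)\<close> has a double zero of its derivative at \<open>z = 0\<close>, so it may be glued with
  zero there.
\<close>
definition cutoff :: "real \<Rightarrow> real \<Rightarrow> real" where
  "cutoff e s = max 0 (s - e) - e * arctan (max 0 (s - e) / e)"
definition cutoff' :: "real \<Rightarrow> real \<Rightarrow> real" where
  "cutoff' e s = (max 0 (s - e))\<^sup>2 / (e\<^sup>2 + (max 0 (s - e))\<^sup>2)"
definition cutoff'' :: "real \<Rightarrow> real \<Rightarrow> real" where
  "cutoff'' e s = 2 * e\<^sup>2 * max 0 (s - e) / (e\<^sup>2 + (max 0 (s - e))\<^sup>2)\<^sup>2"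

lemma cutoff_den: "e > 0 \<Longrightarrow> 0 < e\<^sup>2 + z\<^sup>2" for e z :: real
  by (simp add: add_pos_nonneg)

lemma DERIV_cutoff:
  assumes "e > 0"
  shows "(cutoff e has_real_derivative cutoff' e s) (at s)"
proof -
  have 1: "((\<lambda>z. z - e * arctan (z / e)) has_real_derivative z\<^sup>2 / (e\<^sup>2 + z\<^sup>2)) (at z)" for z
    using cutoff_den[OF assms, of z] assms
    by (auto intro!: derivative_eq_intros simp: divide_simps power2_eq_square add_eq_0_iff_both_eq_0)
  have "((\<lambda>s. max 0 s - e * arctan (max 0 s / e)) has_real_derivative
      (max 0 (s - e))\<^sup>2 / (e\<^sup>2 + (max 0 (s - e))\<^sup>2)) (at (s - e))"
    by (rule DERIV_comp_max_0[OF 1]) auto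
  then have "((\<lambda>s. max 0 (s - e) - e * arctan (max 0 (s - e) / e)) has_real_derivative
      (max 0 (s - e))\<^sup>2 / (e\<^sup>2 + (max 0 (s - e))\<^sup>2)) (at s)"
    using DERIV_shift[of "\<lambda>s. max 0 s - e * arctan (max 0 s / e)" _ s "- e"] by simp
  then show ?thesis unfolding cutoff_def[abs_def] cutoff'_def .
qed

lemma DERIV_cutoff':
  assumes "e > 0"
  shows "(cutoff' e has_real_derivative cutoff'' e s) (at s)"
proof -
  have 1: "((\<lambda>z. z\<^sup>2 / (e\<^sup>2 + z\<^sup>2)) has_real_derivative 2 * e\<^sup>2 * z / (e\<^sup>2 + z\<^sup>2)\<^sup>2) (at z)" for z
    using cutoff_den[OF assms, of z]
    by (auto intro!: derivative_eq_intros simp: power2_eq_square algebra_simps)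
  have "((\<lambda>s. (max 0 s)\<^sup>2 / (e\<^sup>2 + (max 0 s)\<^sup>2)) has_real_derivative
      2 * e\<^sup>2 * max 0 (s - e) / (e\<^sup>2 + (max 0 (s - e))\<^sup>2)\<^sup>2) (at (s - e))"
    by (rule DERIV_comp_max_0[OF 1]) auto
  then have "((\<lambda>s. (max 0 (s - e))\<^sup>2 / (e\<^sup>2 + (max 0 (s - e))\<^sup>2)) has_real_derivative
      2 * e\<^sup>2 * max 0 (s - e) / (e\<^sup>2 + (max 0 (s - e))\<^sup>2)\<^sup>2) (at s)"
    using DERIV_shift[of "\<lambda>s. (max 0 s)\<^sup>2 / (e\<^sup>2 + (max 0 s)\<^sup>2)" _ s "- e"] by simp
  then show ?thesis unfolding cutoff'_def[abs_def] cutoff''_def .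
qed

lemma cutoff_zero: "s \<le> e \<Longrightarrow> cutoff e s = 0" "s \<le> e \<Longrightarrow> cutoff' e s = 0" "s \<le> e \<Longrightarrow> cutoff'' e s = 0"
  by (auto simp: cutoff_def cutoff'_def cutoff''_def)

lemma cutoff_bounds:
  assumes "e > 0"
  shows "0 \<le> cutoff' e s" "cutoff' e s \<le> 1" "0 \<le> cutoff'' e s" "s \<ge> 0 \<Longrightarrow> \<bar>cutoff e s\<bar> \<le> s"
proof -
  note d = cutoff_den[OF assms, of "max 0 (s - e)"]
  show "0 \<le> cutoff' e s" "0 \<le> cutoff'' e s" unfolding cutoff'_def cutoff''_def by auto
  show "cutoff' e s \<le> 1" unfolding cutoff'_def using d by (simp add: divide_le_eq)
  assume s: "s \<ge> 0"
  define z where "z = max 0 (s - e)"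
  have z: "0 \<le> z" "z \<le> s" using s assms by (auto simp: z_def)
  have "0 \<le> arctan (z / e)" using z assms by simp
  moreover have "arctan (z / e) \<le> z / e"
    using arctan_lipschitz[of "z / e" 0] z assms by simp
  ultimately have "0 \<le> e * arctan (z / e)" "e * arctan (z / e) \<le> z"
    using assms by (auto simp: field_simps)
  then show "\<bar>cutoff e s\<bar> \<le> s" using z unfolding cutoff_def z_def[symmetric] by auto
qed

lemma continuous_cutoff:
  assumes "e > 0"
  shows "continuous_on A (cutoff e)" "continuous_on A (cutoff' e)" "continuous_on A (cutoff'' e)"
proof -
  have "\<And>z. e\<^sup>2 + z\<^sup>2 \<noteq> 0" using cutoff_den[OF assms] by (metis less_irrefl)
  then show "continuous_on A (cutoff e)" "continuous_on A (cutoff' e)" "continuous_on A (cutoff'' e)"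
    unfolding cutoff_def[abs_def] cutoff'_def[abs_def] cutoff''_def[abs_def]
    using assms by (auto intro!: continuous_intros)
qed

lemma cutoff_tendsto:
  assumes "s > 0"
  shows "(\<lambda>k. cutoff (1 / real (Suc k)) s) \<longlonglongrightarrow> s" "(\<lambda>k. cutoff' (1 / real (Suc k)) s) \<longlonglongrightarrow> 1"
proof -
  have e: "(\<lambda>k. 1 / real (Suc k)) \<longlonglongrightarrow> 0"
    using LIMSEQ_inverse_real_of_nat by (simp add: inverse_eq_divide)
  have z: "(\<lambda>k. max 0 (s - 1 / real (Suc k))) \<longlonglongrightarrow> s"
    using tendsto_max[OF tendsto_const[of 0] tendsto_diff[OF tendsto_const[of s] e]] assms by simp
  have "(\<lambda>k. (max 0 (s - 1 / real (Suc k)))\<^sup>2 / ((1 / real (Suc k))\<^sup>2 + (max 0 (s - 1 / real (Suc k)))\<^sup>2)) \<longlonglongrightarrow> s\<^sup>2 / (0\<^sup>2 + s\<^sup>2)"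
    by (intro tendsto_intros z e) (use assms in simp)
  then show "(\<lambda>k. cutoff' (1 / real (Suc k)) s) \<longlonglongrightarrow> 1" using assms by (simp add: cutoff'_def)
  have "(\<lambda>k. 1 / real (Suc k) * arctan (max 0 (s - 1 / real (Suc k)) / (1 / real (Suc k)))) \<longlonglongrightarrow> 0"
  proof (rule Lim_null_comparison)
    have at: "\<bar>arctan y\<bar> \<le> pi / 2" for y using arctan_bounded[of y] by auto
    have "norm (1 / real (Suc k) * arctan y) \<le> 1 / real (Suc k) * (pi / 2)" for k y
      unfolding real_norm_def abs_mult using at[of y] by (intro mult_mono) auto
    then show "\<forall>\<^sub>F k in sequentially. norm (1 / real (Suc k) * arctan (max 0 (s - 1 / real (Suc k)) / (1 / real (Suc k)))) \<le> 1 / real (Suc k) * (pi / 2)"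
      by (intro always_eventually allI)
    show "(\<lambda>k. 1 / real (Suc k) * (pi / 2)) \<longlonglongrightarrow> 0" using tendsto_mult_left_zero[OF e] .
  qed
  from tendsto_diff[OF z this] show "(\<lambda>k. cutoff (1 / real (Suc k)) s) \<longlonglongrightarrow> s"
    by (simp add: cutoff_def)
qed

lemma Ck2_on_subset: "Ck_on 2 U u \<Longrightarrow> V \<subseteq> U \<Longrightarrow> Ck_on 2 V u"
  unfolding numeral_2_eq_2 by (auto intro: differentiable_on_subset continuous_on_subset)

lemma integrable_lebesgue_on_subset:
  fixes f :: "real^'n \<Rightarrow> real"
  assumes "open U" "open V" "V \<subseteq> U" "integrable (lebesgue_on U) f"
  shows "integrable (lebesgue_on V) f"
proof -
  have s: "U \<in> sets lebesgue" "V \<in> sets lebesgue" using assms by auto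
  have "integrable lebesgue (\<lambda>x. indicator U x *\<^sub>R f x)"
    using assms(4) s by (subst (asm) integrable_restrict_space) auto
  then have "integrable lebesgue (\<lambda>x. indicator V x *\<^sub>R (indicator U x *\<^sub>R f x))"
    by (rule integrable_mult_indicator[OF s(2)])
  moreover have "(\<lambda>x. indicator V x *\<^sub>R (indicator U x *\<^sub>R f x)) = (\<lambda>x. indicator V x *\<^sub>R f x)"
    using assms(3) by (auto simp: fun_eq_iff indicator_def)
  ultimately show ?thesis using s by (subst integrable_restrict_space) auto
qed

context positive_eigenfunction
begin

lemma integrable_u_mult_subset:
  assumes "open V" "V \<subseteq> U" "continuous_on UNIV p"
  shows "integrable (lebesgue_on V) (\<lambda>x. u x * p x)"
  by (rule integrable_lebesgue_on_subset[OF open_U assms(1,2) integrable_u_mult[OF assms(3)]])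

text \<open>
  On \<open>V\<close> the boundary term of Green's formula has the favourable sign because \<open>u
  > 0\<close> while \<open>p\<close> vanishes on the boundary and is positive inside. To avoid
  boundary integrals, \<open>p\<close> is replaced by the convex cutoff \<open>h(p)\<close>, which
  has compact support in \<open>V\<close>; by convexity \<open>\<Delta> h(p) \<ge> h'(p)
  \<Delta>p\<close>, and \<open>h'(p)\<close> tends to \<open>1\<close> wherever \<open>p >
  0\<close>.
\<close>
lemma weak_supersolution_pos:
  assumes V: "open V" "V \<subseteq> U" and p: "C2_jet p p1 p2"
    and p0: "\<And>x. x \<in> V \<Longrightarrow> 0 < p x" and pf: "\<And>x. x \<in> frontier V \<Longrightarrow> p x = 0"
  shows "integral_on V (\<lambda>x. u x * (\<Sum>i\<in>UNIV. p2 i x))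
     \<le> - l * integral_on V (\<lambda>x. u x * p x)"
proof -
  let ?M = "lebesgue_on V"
  let ?I = "integral\<^sup>L ?M"
  note pD = C2_jet_D[OF p]
  define L where "L x = (\<Sum>i\<in>UNIV. p2 i x)" for x
  have Lc: "continuous_on UNIV L" unfolding L_def by (intro continuous_intros pD)
  have u1: "u x > 0" if "x \<in> V" for x using that V pos by blast
  have comp: "continuous_on UNIV (\<lambda>x. h (p x))" if "continuous_on UNIV h" for h :: "real \<Rightarrow> real"
    using continuous_on_compose2[OF that pD(1)] by simp
  have bV: "bounded V" using bounded_U V(2) bounded_subset by blast
  have main: "?I (\<lambda>x. u x * (cutoff' e (p x) * L x)) \<le> - l * ?I (\<lambda>x. u x * cutoff e (p x))"
    if e: "e > 0" for e
  proof -
    define K where "K = {x \<in> closure V. p x \<ge> e}"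
    have "closed K"
    proof -
      have "K = closure V \<inter> p -` {e..}" by (auto simp: K_def)
      moreover have "closed (p -` {e..})" using continuous_closed_vimage[of "{e..}" p] pD(1)
        by (auto simp: continuous_on_eq_continuous_at)
      ultimately show ?thesis using closed_Int[OF closed_closure, of "p -` {e..}" V] by simp
    qed
    moreover have "bounded K" using bV bounded_closure bounded_subset K_def by (metis (no_types, lifting) mem_Collect_eq subsetI)
    ultimately have K: "compact K" by (simp add: compact_eq_bounded_closed)
    have KV: "K \<subseteq> V"
      using pf e closure_Un_frontier[of V] unfolding K_def by fastforce
    define q where "q x = (if x \<in> V then cutoff e (p x) else 0)" for x
    define f1 where "f1 i x = cutoff' e (p x) * p1 i x" for i x
    define f2 where "f2 i x = cutoff'' e (p x) * p1 i x * p1 i x + cutoff' e (p x) * p2 i x" for i x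
    define q1 where "q1 i x = (if x \<in> V then f1 i x else 0)" for i x
    define q2 where "q2 i x = (if x \<in> V then f2 i x else 0)" for i x
    have le: "p x \<le> e" if "x \<in> V" "x \<notin> K" for x
      using that closure_subset[of V] by (auto simp: K_def)
    have z: "q x = 0" "q1 i x = 0" "q2 i x = 0" if "x \<notin> K" for x i
      using le[OF _ that] cutoff_zero by (auto simp: q_def q1_def q2_def f1_def f2_def)
    note hc = comp[OF continuous_cutoff(1)[OF e]] comp[OF continuous_cutoff(2)[OF e]] comp[OF continuous_cutoff(3)[OF e]]
    have f1c: "continuous_on UNIV (f1 i)" and f2c: "continuous_on UNIV (f2 i)" for i
      unfolding f1_def f2_def by (intro continuous_intros hc pD)+
    have zV: "f1 i x = 0" "f2 i x = 0" "cutoff e (p x) = 0" if "x \<in> V" "x \<notin> K" for x i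
      using le[OF that] cutoff_zero by (auto simp: f1_def f2_def)
    have jet: "C2_jet q q1 q2"
      unfolding C2_jet_def
    proof (intro conjI allI)
      show "continuous_on UNIV q" unfolding q_def
        by (rule continuous_on_extend_zero[OF V(1) \<open>closed K\<close> KV continuous_on_subset[OF hc(1)] zV(3)]) auto
      fix i
      show "continuous_on UNIV (q1 i)" unfolding q1_def
        by (rule continuous_on_extend_zero[OF V(1) \<open>closed K\<close> KV continuous_on_subset[OF f1c] zV(1)]) auto
      show "continuous_on UNIV (q2 i)" unfolding q2_def
        by (rule continuous_on_extend_zero[OF V(1) \<open>closed K\<close> KV continuous_on_subset[OF f2c] zV(2)]) auto
      fix x
      have d1: "has_partial i (\<lambda>x. cutoff e (p x)) (f1 i x) x"
        unfolding f1_def by (rule has_partial_chain[OF pD(4) DERIV_cutoff[OF e]])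
      have d2: "has_partial i (f1 i) (f2 i x) x"
        unfolding f1_def f2_def
        by (rule has_partial_mult[OF has_partial_chain[OF pD(4) DERIV_cutoff'[OF e]] pD(5)])
      show "has_partial i q (q1 i x) x"
      proof (cases "x \<in> V")
        case True
        then show ?thesis using has_partial_cong_open[OF d1 V(1) True, of q] by (simp add: q_def q1_def)
      next
        case False
        have "has_partial i q 0 x"
          by (rule has_partial_vanish[OF \<open>closed K\<close>]) (use False KV z in auto)
        then show ?thesis using False by (simp add: q1_def)
      qed
      show "has_partial i (q1 i) (q2 i x) x"
      proof (cases "x \<in> V")
        case True
        then show ?thesis using has_partial_cong_open[OF d2 V(1) True, of "q1 i"] by (simp add: q1_def q2_def)
      next
        case False
        have "has_partial i (q1 i) 0 x"
          by (rule has_partial_vanish[OF \<open>closed K\<close>]) (use False KV z in auto)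
        then show ?thesis using False by (simp add: q2_def)
      qed
    qed
    have i2: "integrable ?M (\<lambda>x. u x * (\<Sum>i\<in>UNIV. f2 i x))"
      and i0: "integrable ?M (\<lambda>x. u x * cutoff e (p x))"
      and i3: "integrable ?M (\<lambda>x. u x * (cutoff' e (p x) * L x))"
      by (intro integrable_u_mult_subset V continuous_intros f2c hc Lc)+
    have "0 = ?I (\<lambda>x. u x * (\<Sum>i\<in>UNIV. q2 i x) - q x * laplacian u x)"
      using green_compact_support[OF V(1) Ck2_on_subset[OF u_facts(1) V(2)] jet K KV z(1)] by simp
    also have "\<dots> = ?I (\<lambda>x. u x * (\<Sum>i\<in>UNIV. f2 i x) + l * (u x * cutoff e (p x)))"
      using u_facts(3) V(2)
      by (intro Bochner_Integration.integral_cong) (auto simp: q_def q2_def subset_iff)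
    also have "\<dots> = ?I (\<lambda>x. u x * (\<Sum>i\<in>UNIV. f2 i x)) + l * ?I (\<lambda>x. u x * cutoff e (p x))"
      using i2 i0 by simp
    finally have eq: "?I (\<lambda>x. u x * (\<Sum>i\<in>UNIV. f2 i x)) = - l * ?I (\<lambda>x. u x * cutoff e (p x))"
      by simp
    have "?I (\<lambda>x. u x * (cutoff' e (p x) * L x)) \<le> ?I (\<lambda>x. u x * (\<Sum>i\<in>UNIV. f2 i x))"
    proof (rule integral_mono[OF i3 i2])
      fix x assume "x \<in> space ?M"
      then have "u x > 0" using u1 by simp
      moreover have "cutoff' e (p x) * L x \<le> (\<Sum>i\<in>UNIV. f2 i x)"
        unfolding L_def sum_distrib_left f2_def using cutoff_bounds(3)[OF e, of "p x"]
        by (intro sum_mono) (simp add: mult.assoc)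
      ultimately show "u x * (cutoff' e (p x) * L x) \<le> u x * (\<Sum>i\<in>UNIV. f2 i x)"
        by (intro mult_left_mono) auto
    qed
    then show ?thesis using eq by simp
  qed
  define e where "e k = 1 / real (Suc k)" for k
  have e: "e k > 0" for k by (simp add: e_def)
  have iL: "integrable ?M (\<lambda>x. u x * L x)" and ip: "integrable ?M (\<lambda>x. u x * p x)"
    by (intro integrable_u_mult_subset V Lc pD)+
  note hc = comp[OF continuous_cutoff(1)[OF e]] comp[OF continuous_cutoff(2)[OF e]]
  have l1: "(\<lambda>k. ?I (\<lambda>x. u x * (cutoff' (e k) (p x) * L x))) \<longlonglongrightarrow> ?I (\<lambda>x. u x * L x)"
  proof (rule integral_dominated_convergence[where w="\<lambda>x. \<bar>u x * L x\<bar>"])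
    show "(\<lambda>x. u x * L x) \<in> borel_measurable ?M" "integrable ?M (\<lambda>x. \<bar>u x * L x\<bar>)" using iL by auto
    show "(\<lambda>x. u x * (cutoff' (e k) (p x) * L x)) \<in> borel_measurable ?M" for k
      by (rule borel_measurable_integrable) (intro integrable_u_mult_subset V continuous_intros hc Lc)
    have "(\<lambda>k. u x * (cutoff' (e k) (p x) * L x)) \<longlonglongrightarrow> u x * (1 * L x)" if "x \<in> V" for x
      unfolding e_def by (intro tendsto_intros cutoff_tendsto p0 that)
    then show "AE x in ?M. (\<lambda>k. u x * (cutoff' (e k) (p x) * L x)) \<longlonglongrightarrow> u x * L x"
      by (intro AE_I2) simp
    have "\<bar>u x * (cutoff' (e k) (p x) * L x)\<bar> \<le> \<bar>u x * L x\<bar>" for k x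
      using cutoff_bounds[OF e[of k], of "p x"] mult_right_mono[of "cutoff' (e k) (p x)" 1 "\<bar>u x\<bar> * \<bar>L x\<bar>"]
      by (simp add: abs_mult mult.left_commute)
    then show "AE x in ?M. norm (u x * (cutoff' (e k) (p x) * L x)) \<le> \<bar>u x * L x\<bar>" for k
      by (intro AE_I2) simp
  qed
  have l2: "(\<lambda>k. ?I (\<lambda>x. u x * cutoff (e k) (p x))) \<longlonglongrightarrow> ?I (\<lambda>x. u x * p x)"
  proof (rule integral_dominated_convergence[where w="\<lambda>x. u x * p x"])
    show "(\<lambda>x. u x * p x) \<in> borel_measurable ?M" "integrable ?M (\<lambda>x. u x * p x)" using ip by auto
    show "(\<lambda>x. u x * cutoff (e k) (p x)) \<in> borel_measurable ?M" for k
      by (rule borel_measurable_integrable) (intro integrable_u_mult_subset V continuous_intros hc)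
    have "(\<lambda>k. u x * cutoff (e k) (p x)) \<longlonglongrightarrow> u x * p x" if "x \<in> V" for x
      unfolding e_def by (intro tendsto_intros cutoff_tendsto p0 that)
    then show "AE x in ?M. (\<lambda>k. u x * cutoff (e k) (p x)) \<longlonglongrightarrow> u x * p x" by (intro AE_I2) simp
    have "\<bar>u x * cutoff (e k) (p x)\<bar> \<le> u x * p x" if "x \<in> V" for k x
      using cutoff_bounds(4)[OF e[of k], of "p x"] p0[OF that] u1[OF that]
      by (simp add: abs_mult)
    then show "AE x in ?M. norm (u x * cutoff (e k) (p x)) \<le> u x * p x" for k
      by (intro AE_I2) simp
  qed
  have "?I (\<lambda>x. u x * L x) \<le> - l * ?I (\<lambda>x. u x * p x)"
    by (rule LIMSEQ_le[OF l1 tendsto_mult_left[OF l2]]) (use main e in blast)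
  then show ?thesis by (simp add: L_def)
qed

text \<open>
  For \<open>p\<close> that is only nonnegative the cutoff would lose the Laplacian on the zero set
  of \<open>p\<close>; a small multiple of a positive function \<open>w\<close> is added and removed
  in the limit.
\<close>
lemma weak_supersolution:
  assumes V: "open V" "V \<subseteq> U" and p: "C2_jet p p1 p2" and w: "C2_jet w w1 w2"
    and p0: "\<And>x. x \<in> V \<Longrightarrow> 0 \<le> p x" and pf: "\<And>x. x \<in> frontier V \<Longrightarrow> p x = 0"
    and w0: "\<And>x. x \<in> V \<Longrightarrow> 0 < w x" and wf: "\<And>x. x \<in> frontier V \<Longrightarrow> w x = 0"
  shows "integral_on V (\<lambda>x. u x * (\<Sum>i\<in>UNIV. p2 i x))
     \<le> - l * integral_on V (\<lambda>x. u x * p x)"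
proof -
  let ?I = "integral_on V"
  note pD = C2_jet_D[OF p] and wD = C2_jet_D[OF w]
  define a b c d where "a = ?I (\<lambda>x. u x * (\<Sum>i\<in>UNIV. p2 i x))" and "b = ?I (\<lambda>x. u x * (\<Sum>i\<in>UNIV. w2 i x))"
    and "c = ?I (\<lambda>x. u x * p x)" and "d = ?I (\<lambda>x. u x * w x)"
  have i: "integrable (lebesgue_on V) (\<lambda>x. u x * (\<Sum>i\<in>UNIV. p2 i x))" "integrable (lebesgue_on V) (\<lambda>x. u x * (\<Sum>i\<in>UNIV. w2 i x))"
    "integrable (lebesgue_on V) (\<lambda>x. u x * p x)" "integrable (lebesgue_on V) (\<lambda>x. u x * w x)"
    by (intro integrable_u_mult_subset V continuous_intros pD wD)+
  have "a + e * b \<le> - l * (c + e * d)" if e: "e > 0" for e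
  proof -
    have "C2_jet (\<lambda>x. p x + e * w x) (\<lambda>i x. p1 i x + e * w1 i x) (\<lambda>i x. p2 i x + e * w2 i x)"
      unfolding C2_jet_def
    proof (intro conjI allI)
      have m: "has_partial i f y x \<Longrightarrow> has_partial i (\<lambda>x. e * f x) (e * y) x" for i f y x
        using has_partial_mult[OF has_partial_const[of i e x]] by fastforce
      fix i x
      show "has_partial i (\<lambda>x. p x + e * w x) (p1 i x + e * w1 i x) x"
        "has_partial i (\<lambda>x. p1 i x + e * w1 i x) (p2 i x + e * w2 i x) x"
        by (intro has_partial_add m pD wD)+
    qed (intro continuous_intros pD wD)+
    from weak_supersolution_pos[OF V this]
    have "?I (\<lambda>x. u x * (\<Sum>i\<in>UNIV. p2 i x + e * w2 i x)) \<le> - l * ?I (\<lambda>x. u x * (p x + e * w x))"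
      using p0 pf w0 wf e by (simp add: add_nonneg_pos)
    moreover have "?I (\<lambda>x. u x * (\<Sum>i\<in>UNIV. p2 i x + e * w2 i x)) = a + e * b"
    proof -
      have "(\<lambda>x. u x * (\<Sum>i\<in>UNIV. p2 i x + e * w2 i x)) =
         (\<lambda>x. u x * (\<Sum>i\<in>UNIV. p2 i x) + e * (u x * (\<Sum>i\<in>UNIV. w2 i x)))"
        by (simp add: fun_eq_iff sum.distrib sum_distrib_left[symmetric] algebra_simps)
      then show ?thesis using i by (simp add: a_def b_def)
    qed
    moreover have "?I (\<lambda>x. u x * (p x + e * w x)) = c + e * d"
    proof -
      have "(\<lambda>x. u x * (p x + e * w x)) = (\<lambda>x. u x * p x + e * (u x * w x))"
        by (simp add: fun_eq_iff algebra_simps)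
      then show ?thesis using i by (simp add: c_def d_def)
    qed
    ultimately show ?thesis by simp
  qed
  then have ev: "\<forall>\<^sub>F e in at_right 0. a + e * b \<le> - l * (c + e * d)"
    by (auto simp: eventually_at_right_field intro!: exI[of _ 1])
  have "a + 0 * b \<le> - l * (c + 0 * d)"
    by (rule tendsto_le[OF _ _ _ ev, rotated]) (intro tendsto_intros, intro tendsto_intros, simp)
  then show ?thesis by (simp add: a_def c_def)
qed

end

section \<open>An explicit heat kernel on an interval\<close>

lemma sum_symmetric_split:
  fixes g :: "nat \<Rightarrow> 'a::comm_monoid_add"
  shows "(\<Sum>j\<le>2*N. g j) = g N + (\<Sum>k=1..N. g (N + k) + g (N - k))"
proof -
  have s: "{..2*N} = ({..<N} \<union> {N}) \<union> {1+N..N+N}" by auto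
  have "(\<Sum>j\<le>2*N. g j) = (\<Sum>j<N. g j) + g N + (\<Sum>j=1+N..N+N. g j)"
    unfolding s by (subst sum.union_disjoint) (auto simp: add.commute)
  also have "(\<Sum>j=1+N..N+N. g j) = (\<Sum>k=1..N. g (k + N))"
    by (rule sum.shift_bounds_cl_nat_ivl)
  also have "(\<Sum>j<N. g j) = (\<Sum>k=1..N. g (N - k))"
    by (rule sum.reindex_bij_witness[of _ "\<lambda>k. N - k" "\<lambda>j. N - j"]) auto
  finally show ?thesis by (simp add: sum.distrib ac_simps)
qed

text \<open>
  The Fourier coefficients of \<open>cos\<^sup>2\<^sup>N (\<theta>/2)\<close>, normalised so that
  the mean is \<open>1\<close>.
\<close>
definition fcoeff :: "nat \<Rightarrow> nat \<Rightarrow> real" where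
  "fcoeff N k = real ((2*N) choose (N + k)) / real ((2*N) choose N)"

text \<open>
  The even, nonnegative trigonometric polynomial with these coefficients; it decreases on \<open>[0,
  pi]\<close> and concentrates at \<open>0\<close>.
\<close>
definition peak :: "nat \<Rightarrow> real \<Rightarrow> real" where
  "peak N \<theta> = 4^N / real ((2*N) choose N) * ((1 + cos \<theta>) / 2)^N"

text \<open>
  The heat flow on \<open>[0, pi]\<close> with Dirichlet conditions, started from the odd reflection
  of \<open>peak N\<close> centred at \<open>x\<close>.
\<close>
definition dker :: "nat \<Rightarrow> real \<Rightarrow> real \<Rightarrow> real \<Rightarrow> real" where
  "dker N t x y = (\<Sum>k=1..N. 4 * fcoeff N k * exp (- (real k)\<^sup>2 * t) * sin (real k * x) * sin (real k * y))"

text \<open>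
  Both sides are the real part of \<open>(cis (- \<theta>) (1 + cis
  \<theta>)\<^sup>2)\<^sup>N\<close>.
\<close>
lemma sum_binomial_cos:
  "(\<Sum>j\<le>2*N. real ((2*N) choose j) * cos ((real j - real N) * \<theta>)) = (2 + 2 * cos \<theta>)^N"
proof -
  have "(\<Sum>j\<le>2*N. of_nat ((2*N) choose j) * cis \<theta> ^ j) = (cis \<theta> + 1) ^ (2*N)"
    using binomial_ring[of "cis \<theta>" 1 "2*N"] by simp
  then have "cis (- \<theta>) ^ N * (\<Sum>j\<le>2*N. of_nat ((2*N) choose j) * cis \<theta> ^ j) =
      (cis (- \<theta>) * (cis \<theta> + 1)\<^sup>2) ^ N"
    by (simp add: power_mult power_mult_distrib)
  also have "cis (- \<theta>) * (cis \<theta> + 1)\<^sup>2 = complex_of_real (2 + 2 * cos \<theta>)"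
  proof -
    have "cis (- \<theta>) * (cis \<theta> + 1)\<^sup>2 = cis (- \<theta>) * cis \<theta> * cis \<theta> + 2 * (cis (- \<theta>) * cis \<theta>) + cis (- \<theta>)"
      by (simp add: power2_eq_square algebra_simps)
    also have "\<dots> = cis \<theta> + 2 + cis (- \<theta>)" by (simp add: cis_mult)
    also have "\<dots> = complex_of_real (2 + 2 * cos \<theta>)" by (simp add: complex_eq_iff)
    finally show ?thesis .
  qed
  also have "cis (- \<theta>) ^ N * (\<Sum>j\<le>2*N. of_nat ((2*N) choose j) * cis \<theta> ^ j) =
     (\<Sum>j\<le>2*N. of_nat ((2*N) choose j) * cis ((real j - real N) * \<theta>))"
    unfolding sum_distrib_left
  proof (intro sum.cong refl)
    fix j
    have "cis (- \<theta>) ^ N * cis \<theta> ^ j = cis (real N * (- \<theta>) + real j * \<theta>)"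
      by (simp only: Complex.DeMoivre cis_mult)
    also have "real N * (- \<theta>) + real j * \<theta> = (real j - real N) * \<theta>" by (simp add: algebra_simps)
    finally show "cis (- \<theta>) ^ N * (of_nat ((2*N) choose j) * cis \<theta> ^ j) =
        of_nat ((2*N) choose j) * cis ((real j - real N) * \<theta>)" by (simp add: mult.left_commute)
  qed
  finally have "Re (\<Sum>j\<le>2*N. of_nat ((2*N) choose j) * cis ((real j - real N) * \<theta>)) =
      Re (complex_of_real (2 + 2 * cos \<theta>) ^ N)" by simp
  moreover have "Re (of_nat m * z) = real m * Re z" for m z by simp
  moreover have "Re (complex_of_real r ^ N) = r ^ N" for r by (metis Re_complex_of_real of_real_power)
  ultimately show ?thesis by (simp only: Re_sum cis.sel)
qed

lemma peak_eq: "peak N \<theta> = 1 + 2 * (\<Sum>k=1..N. fcoeff N k * cos (real k * \<theta>))"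
proof -
  let ?C = "real ((2*N) choose N)"
  have C: "?C > 0" by simp
  have sym: "(2*N) choose (N - k) = (2*N) choose (N + k)" if "k \<in> {1..N}" for k
    using binomial_symmetric[of "N - k" "2*N"] that by (simp add: mult_2)
  have "(2 + 2 * cos \<theta>)^N = ?C + (\<Sum>k=1..N. real ((2*N) choose (N+k)) * cos (real k * \<theta>) + real ((2*N) choose (N-k)) * cos (- real k * \<theta>))"
    unfolding sum_binomial_cos[symmetric] sum_symmetric_split
    by (intro arg_cong2[of _ _ _ _ "(+)"] sum.cong refl) (auto simp: of_nat_diff)
  also have "\<dots> = ?C + (\<Sum>k=1..N. 2 * (real ((2*N) choose (N+k)) * cos (real k * \<theta>)))"
    by (intro arg_cong2[of _ _ _ _ "(+)"] sum.cong refl) (simp add: sym)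
  finally have 1: "(2 + 2 * cos \<theta>)^N / ?C = 1 + 2 * (\<Sum>k=1..N. fcoeff N k * cos (real k * \<theta>))"
    using C by (simp add: add_divide_distrib fcoeff_def sum_divide_distrib sum_distrib_left)
  have "(4::real)^N * ((1 + cos \<theta>) / 2)^N = (4 * ((1 + cos \<theta>) / 2))^N" by (simp only: power_mult_distrib)
  also have "4 * ((1 + cos \<theta>) / 2) = 2 + 2 * cos \<theta>" by simp
  finally show ?thesis using 1 unfolding peak_def by simp
qed

lemma dker_0: "dker N 0 x y = peak N (x - y) - peak N (x + y)"
proof -
  have *: "2 * (sin (real k * x) * sin (real k * y)) = cos (real k * (x - y)) - cos (real k * (x + y))" for k
    by (simp add: right_diff_distrib distrib_left cos_diff cos_add)
  then have "dker N 0 x y = (\<Sum>k=1..N. 2 * (fcoeff N k * cos (real k * (x - y))) - 2 * (fcoeff N k * cos (real k * (x + y))))"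
    unfolding dker_def
  proof (intro sum.cong refl)
    fix k
    have "4 * fcoeff N k * exp (- (real k)\<^sup>2 * 0) * sin (real k * x) * sin (real k * y) =
        2 * fcoeff N k * (2 * (sin (real k * x) * sin (real k * y)))" by simp
    also have "\<dots> = 2 * fcoeff N k * (cos (real k * (x - y)) - cos (real k * (x + y)))"
      by (simp only: *)
    finally show "4 * fcoeff N k * exp (- (real k)\<^sup>2 * 0) * sin (real k * x) * sin (real k * y) =
        2 * (fcoeff N k * cos (real k * (x - y))) - 2 * (fcoeff N k * cos (real k * (x + y)))"
      by (simp add: right_diff_distrib)
  qed
  then show ?thesis
    by (simp add: peak_eq sum_subtractf sum_distrib_left)
qed

lemma fcoeff_bounds: "0 \<le> fcoeff N k" "fcoeff N k \<le> 1"
  using binomial_maximum'[of N "N + k"] by (auto simp: fcoeff_def divide_le_eq)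

lemma fcoeff_1: "fcoeff N 1 = real N / (real N + 1)"
proof -
  have a: "Suc N * ((2*N) choose Suc N) = 2*N * ((2*N - 1) choose N)" 
    by (rule binomial_absorption)
  have "(2*N - N) * ((2*N) choose N) = 2*N * ((2*N - 1) choose N)"
    by (rule binomial_absorb_comp)
  then have "Suc N * ((2*N) choose Suc N) = N * ((2*N) choose N)" unfolding a by (simp only: mult_2 add_diff_cancel_left')
  then have "real (Suc N) * real ((2*N) choose Suc N) = real N * real ((2*N) choose N)"
    by (metis of_nat_mult)
  then show ?thesis by (simp add: fcoeff_def field_simps)
qed

text \<open>
  The factor \<open>2N + 1\<close> is what the induction reproduces; it gives the bound
  \<open>4\<^sup>N / \<surd>N\<close> for the central binomial coefficient and hence the height of
  \<open>peak N\<close>.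
\<close>
lemma central_binomial_upper: "(real ((2*N) choose N))\<^sup>2 * (2 * real N + 1) \<le> 16^N"
proof (induction N)
  case (Suc N)
  let ?c = "real ((2*N) choose N)" and ?d = "real ((2 * Suc N) choose Suc N)"
  have "Suc (2*N) * ((2*N) choose N) = (Suc (2*N) choose Suc N) * Suc N"
    by (rule Suc_times_binomial_eq)
  moreover have "(2 * Suc N) choose Suc N = 2 * (Suc (2*N) choose Suc N)"
    using binomial_symmetric[of N "Suc (2*N)"] by (simp add: mult_2)
  ultimately have "Suc N * ((2 * Suc N) choose Suc N) = 2 * (Suc (2*N) * ((2*N) choose N))" by simp
  then have d: "(real N + 1) * ?d = 2 * ((2 * real N + 1) * ?c)"
    by (metis (no_types, opaque_lifting) Suc_eq_plus1 add.commute mult_2 of_nat_1 of_nat_add of_nat_mult of_nat_numeral)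
  have "(real N + 1)\<^sup>2 * (?d\<^sup>2 * (2 * real (Suc N) + 1)) = ((real N + 1) * ?d)\<^sup>2 * (2 * real N + 3)"
    by (simp add: power2_eq_square algebra_simps)
  also have "\<dots> = 4 * (2 * real N + 1) * (2 * real N + 3) * (?c\<^sup>2 * (2 * real N + 1))"
    unfolding d by (simp add: power2_eq_square algebra_simps)
  also have "\<dots> \<le> 4 * (2 * real N + 1) * (2 * real N + 3) * 16^N"
    using Suc by (intro mult_left_mono) auto
  also have "\<dots> \<le> (real N + 1)\<^sup>2 * 16^Suc N"
  proof -
    have "4 * (2 * real N + 1) * (2 * real N + 3) \<le> (real N + 1)\<^sup>2 * 16"
      by (simp add: power2_eq_square algebra_simps)
    from mult_right_mono[OF this, of "16^N"] show ?thesis by simp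
  qed
  finally show ?case by (rule mult_left_le_imp_le) simp
qed simp

lemma peak_factor_bounds:
  assumes "N > 0"
  shows "sqrt (real N) \<le> 4^N / real ((2*N) choose N)" "4^N / real ((2*N) choose N) \<le> 2 * real N"
proof -
  let ?c = "real ((2*N) choose N)"
  have c: "?c > 0" by simp
  show "4^N / ?c \<le> 2 * real N"
    using central_binomial_lower_bound[OF assms] assms c by (simp add: field_simps)
  have "(sqrt (real N) * ?c)\<^sup>2 = real N * ?c\<^sup>2" by (simp add: power_mult_distrib)
  also have "\<dots> \<le> (2 * real N + 1) * ?c\<^sup>2" by (intro mult_right_mono) auto
  also have "\<dots> \<le> 16^N" using central_binomial_upper[of N] by (simp add: mult.commute)
  also have "\<dots> = (4^N)\<^sup>2" by (simp add: power2_eq_square flip: power_mult_distrib)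
  finally have "sqrt (real N) * ?c \<le> 4^N" by (rule power2_le_imp_le) simp
  then show "sqrt (real N) \<le> 4^N / ?c" using c by (simp add: le_divide_eq)
qed

lemma one_plus_cos_nonneg: "0 \<le> (1 + cos \<theta>) / 2" for \<theta> :: real
proof -
  have "- 1 + 1 \<le> cos \<theta> + 1" by (intro add_right_mono cos_ge_minus_one)
  then show ?thesis by (simp add: add.commute)
qed

lemma one_plus_cos_le_one: "(1 + cos \<theta>) / 2 \<le> 1" for \<theta> :: real
  using divide_right_mono[OF add_left_mono[OF cos_le_one[of \<theta>]], of 2 1] by simp

lemma peak_nonneg: "0 \<le> peak N \<theta>"
  unfolding peak_def by (intro mult_nonneg_nonneg zero_le_power one_plus_cos_nonneg) auto

lemma dker_0_le_peak: "dker N 0 x y \<le> peak N (x - y)"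
  using peak_nonneg[of N "x + y"] by (simp add: dker_0)

text \<open>
  Positivity of the reflected kernel amounts to \<open>cos (x + y) \<le> cos (x - y)\<close>.
\<close>
lemma dker_0_nonneg:
  assumes "x \<in> {0..pi}" "y \<in> {0..pi}"
  shows "0 \<le> dker N 0 x y"
proof -
  have "0 \<le> sin x * sin y" using assms by (intro mult_nonneg_nonneg sin_ge_zero) auto
  then have "cos (x + y) \<le> cos (x - y)" by (simp add: cos_add cos_diff)
  then have "((1 + cos (x + y)) / 2)^N \<le> ((1 + cos (x - y)) / 2)^N"
    by (intro power_mono one_plus_cos_nonneg) simp
  then show ?thesis unfolding dker_0 peak_def
    by (intro diff_ge_0_iff_ge[THEN iffD2] mult_left_mono) auto
qed

text \<open>
  The classical argument: if \<open>w\<close> were negative somewhere, \<open>w + e t\<close> with a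
  small \<open>e > 0\<close> would have a negative minimum inside the strip at a positive time,
  where the time derivative of \<open>w\<close> is at most \<open>- e\<close> although its second
  space derivative is nonnegative.
\<close>
lemma heat_minimum_principle:
  fixes w wt wy wyy :: "real \<Rightarrow> real \<Rightarrow> real"
  assumes c: "continuous_on UNIV (\<lambda>(t, y). w t y)"
    and dt: "\<And>t y. ((\<lambda>t. w t y) has_real_derivative wt t y) (at t)"
    and dy: "\<And>t y. (w t has_real_derivative wy t y) (at y)"
    and dyy: "\<And>t y. (wy t has_real_derivative wyy t y) (at y)"
    and heat: "\<And>t y. wt t y = wyy t y"
    and init: "\<And>y. y \<in> {a..b} \<Longrightarrow> 0 \<le> w 0 y"
    and bdry: "\<And>t. 0 \<le> w t a" "\<And>t. 0 \<le> w t b"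
    and t: "t \<ge> 0" and y: "y \<in> {a..b}"
  shows "0 \<le> w t y"
proof (rule ccontr)
  assume "\<not> 0 \<le> w t y"
  then have neg: "w t y < 0" by simp
  define e where "e = - w t y / (2 * (t + 1))"
  have e: "e > 0" using neg t by (simp add: e_def divide_neg_pos)
  have "e * t \<le> e * (t + 1)" using e by simp
  also have "\<dots> = - w t y / 2" unfolding e_def using t by (simp add: field_simps)
  finally have vneg: "w t y + e * t < 0" using neg by linarith
  define v where "v z = w (fst z) (snd z) + e * fst z" for z
  have "continuous_on ({0..t} \<times> {a..b}) v"
  proof -
    have "continuous_on UNIV (\<lambda>z. w (fst z) (snd z))" using c by (simp add: case_prod_unfold)
    then have "continuous_on UNIV v" unfolding v_def by (intro continuous_intros)
    then show ?thesis by (rule continuous_on_subset) simp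
  qed
  moreover have "compact ({0..t} \<times> {a..b})" by (intro compact_Times compact_Icc)
  moreover have ne: "(t, y) \<in> {0..t} \<times> {a..b}" using t y by auto
  ultimately obtain z where z: "z \<in> {0..t} \<times> {a..b}" "\<And>z'. z' \<in> {0..t} \<times> {a..b} \<Longrightarrow> v z \<le> v z'"
    using continuous_attains_inf[of "{0..t} \<times> {a..b}" v] by blast
  obtain s x where sx: "z = (s, x)" by (cases z)
  have s: "0 \<le> s" "s \<le> t" and x: "a \<le> x" "x \<le> b" using z(1) sx by auto
  have min: "w s x + e * s \<le> w s' x' + e * s'" if "0 \<le> s'" "s' \<le> t" "a \<le> x'" "x' \<le> b" for s' x'
    using z(2)[of "(s', x')"] that by (simp add: v_def sx)
  have vz: "w s x + e * s < 0" using min[of t y] vneg t y by simp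
  have es: "e * s \<ge> 0" using e s by simp
  have "s \<noteq> 0" using vz init[of x] x by auto
  then have s0: "s > 0" using s by simp
  have "x \<noteq> a" "x \<noteq> b" using vz bdry[of s] es by auto
  then have x0: "a < x" "x < b" using x by auto
  have "wt s x + e \<le> 0"
  proof (rule ccontr)
    assume "\<not> wt s x + e \<le> 0"
    moreover have "((\<lambda>t. w t x + e * t) has_real_derivative wt s x + e) (at s)"
      by (auto intro!: derivative_eq_intros dt)
    ultimately obtain d where d: "d > 0" "\<And>h. h > 0 \<Longrightarrow> h < d \<Longrightarrow> w (s - h) x + e * (s - h) < w s x + e * s"
      using DERIV_pos_inc_left[of "\<lambda>t. w t x + e * t" "wt s x + e" s] by auto
    define h where "h = min (d/2) s"
    have "h > 0" "h < d" "h \<le> s" using d(1) s0 by (auto simp: h_def)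
    then show False using d(2)[of h] min[of "s - h" x] s x by auto
  qed
  then have neg2: "wyy s x < 0" using e heat[of s x] by simp
  define r where "r = min (x - a) (b - x)"
  have r: "r > 0" using x0 by (simp add: r_def)
  have loc: "w s x \<le> w s x'" if "\<bar>x - x'\<bar> < r" for x'
  proof -
    have "a \<le> x'" "x' \<le> b" using that by (auto simp: r_def)
    then show ?thesis using min[of s x'] s by simp
  qed
  have wy0: "wy s x = 0"
    by (rule DERIV_local_min[OF dy r]) (use loc in auto)
  obtain d where d: "d > 0" "\<And>h. h > 0 \<Longrightarrow> h < d \<Longrightarrow> wy s x < wy s (x - h)"
    using DERIV_neg_dec_left[OF dyy neg2] by auto
  define h where "h = min (d/2) (r/2)"
  have h: "h > 0" "h < d" "h < r" using d r by (auto simp: h_def)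
  have "\<exists>z>x - h. z < x \<and> w s x - w s (x - h) = (x - (x - h)) * wy s z"
    by (rule MVT2) (use h dy in auto)
  then obtain z where zz: "x - h < z" "z < x" "w s x - w s (x - h) = h * wy s z" by auto
  have "wy s z > 0" using d(2)[of "x - z"] zz h wy0 by simp
  then have "w s x > w s (x - h)" using zz(3) h(1) by (smt (verit) mult_pos_pos)
  then show False using loc[of "x - h"] h by simp
qed

lemma dker_nonneg:
  assumes x: "x \<in> {0..pi}" and y: "y \<in> {0..pi}" and t: "t \<ge> 0"
  shows "0 \<le> dker N t x y"
proof -
  let ?g = "\<lambda>k. 4 * fcoeff N k"
  show ?thesis
  proof (rule heat_minimum_principle[where w="\<lambda>t y. dker N t x y" and a=0 and b=pi
      and wt = "\<lambda>t y. \<Sum>k=1..N. ?g k * (- (real k)\<^sup>2 * exp (- (real k)\<^sup>2 * t)) * sin (real k * x) * sin (real k * y)"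
      and wyy = "\<lambda>t y. \<Sum>k=1..N. ?g k * (- (real k)\<^sup>2 * exp (- (real k)\<^sup>2 * t)) * sin (real k * x) * sin (real k * y)"
      and wy = "\<lambda>t y. \<Sum>k=1..N. ?g k * (real k * exp (- (real k)\<^sup>2 * t)) * sin (real k * x) * cos (real k * y)"])
    show "continuous_on UNIV (\<lambda>(t, y). dker N t x y)"
      unfolding dker_def case_prod_unfold by (intro continuous_intros)
    show "((\<lambda>t. dker N t x y) has_real_derivative
       (\<Sum>k=1..N. ?g k * (- (real k)\<^sup>2 * exp (- (real k)\<^sup>2 * t)) * sin (real k * x) * sin (real k * y))) (at t)" for t y
      unfolding dker_def by (intro DERIV_sum) (auto intro!: derivative_eq_intros)
    show "(dker N t x has_real_derivative
       (\<Sum>k=1..N. ?g k * (real k * exp (- (real k)\<^sup>2 * t)) * sin (real k * x) * cos (real k * y))) (at y)" for t y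
      unfolding dker_def[abs_def] by (intro DERIV_sum) (auto intro!: derivative_eq_intros)
    show "((\<lambda>y. \<Sum>k=1..N. ?g k * (real k * exp (- (real k)\<^sup>2 * t)) * sin (real k * x) * cos (real k * y)) has_real_derivative
       (\<Sum>k=1..N. ?g k * (- (real k)\<^sup>2 * exp (- (real k)\<^sup>2 * t)) * sin (real k * x) * sin (real k * y))) (at y)" for t y
      by (intro DERIV_sum) (auto intro!: derivative_eq_intros simp: power2_eq_square)
    show "0 \<le> dker N 0 x y" if "y \<in> {0..pi}" for y by (rule dker_0_nonneg[OF x that])
    show "0 \<le> dker N t x 0" "0 \<le> dker N t x pi" for t by (simp_all add: dker_def)
  qed (use t y in auto)
qed

lemma abs_sin_mult_le: "\<bar>sin (real k * x)\<bar> \<le> real k * \<bar>sin x\<bar>"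
proof (induction k)
  case (Suc k)
  have "\<bar>sin (real (Suc k) * x)\<bar> = \<bar>sin (real k * x) * cos x + cos (real k * x) * sin x\<bar>"
  proof -
    have "real (Suc k) * x = real k * x + x" by (simp add: algebra_simps)
    then show ?thesis by (simp only: sin_add)
  qed
  also have "\<dots> \<le> \<bar>sin (real k * x)\<bar> * \<bar>cos x\<bar> + \<bar>cos (real k * x)\<bar> * \<bar>sin x\<bar>"
    by (metis abs_mult abs_triangle_ineq)
  also have "\<dots> \<le> \<bar>sin (real k * x)\<bar> * 1 + 1 * \<bar>sin x\<bar>"
    by (intro add_mono mult_mono) auto
  finally show ?case using Suc by (simp add: distrib_right)
qed simp

text \<open>
  From \<open>k\<^sup>2 \<le> 4\<^sup>k\<^sup>-\<^sup>1\<close> and \<open>e\<^sup>-\<^sup>t \<le>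
  1/20\<close> the terms are dominated by a geometric series of ratio \<open>1/5\<close>, whose sum
  from the second mode on is \<open>1/4\<close>.
\<close>
lemma exp_tail_sum:
  assumes t: "t \<ge> 5"
  shows "(\<Sum>k=2..N. (real k)\<^sup>2 * exp (- ((real k)\<^sup>2 - 1) * t)) \<le> 1 / 4"
proof -
  have e1: "exp (- t) \<le> 1 / 20"
  proof -
    have "(2::real) ^ 5 \<le> exp 1 ^ 5" using exp_ge_add_one_self[of 1] by (intro power_mono) auto
    also have "\<dots> = exp 5" by (simp flip: exp_of_nat_mult)
    also have "\<dots> \<le> exp t" using t by simp
    finally have "20 \<le> exp t" by simp
    then show ?thesis by (simp add: exp_minus field_simps)
  qed
  have sq: "(real (Suc j))\<^sup>2 \<le> 4 ^ j" for j
  proof (induction j)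
    case (Suc j)
    have "(real (Suc (Suc j)))\<^sup>2 \<le> 4 * (real (Suc j))\<^sup>2" by (simp add: power2_eq_square algebra_simps)
    then show ?case using Suc by simp
  qed simp
  have bound: "(real k)\<^sup>2 * exp (- ((real k)\<^sup>2 - 1) * t) \<le> (1/5) ^ (k - 1)" if "k \<ge> 2" for k
  proof -
    define j where "j = k - 1"
    have j: "k = Suc j" "j \<ge> 1" using that by (auto simp: j_def)
    have "real j \<le> (real k)\<^sup>2 - 1" by (simp add: j power2_eq_square algebra_simps)
    then have "real j * t \<le> ((real k)\<^sup>2 - 1) * t" using t by (intro mult_right_mono) auto
    then have "exp (- ((real k)\<^sup>2 - 1) * t) \<le> exp (- real j * t)" by (simp add: algebra_simps)
    also have "\<dots> = exp (- t) ^ j" by (simp flip: exp_of_nat_mult)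
    also have "\<dots> \<le> (1/20) ^ j" using e1 by (intro power_mono) auto
    finally have "(real k)\<^sup>2 * exp (- ((real k)\<^sup>2 - 1) * t) \<le> 4 ^ j * (1/20) ^ j"
      using sq[of j] j by (intro mult_mono) auto
    also have "\<dots> = (1/5) ^ (k - 1)" by (simp add: j flip: power_mult_distrib)
    finally show ?thesis .
  qed
  have geo: "(\<Sum>k=2..N. (1/5::real) ^ (k - 1)) \<le> 1/4 - (1/4) * (1/5) ^ (N - 1)" if "N \<ge> 1" for N
    using that
  proof (induction N rule: dec_induct)
    case (step n)
    then show ?case by (cases n) auto
  qed simp
  have "(\<Sum>k=2..N. (real k)\<^sup>2 * exp (- ((real k)\<^sup>2 - 1) * t)) \<le> (\<Sum>k=2..N. (1/5::real) ^ (k - 1))"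
    by (intro sum_mono bound) auto
  also have "\<dots> \<le> 1/4"
  proof (cases "N \<ge> 1")
    case True
    have "(1/5::real) ^ (N - 1) \<ge> 0" by simp
    then show ?thesis using geo[OF True] by linarith
  qed simp
  finally show ?thesis .
qed

text \<open>
  Since \<open>\<bar>sin (k x)\<bar> \<le> k \<bar>sin x\<bar>\<close>, the higher modes carry the
  same boundary factor \<open>sin x sin y\<close> as the first one, so they are dominated by it up
  to the boundary.
\<close>
lemma dker_first_mode:
  assumes x: "x \<in> {0..pi}" and y: "y \<in> {0..pi}" and t: "t \<ge> 5" and N: "N \<ge> 1"
  shows "\<bar>dker N t x y - 4 * fcoeff N 1 * exp (- t) * (sin x * sin y)\<bar> \<le> exp (- t) * (sin x * sin y)"
proof -
  have sx: "0 \<le> sin x" "0 \<le> sin y" using x y by (auto intro: sin_ge_zero)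
  define T where "T k = 4 * fcoeff N k * exp (- (real k)\<^sup>2 * t) * sin (real k * x) * sin (real k * y)" for k
  have "dker N t x y = T 1 + (\<Sum>k=2..N. T k)"
    unfolding dker_def T_def[symmetric] using N by (simp add: sum.atLeast_Suc_atMost numeral_2_eq_2)
  then have "\<bar>dker N t x y - 4 * fcoeff N 1 * exp (- t) * (sin x * sin y)\<bar> = \<bar>\<Sum>k=2..N. T k\<bar>"
    by (simp add: T_def mult.assoc)
  also have "\<dots> \<le> (\<Sum>k=2..N. \<bar>T k\<bar>)" by (rule sum_abs)
  also have "\<dots> \<le> (\<Sum>k=2..N. 4 * exp (- t) * (sin x * sin y) * ((real k)\<^sup>2 * exp (- ((real k)\<^sup>2 - 1) * t)))"
  proof (rule sum_mono)
    fix k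
    have e: "exp (- (real k)\<^sup>2 * t) = exp (- t) * exp (- ((real k)\<^sup>2 - 1) * t)"
      by (simp add: algebra_simps flip: exp_add)
    have "\<bar>T k\<bar> = 4 * fcoeff N k * exp (- (real k)\<^sup>2 * t) * (\<bar>sin (real k * x)\<bar> * \<bar>sin (real k * y)\<bar>)"
      using fcoeff_bounds[of N k] by (simp add: T_def abs_mult)
    also have "\<dots> \<le> 4 * 1 * exp (- (real k)\<^sup>2 * t) * ((real k * \<bar>sin x\<bar>) * (real k * \<bar>sin y\<bar>))"
      using fcoeff_bounds[of N k] by (intro mult_mono abs_sin_mult_le) auto
    also have "\<dots> = 4 * exp (- t) * (sin x * sin y) * ((real k)\<^sup>2 * exp (- ((real k)\<^sup>2 - 1) * t))"
      unfolding e using sx by (simp add: power2_eq_square)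
    finally show "\<bar>T k\<bar> \<le> \<dots>" .
  qed
  also have "\<dots> = 4 * exp (- t) * (sin x * sin y) * (\<Sum>k=2..N. (real k)\<^sup>2 * exp (- ((real k)\<^sup>2 - 1) * t))"
    by (simp add: sum_distrib_left)
  also have "\<dots> \<le> 4 * exp (- t) * (sin x * sin y) * (1/4)"
    using sx by (intro mult_left_mono exp_tail_sum t) auto
  finally show ?thesis by simp
qed

text \<open>
  For \<open>N \<ge> 3\<close> the first coefficient \<open>N / (N + 1)\<close> is at least
  \<open>3/4\<close>, which leaves room for the higher modes.
\<close>
lemma dker_large_time:
  assumes x: "x \<in> {0..pi}" and y: "y \<in> {0..pi}" and t: "t \<ge> 5" and N: "N \<ge> 3"
  shows "dker N t x y \<le> 5 * exp (- t) * (sin x * sin y)" "2 * exp (- t) * (sin x * sin y) \<le> dker N t x y"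
proof -
  have sx: "0 \<le> sin x * sin y" using x y by (auto intro!: mult_nonneg_nonneg sin_ge_zero)
  define E where "E = exp (- t) * (sin x * sin y)"
  have E: "E \<ge> 0" using sx by (simp add: E_def)
  have f: "3 / 4 \<le> fcoeff N 1" "fcoeff N 1 \<le> 1"
    using fcoeff_bounds[of N 1] unfolding fcoeff_1 using N by (simp_all add: field_simps)
  have "\<bar>dker N t x y - 4 * fcoeff N 1 * E\<bar> \<le> E"
    using dker_first_mode[OF x y t, of N] N by (simp add: E_def mult.assoc)
  moreover have "4 * fcoeff N 1 * E \<le> 4 * E" "3 * E \<le> 4 * fcoeff N 1 * E"
    using mult_right_mono[OF f(1) E] mult_right_mono[OF f(2) E] by simp_all
  ultimately have "dker N t x y \<le> 5 * E" "2 * E \<le> dker N t x y" by linarith+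
  then show "dker N t x y \<le> 5 * exp (- t) * (sin x * sin y)" "2 * exp (- t) * (sin x * sin y) \<le> dker N t x y"
    by (simp_all add: E_def mult.assoc)
qed

lemma cos_lipschitz: "\<bar>cos a - cos b\<bar> \<le> \<bar>a - b\<bar>" for a b :: real
proof -
  have "\<bar>cos a - cos b\<bar> = 2 * (\<bar>sin ((a + b) / 2)\<bar> * \<bar>sin ((b - a) / 2)\<bar>)"
    by (simp add: cos_diff_cos abs_mult)
  also have "\<dots> \<le> 2 * (1 * \<bar>(b - a) / 2\<bar>)"
    by (intro mult_left_mono mult_mono abs_sin_x_le_abs_x) auto
  finally show ?thesis by simp
qed

lemma inverse_sqrt_tendsto_0: "(\<lambda>N. 1 / sqrt (real N)) \<longlonglongrightarrow> 0"
  by (intro tendsto_divide_0[OF tendsto_const] filterlim_at_top_imp_at_infinity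
      filterlim_compose[OF sqrt_at_top filterlim_real_sequentially])

text \<open>
  Near the diagonal, at distance \<open>1 / \<surd>N\<close>, the peak still has a fixed fraction of
  its height \<open>\<surd>N\<close>, while the reflected peak is exponentially small there. With
  \<open>n\<close> coordinates the product of these bounds balances the volume of a box of this
  size, which is all that the upper bound for eigenfunctions requires of the initial data.
\<close>
lemma dker_0_local_lower:
  assumes x: "0 < x" "x < pi"
  shows "\<forall>\<^sub>F N in sequentially. \<forall>y. \<bar>y - x\<bar> \<le> 1 / sqrt (real N) \<longrightarrow> sqrt (real N) / 4 \<le> dker N 0 x y"
proof -
  define r where "r = (3 + cos (2 * x)) / 4"
  have "cos (2 * x) = 1 - 2 * (sin x)\<^sup>2" by (rule cos_double_sin)
  moreover have "sin x > 0" using x by (rule sin_gt_zero)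
  ultimately have c: "cos (2 * x) < 1" by simp
  have r: "0 \<le> r" "r < 1"
    using c one_plus_cos_nonneg[of "2 * x"] by (simp_all add: r_def)
  have "(\<lambda>N. r ^ N) \<longlonglongrightarrow> 0" using r by (intro LIMSEQ_power_zero) simp
  then have E1: "\<forall>\<^sub>F N in sequentially. r ^ N < 1 / 2" by (rule order_tendstoD) simp
  have E2: "\<forall>\<^sub>F N in sequentially. 1 / sqrt (real N) < (1 - cos (2 * x)) / 2"
    by (rule order_tendstoD[OF inverse_sqrt_tendsto_0]) (use c in simp)
  show ?thesis
    using E1 E2 eventually_gt_at_top[of 0]
  proof eventually_elim
    case (elim N)
    note rN = elim(1) and eta = elim(2) and N = elim(3)
    show ?case
    proof (intro allI impI)
      fix y assume y: "\<bar>y - x\<bar> \<le> 1 / sqrt (real N)"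
      have "(x - y)\<^sup>2 \<le> (1 / sqrt (real N))\<^sup>2" using y by (intro abs_le_square_iff[THEN iffD1]) (simp add: abs_minus_commute)
      then have d2: "(x - y)\<^sup>2 \<le> 1 / real N" using N by (simp add: power_divide)
      have "cos (x - y) = 1 - 2 * (sin ((x - y) / 2))\<^sup>2" using cos_double_sin[of "(x - y) / 2"] by (simp only: times_divide_eq_right nonzero_mult_div_cancel_left zero_neq_numeral[symmetric] not_False_eq_True)
      moreover have "(sin ((x - y) / 2))\<^sup>2 \<le> ((x - y) / 2)\<^sup>2"
        using abs_sin_x_le_abs_x[of "(x - y) / 2"] by (simp only: abs_le_square_iff)
      ultimately have "1 - (x - y)\<^sup>2 / 4 \<le> (1 + cos (x - y)) / 2" by (simp add: power_divide)
      then have b1: "1 + (- 1 / (4 * real N)) \<le> (1 + cos (x - y)) / 2" using d2 by (simp add: field_simps)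
      have "real N \<ge> 1" using N by simp
      then have b0: "-1 \<le> - 1 / (4 * real N)" by (simp add: field_simps)
      have "3 / 4 = 1 + real N * (- 1 / (4 * real N))" using N by simp
      also have "\<dots> \<le> (1 + (- 1 / (4 * real N))) ^ N" by (rule Bernoulli_inequality[OF b0])
      also have "\<dots> \<le> ((1 + cos (x - y)) / 2) ^ N" using b1 b0 by (intro power_mono) auto
      finally have A: "3 / 4 \<le> ((1 + cos (x - y)) / 2) ^ N" .
      have "cos (x + y) \<le> cos (2 * x) + \<bar>y - x\<bar>" using cos_lipschitz[of "x + y" "2 * x"] by simp
      moreover have "(1 + a) / 2 \<le> (3 + c) / 4"
        if "a \<le> c + d" "d \<le> e" "e < (1 - c) / 2" for a c d e :: real
        using that by (simp add: field_simps)
      ultimately have "(1 + cos (x + y)) / 2 \<le> r" using y eta unfolding r_def by blast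
      then have "((1 + cos (x + y)) / 2) ^ N \<le> r ^ N" by (intro power_mono one_plus_cos_nonneg)
      then have D: "1 / 4 \<le> ((1 + cos (x - y)) / 2) ^ N - ((1 + cos (x + y)) / 2) ^ N" using A rN by linarith
      have "sqrt (real N) * (1 / 4) \<le> 4^N / real ((2*N) choose N) * (((1 + cos (x - y)) / 2) ^ N - ((1 + cos (x + y)) / 2) ^ N)"
        using peak_factor_bounds[OF N] D by (intro mult_mono) auto
      then show "sqrt (real N) / 4 \<le> dker N 0 x y" by (simp add: dker_0 peak_def right_diff_distrib)
    qed
  qed
qed

lemma peak_le: "N > 0 \<Longrightarrow> peak N \<theta> \<le> 2 * real N"
proof -
  assume N: "N > 0"
  have "((1 + cos \<theta>) / 2) ^ N \<le> 1"
    by (intro power_le_one one_plus_cos_nonneg one_plus_cos_le_one)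
  then have "peak N \<theta> \<le> 4^N / real ((2*N) choose N) * 1" unfolding peak_def by (intro mult_left_mono) auto
  then show ?thesis using peak_factor_bounds(2)[OF N] by simp
qed

lemma dker_0_tail:
  assumes N: "N > 0" and d: "0 \<le> d" "d \<le> \<bar>x - y\<bar>" and x: "x \<in> {0..pi}" and y: "y \<in> {0..pi}"
  shows "dker N 0 x y \<le> 2 * real N * ((1 + cos d) / 2) ^ N"
proof -
  have "cos (x - y) = cos \<bar>x - y\<bar>" by simp
  also have "\<dots> \<le> cos d" using d x y by (intro cos_monotone_0_pi_le) auto
  finally have "((1 + cos (x - y)) / 2) ^ N \<le> ((1 + cos d) / 2) ^ N"
    by (intro power_mono one_plus_cos_nonneg) simp
  then have "peak N (x - y) \<le> 2 * real N * ((1 + cos d) / 2) ^ N"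
    unfolding peak_def using peak_factor_bounds(2)[OF N]
    by (intro mult_mono zero_le_power one_plus_cos_nonneg) auto
  then show ?thesis using dker_0_le_peak[of N x y] by linarith
qed

text \<open>
  One full period of \<open>peak N\<close>, rescaled to length \<open>4a\<close>; only the mean
  value \<open>1\<close> survives.
\<close>
lemma peak_mass:
  assumes a: "a > 0"
  shows "(\<integral>\<^sup>+ y. ennreal (indicator {c - 2*a..c + 2*a} y * peak N (pi * (c - y) / (2 * a))) \<partial>lborel) = ennreal (4 * a)"
proof -
  define F where "F y = y + (\<Sum>k=1..N. 2 * fcoeff N k * (- (2 * a / (real k * pi))) * sin (real k * (pi * (c - y) / (2 * a))))" for y
  have "(\<integral>\<^sup>+ y. ennreal (peak N (pi * (c - y) / (2 * a))) * indicator {c - 2*a..c + 2*a} y \<partial>lborel) = ennreal (F (c + 2*a) - F (c - 2*a))"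
  proof (rule nn_integral_FTC_Icc)
    show "(\<lambda>y. peak N (pi * (c - y) / (2 * a))) \<in> borel_measurable borel"
      unfolding peak_def by measurable
    show "c - 2 * a \<le> c + 2 * a" using a by simp
    fix y
    show "0 \<le> peak N (pi * (c - y) / (2 * a))" by (rule peak_nonneg)
    have "(F has_real_derivative 1 + (\<Sum>k=1..N. 2 * fcoeff N k * cos (real k * (pi * (c - y) / (2 * a))))) (at y)"
      unfolding F_def
    proof (intro DERIV_add DERIV_sum DERIV_ident)
      fix k assume "k \<in> {1..N}"
      then show "((\<lambda>y. 2 * fcoeff N k * (- (2 * a / (real k * pi))) * sin (real k * (pi * (c - y) / (2 * a)))) has_real_derivative
          2 * fcoeff N k * cos (real k * (pi * (c - y) / (2 * a)))) (at y)"
        using a by (auto intro!: derivative_eq_intros)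
    qed
    then show "(F has_real_derivative peak N (pi * (c - y) / (2 * a))) (at y)"
      by (simp add: peak_eq sum_distrib_left mult.assoc)
  qed
  moreover have "F (c + 2*a) = c + 2*a" "F (c - 2*a) = c - 2*a"
  proof -
    have "pi * (c - (c + 2*a)) / (2 * a) = - pi" "pi * (c - (c - 2*a)) / (2 * a) = pi"
      using a by (auto simp: field_simps)
    then show "F (c + 2*a) = c + 2*a" "F (c - 2*a) = c - 2*a" unfolding F_def by simp_all
  qed
  moreover have "ennreal (indicator {c - 2*a..c + 2*a} y * peak N (pi * (c - y) / (2 * a))) =
      ennreal (peak N (pi * (c - y) / (2 * a))) * indicator {c - 2*a..c + 2*a} y" for y
    by (simp split: split_indicator)
  moreover have "c + 2*a - (c - 2*a) = 4*a" by simp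
  ultimately show ?thesis by (simp only:)
qed

section \<open>The heat kernel of a box paired with an eigenfunction\<close>

text \<open>
  The coordinate on the \<open>i\<close>-th side, rescaled from \<open>[- b\<^sub>i,
  b\<^sub>i]\<close> to \<open>[0, pi]\<close>.
\<close>
definition ang :: "real^'n \<Rightarrow> 'n \<Rightarrow> real^'n \<Rightarrow> real" where
  "ang b i y = pi * (y $ i + b $ i) / (2 * b $ i)"

definition rate :: "real^'n \<Rightarrow> 'n \<Rightarrow> real" where
  "rate b i = (pi / (2 * b $ i))\<^sup>2"

definition box_eigenvalue :: "real^'n \<Rightarrow> real" where
  "box_eigenvalue b = (\<Sum>i\<in>UNIV. rate b i)"

text \<open>
  The Dirichlet eigenfunctions of the box, indexed by the vector of frequencies.
\<close>
definition mode :: "real^'n \<Rightarrow> ('n \<Rightarrow> nat) \<Rightarrow> real^'n \<Rightarrow> real" where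
  "mode b f y = (\<Prod>i\<in>UNIV. sin (real (f i) * ang b i y))"

definition mode_rate :: "real^'n \<Rightarrow> ('n \<Rightarrow> nat) \<Rightarrow> real" where
  "mode_rate b f = (\<Sum>i\<in>UNIV. (real (f i))\<^sup>2 * rate b i)"

definition mode1 :: "real^'n \<Rightarrow> ('n \<Rightarrow> nat) \<Rightarrow> 'n \<Rightarrow> real^'n \<Rightarrow> real" where
  "mode1 b f i y = real (f i) * (pi / (2 * b $ i)) * cos (real (f i) * ang b i y) *
     (\<Prod>j\<in>UNIV - {i}. sin (real (f j) * ang b j y))"

definition mode2 :: "real^'n \<Rightarrow> ('n \<Rightarrow> nat) \<Rightarrow> 'n \<Rightarrow> real^'n \<Rightarrow> real" where
  "mode2 b f i y = - ((real (f i))\<^sup>2 * rate b i) * mode b f y"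

definition hker :: "nat \<Rightarrow> real^'n \<Rightarrow> real \<Rightarrow> real^'n \<Rightarrow> real^'n \<Rightarrow> real" where
  "hker N b t x y = (\<Prod>i\<in>UNIV. dker N (rate b i * t) (ang b i x) (ang b i y))"

lemma continuous_ang [continuous_intros]: "continuous_on S (ang b i)"
proof -
  have "ang b i = (\<lambda>y. pi / (2 * b $ i) * (y $ i + b $ i))" by (simp add: ang_def fun_eq_iff)
  moreover have "continuous_on S (\<lambda>y. y $ i + b $ i)" by (intro continuous_intros)
  ultimately show ?thesis by (simp only: continuous_on_mult_left)
qed

lemma ang_axis: "b $ i > 0 \<Longrightarrow> ang b j (y + t *\<^sub>R axis i 1) = (if j = i then ang b i y + t * (pi / (2 * b $ i)) else ang b j y)"
  by (auto simp: ang_def axis_def field_simps)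

lemma mode_jet:
  assumes b: "\<And>i. b $ i > 0"
  shows "C2_jet (mode b f) (mode1 b f) (mode2 b f)"
  unfolding C2_jet_def
proof (intro conjI allI)
  show c: "continuous_on UNIV (mode b f)" unfolding mode_def by (intro continuous_intros)
  fix i
  show "continuous_on UNIV (mode1 b f i)" unfolding mode1_def
    by (intro continuous_on_mult continuous_on_const continuous_on_prod continuous_on_cos continuous_on_sin continuous_ang)
  show "continuous_on UNIV (mode2 b f i)" unfolding mode2_def by (intro continuous_intros c)
  fix x :: "real^'a"
  define P where "P = (\<Prod>j\<in>UNIV - {i}. sin (real (f j) * ang b j x))"
  have P: "(\<Prod>j\<in>UNIV - {i}. sin (real (f j) * ang b j (x + t *\<^sub>R axis i 1))) = P" for t
    unfolding P_def by (intro prod.cong refl) (simp add: ang_axis b)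
  have m: "mode b f (x + t *\<^sub>R axis i 1) = sin (real (f i) * (ang b i x + t * (pi / (2 * b $ i)))) * P" for t
    unfolding mode_def P[of t, symmetric] by (subst prod.remove[of UNIV i]) (simp_all add: ang_axis b)
  have d1: "((\<lambda>t. sin (k * (a + t * c)) * P) has_real_derivative k * c * cos (k * a) * P) (at 0)"
    and d2: "((\<lambda>t. k * c * cos (k * (a + t * c)) * P) has_real_derivative - (k\<^sup>2 * c\<^sup>2) * (sin (k * a) * P)) (at 0)"
    for k a c :: real
    by (auto intro!: derivative_eq_intros simp: power2_eq_square)
  show "has_partial i (mode b f) (mode1 b f i x) x"
    unfolding has_partial_def m mode1_def P_def[symmetric] by (rule d1)
  have m1: "mode1 b f i (x + t *\<^sub>R axis i 1) = real (f i) * (pi / (2 * b $ i)) * cos (real (f i) * (ang b i x + t * (pi / (2 * b $ i)))) * P" for t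
    unfolding mode1_def P by (simp add: ang_axis b)
  have "mode b f x = sin (real (f i) * ang b i x) * P" using m[of 0] by simp
  then show "has_partial i (mode1 b f i) (mode2 b f i x) x"
    unfolding has_partial_def m1 mode2_def rate_def by (simp only: d2)
qed

lemma mode2_sum: "(\<Sum>i\<in>UNIV. mode2 b f i y) = - mode_rate b f * mode b f y"
  by (simp add: mode2_def mode_rate_def sum_negf sum_distrib_right)

lemma C2_jet_sum:
  assumes "finite S" "\<And>f. f \<in> S \<Longrightarrow> C2_jet (p f) (p1 f) (p2 f)"
  shows "C2_jet (\<lambda>x. \<Sum>f\<in>S. c f * p f x) (\<lambda>i x. \<Sum>f\<in>S. c f * p1 f i x) (\<lambda>i x. \<Sum>f\<in>S. c f * p2 f i x)"
  unfolding C2_jet_def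
proof (intro conjI allI)
  note D = C2_jet_D[OF assms(2)]
  show "continuous_on UNIV (\<lambda>x. \<Sum>f\<in>S. c f * p f x)" by (intro continuous_intros D)
  fix i
  show "continuous_on UNIV (\<lambda>x. \<Sum>f\<in>S. c f * p1 f i x)" "continuous_on UNIV (\<lambda>x. \<Sum>f\<in>S. c f * p2 f i x)"
    by (intro continuous_intros D; assumption)+
  fix x
  show "has_partial i (\<lambda>x. \<Sum>f\<in>S. c f * p f x) (\<Sum>f\<in>S. c f * p1 f i x) x"
    unfolding has_partial_def
    by (intro DERIV_sum DERIV_cmult) (use D(4) in \<open>auto simp: has_partial_def\<close>)
  show "has_partial i (\<lambda>x. \<Sum>f\<in>S. c f * p1 f i x) (\<Sum>f\<in>S. c f * p2 f i x) x"
    unfolding has_partial_def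
    by (intro DERIV_sum DERIV_cmult) (use D(5) in \<open>auto simp: has_partial_def\<close>)
qed

lemma mem_centred_box: "y \<in> box (- b) b \<longleftrightarrow> (\<forall>i. - b $ i < y $ i \<and> y $ i < b $ i)" for b :: "real^'n"
  by (simp add: mem_box_cart)

lemma ang_in_0_pi:
  assumes "y \<in> box (- b) b" "b $ i > 0"
  shows "0 < ang b i y" "ang b i y < pi"
proof -
  have y: "0 < y $ i + b $ i" "y $ i + b $ i < 2 * b $ i"
    using assms(1)[unfolded mem_centred_box, rule_format, of i] by linarith+
  then show "0 < ang b i y" using assms(2) unfolding ang_def by (intro divide_pos_pos mult_pos_pos) auto
  show "ang b i y < pi" using y assms(2) unfolding ang_def by (simp add: divide_less_eq)
qed

lemma frontier_centred_box:
  fixes b :: "real^'n"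
  assumes b: "\<And>i. b $ i > 0" and y: "y \<in> frontier (box (- b) b)"
  obtains i where "ang b i y = 0 \<or> ang b i y = pi"
proof -
  have "closure (box (- b) b) \<subseteq> cbox (- b) b" by (intro closure_minimal box_subset_cbox closed_cbox)
  then have c: "- b $ i \<le> y $ i" "y $ i \<le> b $ i" for i
    using y by (auto simp: frontier_def mem_box_cart)
  have "y \<notin> box (- b) b" using y by (simp add: frontier_def interior_open[OF open_box])
  then obtain i where "\<not> (- b $ i < y $ i \<and> y $ i < b $ i)" unfolding mem_centred_box by blast
  then have "y $ i = - b $ i \<or> y $ i = b $ i" using c[of i] by linarith
  then have "ang b i y = 0 \<or> ang b i y = pi" using b[of i] by (auto simp: ang_def)
  then show ?thesis by (rule that)
qed

lemma mode_frontier: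
  assumes "\<And>i. b $ i > 0" "y \<in> frontier (box (- b) b)"
  shows "mode b f y = 0"
proof -
  obtain i where "ang b i y = 0 \<or> ang b i y = pi" using frontier_centred_box[OF assms] .
  then have "sin (real (f i) * ang b i y) = 0" by auto
  then show ?thesis unfolding mode_def by (intro prod_zero) auto
qed

lemma ground_mode_pos:
  assumes "\<And>i. b $ i > 0" "y \<in> box (- b) b"
  shows "0 < mode b (\<lambda>_. 1) y"
  unfolding mode_def using ang_in_0_pi[OF assms(2,1)] by (intro prod_pos) (simp add: sin_gt_zero)

definition hcoeff :: "nat \<Rightarrow> real^'n \<Rightarrow> real^'n \<Rightarrow> ('n \<Rightarrow> nat) \<Rightarrow> real" where
  "hcoeff N b x f = (\<Prod>i\<in>UNIV. 4 * fcoeff N (f i) * sin (real (f i) * ang b i x))"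

text \<open>
  Expanding the product over the coordinates turns the kernel into a finite combination of
  eigenfunctions of the box. Integration against \<open>u\<close> then gives a finite sum of
  exponentials in \<open>t\<close>.
\<close>
lemma hker_expand:
  fixes b :: "real^'n"
  shows "hker N b t x y = (\<Sum>f\<in>PiE UNIV (\<lambda>_. {1..N}). (hcoeff N b x f * exp (- mode_rate b f * t)) * mode b f y)"
  unfolding hker_def dker_def
proof (subst prod_sum_PiE)
  show "(\<Sum>f\<in>PiE UNIV (\<lambda>_. {1..N}). \<Prod>i\<in>UNIV. 4 * fcoeff N (f i) * exp (- (real (f i))\<^sup>2 * (rate b i * t)) *
       sin (real (f i) * ang b i x) * sin (real (f i) * ang b i y)) =
     (\<Sum>f\<in>PiE UNIV (\<lambda>_. {1..N}). (hcoeff N b x f * exp (- mode_rate b f * t)) * mode b f y)"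
  proof (intro sum.cong refl)
    fix f :: "'n \<Rightarrow> nat"
    have "exp (- mode_rate b f * t) = (\<Prod>i\<in>UNIV. exp (- (real (f i))\<^sup>2 * (rate b i * t)))"
      by (simp add: mode_rate_def sum_distrib_right sum_negf mult.assoc flip: exp_sum)
    then show "(\<Prod>i\<in>UNIV. 4 * fcoeff N (f i) * exp (- (real (f i))\<^sup>2 * (rate b i * t)) *
       sin (real (f i) * ang b i x) * sin (real (f i) * ang b i y)) =
       (hcoeff N b x f * exp (- mode_rate b f * t)) * mode b f y"
      by (simp add: hcoeff_def mode_def ac_simps flip: prod.distrib)
  qed
qed auto

lemma rate_nonneg: "0 \<le> rate b i" by (simp add: rate_def)

lemma hker_nonneg:
  assumes b: "\<And>i. b $ i > 0" and x: "x \<in> box (- b) b" and y: "y \<in> box (- b) b" and t: "t \<ge> 0"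
  shows "0 \<le> hker N b t x y"
  unfolding hker_def using ang_in_0_pi[OF x b] ang_in_0_pi[OF y b] rate_nonneg[of b] t
  by (intro prod_nonneg dker_nonneg) (auto intro: less_imp_le)

lemma continuous_hker: "continuous_on UNIV (hker N b t x)"
  unfolding hker_def dker_def by (intro continuous_intros)

lemma DERIV_exp_mult:
  assumes "(F has_real_derivative D) (at t)"
  shows "((\<lambda>t. exp (l * t) * F t) has_real_derivative exp (l * t) * (l * F t + D)) (at t)"
proof -
  have "((\<lambda>t. exp (l * t)) has_real_derivative exp (l * t) * l) (at t)"
    by (auto intro!: derivative_eq_intros)
  from DERIV_mult[OF this assms] show ?thesis by (simp add: distrib_left mult_ac)
qed

context positive_eigenfunction
begin

text \<open>
  The quantity that is followed in time: the eigenfunction averaged over \<open>V\<close> with the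
  heat kernel started at \<open>x\<close>.
\<close>
definition pairing :: "(real^'n) set \<Rightarrow> nat \<Rightarrow> real^'n \<Rightarrow> real^'n \<Rightarrow> real \<Rightarrow> real" where
  "pairing V N b x t = integral_on V (\<lambda>y. u y * hker N b t x y)"

text \<open>
  The kernel solves the heat equation in \<open>y\<close>, so the time derivative of the pairing is
  the integral of \<open>u\<close> against the Laplacian of the kernel.
\<close>
lemma DERIV_pairing:
  assumes b: "\<And>i. b $ i > 0" and V: "open V" "V \<subseteq> U"
  obtains p1 p2 where "C2_jet (hker N b t x) p1 p2"
    "(pairing V N b x has_real_derivative integral_on V (\<lambda>y. u y * (\<Sum>i\<in>UNIV. p2 i y))) (at t)"
proof -
  let ?S = "PiE UNIV (\<lambda>_. {1..N}) :: ('n \<Rightarrow> nat) set"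
  have fin: "finite ?S" by (intro finite_PiE) auto
  define c where "c s f = hcoeff N b x f * exp (- mode_rate b f * s)" for s f
  define J where "J f = integral_on V (\<lambda>y. u y * mode b f y)" for f
  have h: "hker N b s x y = (\<Sum>f\<in>?S. c s f * mode b f y)" for s y
    by (simp add: hker_expand c_def)
  define p1 where "p1 i y = (\<Sum>f\<in>?S. c t f * mode1 b f i y)" for i y
  define p2 where "p2 i y = (\<Sum>f\<in>?S. c t f * mode2 b f i y)" for i y
  have jet: "C2_jet (hker N b t x) p1 p2"
    using C2_jet_sum[OF fin mode_jet[OF b], of "c t"] unfolding h[abs_def] p1_def[abs_def] p2_def[abs_def] .
  have i: "integrable (lebesgue_on V) (\<lambda>y. u y * mode b f y)" for f
    by (intro integrable_u_mult_subset V C2_jet_D(1)[OF mode_jet[OF b]])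
  have int: "integral_on V (\<lambda>y. u y * (\<Sum>f\<in>?S. d f * mode b f y)) = (\<Sum>f\<in>?S. d f * J f)" for d
  proof -
    have "(\<lambda>y. u y * (\<Sum>f\<in>?S. d f * mode b f y)) = (\<lambda>y. \<Sum>f\<in>?S. d f * (u y * mode b f y))"
      by (simp add: sum_distrib_left mult.left_commute)
    then show ?thesis unfolding J_def using i by simp
  qed
  have F: "pairing V N b x s = (\<Sum>f\<in>?S. c s f * J f)" for s
    unfolding pairing_def h by (rule int)
  have "((\<lambda>s. \<Sum>f\<in>?S. c s f * J f) has_real_derivative (\<Sum>f\<in>?S. (c t f * - mode_rate b f) * J f)) (at t)"
    unfolding c_def by (intro DERIV_sum) (auto intro!: derivative_eq_intros)
  moreover have "(\<Sum>i\<in>UNIV. p2 i y) = (\<Sum>f\<in>?S. (c t f * - mode_rate b f) * mode b f y)" for y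
  proof -
    have "(\<Sum>i\<in>UNIV. p2 i y) = (\<Sum>f\<in>?S. c t f * (\<Sum>i\<in>UNIV. mode2 b f i y))"
      unfolding p2_def by (subst sum.swap) (simp add: sum_distrib_left)
    then show ?thesis by (simp only: mode2_sum mult.assoc)
  qed
  then have "integral_on V (\<lambda>y. u y * (\<Sum>i\<in>UNIV. p2 i y)) = (\<Sum>f\<in>?S. (c t f * - mode_rate b f) * J f)"
    by (simp only: int)
  ultimately have "(pairing V N b x has_real_derivative integral_on V (\<lambda>y. u y * (\<Sum>i\<in>UNIV. p2 i y))) (at t)"
    unfolding F[abs_def] by simp
  with jet show ?thesis by (rule that)
qed

text \<open>
  The subsolution inequality says that the derivative of \<open>e\<^sup>l\<^sup>t\<close> times the
  pairing is nonnegative.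
\<close>
lemma pairing_growth:
  assumes b: "\<And>i. b $ i > 0" and U: "U \<subseteq> box (- b) b" and x: "x \<in> box (- b) b" and T: "T \<ge> 0"
  shows "pairing U N b x 0 \<le> exp (l * T) * pairing U N b x T"
proof -
  have "exp (l * 0) * pairing U N b x 0 \<le> exp (l * T) * pairing U N b x T"
  proof (rule DERIV_nonneg_imp_nondecreasing[OF T])
    fix t :: real assume t: "0 \<le> t"
    obtain p1 p2 where p: "C2_jet (hker N b t x) p1 p2"
      "(pairing U N b x has_real_derivative integral_on U (\<lambda>y. u y * (\<Sum>i\<in>UNIV. p2 i y))) (at t)"
      by (rule DERIV_pairing[OF b open_U subset_refl])
    define D where "D = integral_on U (\<lambda>y. u y * (\<Sum>i\<in>UNIV. p2 i y))"
    have "- D \<le> l * pairing U N b x t"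
      unfolding D_def pairing_def
      by (rule weak_subsolution[OF p(1)]) (use hker_nonneg[OF b x _ t] U in blast)
    then have "0 \<le> exp (l * t) * (l * pairing U N b x t + D)" by simp
    moreover have "((\<lambda>t. exp (l * t) * pairing U N b x t) has_real_derivative exp (l * t) * (l * pairing U N b x t + D)) (at t)"
      using p(2) unfolding D_def[symmetric] by (rule DERIV_exp_mult)
    ultimately show "\<exists>y. ((\<lambda>t. exp (l * t) * pairing U N b x t) has_real_derivative y) (at t) \<and> 0 \<le> y" by blast
  qed
  then show ?thesis by simp
qed

text \<open>
  The counterpart on a box contained in \<open>U\<close>, from the supersolution inequality.
\<close>
lemma pairing_decay:
  assumes b: "\<And>i. b $ i > 0" and V: "box (- b) b \<subseteq> U" and x: "x \<in> box (- b) b" and T: "T \<ge> 0"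
  shows "exp (l * T) * pairing (box (- b) b) N b x T \<le> pairing (box (- b) b) N b x 0"
proof -
  let ?V = "box (- b) b"
  have "exp (l * T) * pairing ?V N b x T \<le> exp (l * 0) * pairing ?V N b x 0"
  proof (rule DERIV_nonpos_imp_nonincreasing[OF T])
    fix t :: real assume t: "0 \<le> t"
    obtain p1 p2 where p: "C2_jet (hker N b t x) p1 p2"
      "(pairing ?V N b x has_real_derivative integral_on ?V (\<lambda>y. u y * (\<Sum>i\<in>UNIV. p2 i y))) (at t)"
      by (rule DERIV_pairing[OF b open_box V])
    define D where "D = integral_on ?V (\<lambda>y. u y * (\<Sum>i\<in>UNIV. p2 i y))"
    have "D \<le> - l * pairing ?V N b x t"
      unfolding D_def pairing_def
    proof (rule weak_supersolution[OF open_box V p(1) mode_jet[OF b, where f="\<lambda>_. 1"]])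
      show "hker N b t x y = 0" if "y \<in> frontier ?V" for y
        unfolding hker_expand mode_frontier[OF b that] by simp
    qed (use hker_nonneg[OF b x _ t] ground_mode_pos[OF b] mode_frontier[OF b] in auto)
    then have "exp (l * t) * (l * pairing ?V N b x t + D) \<le> 0" by (intro mult_nonneg_nonpos) auto
    moreover have "((\<lambda>t. exp (l * t) * pairing ?V N b x t) has_real_derivative exp (l * t) * (l * pairing ?V N b x t + D)) (at t)"
      using p(2) unfolding D_def[symmetric] by (rule DERIV_exp_mult)
    ultimately show "\<exists>y. ((\<lambda>t. exp (l * t) * pairing ?V N b x t) has_real_derivative y) (at t) \<and> y \<le> 0" by blast
  qed
  then show ?thesis by simp
qed

lemma pairing_pos_weight_pos:
  assumes "open V" "V \<subseteq> U" "V \<noteq> {}" "continuous_on UNIV w" "\<And>x. x \<in> V \<Longrightarrow> 0 < w x"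
  shows "0 < integral_on V (\<lambda>y. u y * w y)"
proof -
  let ?I = "integral_on V (\<lambda>y. u y * w y)"
  have i: "integrable (lebesgue_on V) (\<lambda>y. u y * w y)" by (intro integrable_u_mult_subset assms)
  have p: "0 < u y * w y" if "y \<in> V" for y using that assms pos by (intro mult_pos_pos) auto
  have nn: "AE y in lebesgue_on V. 0 \<le> u y * w y" using p by (intro AE_I2) (auto intro: less_imp_le)
  have "?I \<noteq> 0"
  proof
    assume "?I = 0"
    then have "AE y in lebesgue_on V. u y * w y = 0"
      using integral_nonneg_eq_0_iff_AE[OF i nn] by blast
    moreover have "AE y in lebesgue_on V. u y * w y \<noteq> 0"
    proof (rule AE_I2)
      fix y assume "y \<in> space (lebesgue_on V)"
      then show "u y * w y \<noteq> 0" using p[of y] by (metis less_irrefl space_lebesgue_on)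
    qed
    ultimately have "AE y in lebesgue_on V. False" by eventually_elim simp
    then have "emeasure (lebesgue_on V) V = 0" using AE_iff_measurable[of V "lebesgue_on V" "\<lambda>_. False"] by simp
    then have "emeasure lebesgue V = 0" using assms(1) by (simp add: emeasure_restrict_space)
    then have "V \<in> null_sets lebesgue" using assms(1) by (auto simp: null_sets_def)
    then have "negligible V" by (simp add: negligible_iff_null_sets)
    then show False using open_not_negligible[OF assms(1,3)] by blast
  qed
  moreover have "0 \<le> ?I" using p by (intro Bochner_Integration.integral_nonneg) (auto intro: less_imp_le)
  ultimately show ?thesis by simp
qed

lemma mode_rate_ground: "mode_rate b (\<lambda>_. 1) = box_eigenvalue b"
  by (simp add: mode_rate_def box_eigenvalue_def)

lemma integral_ground_mode2:
  "integral_on V (\<lambda>y. u y * (\<Sum>i\<in>UNIV. mode2 b (\<lambda>_. 1) i y)) =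
    - box_eigenvalue b * integral_on V (\<lambda>y. u y * mode b (\<lambda>_. 1) y)"
proof -
  have "(\<lambda>y. u y * (\<Sum>i\<in>UNIV. mode2 b (\<lambda>_. 1) i y)) =
      (\<lambda>y. - box_eigenvalue b * (u y * mode b (\<lambda>_. 1) y))"
    by (simp only: mode2_sum mode_rate_ground mult.left_commute)
  then show ?thesis by (simp only: integral_mult_right_zero)
qed

text \<open>
  Testing the subsolution inequality with the ground state \<open>w\<close> of the box gives
  \<open>\<Lambda> \<integral> u w \<le> l \<integral> u w\<close>, and \<open>\<integral> u w >
  0\<close> because \<open>u\<close> is positive.
\<close>
lemma eigenvalue_ge_box:
  assumes b: "\<And>i. b $ i > 0" and U: "U \<subseteq> box (- b) b"
  shows "box_eigenvalue b \<le> l"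
proof -
  let ?w = "mode b (\<lambda>_. 1)"
  let ?I = "integral_on U (\<lambda>y. u y * ?w y)"
  note jet = mode_jet[OF b, where f="\<lambda>_. 1"]
  have ne: "U \<noteq> {}" using eigen unfolding dirichlet_eigenfunction_def by blast
  have I: "0 < ?I"
    by (rule pairing_pos_weight_pos[OF open_U subset_refl ne C2_jet_D(1)[OF jet]]) (use ground_mode_pos[OF b] U in blast)
  have "- integral_on U (\<lambda>y. u y * (\<Sum>i\<in>UNIV. mode2 b (\<lambda>_. 1) i y)) \<le> l * ?I"
    by (rule weak_subsolution[OF jet]) (use ground_mode_pos[OF b] U in \<open>blast intro: less_imp_le\<close>)
  then have "box_eigenvalue b * ?I \<le> l * ?I" unfolding integral_ground_mode2 by simp
  then show ?thesis using I by simp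
qed

lemma eigenvalue_le_box:
  assumes b: "\<And>i. b $ i > 0" and V: "box (- b) b \<subseteq> U"
  shows "l \<le> box_eigenvalue b"
proof -
  let ?V = "box (- b) b"
  let ?w = "mode b (\<lambda>_. 1)"
  let ?I = "integral_on ?V (\<lambda>y. u y * ?w y)"
  note jet = mode_jet[OF b, where f="\<lambda>_. 1"]
  have "0 \<in> ?V" using b by (simp add: mem_centred_box)
  then have ne: "?V \<noteq> {}" by blast
  have I: "0 < ?I"
    by (rule pairing_pos_weight_pos[OF open_box V ne C2_jet_D(1)[OF jet] ground_mode_pos[OF b]])
  have "integral_on ?V (\<lambda>y. u y * (\<Sum>i\<in>UNIV. mode2 b (\<lambda>_. 1) i y)) \<le> - l * ?I"
    by (rule weak_supersolution_pos[OF open_box V jet ground_mode_pos[OF b] mode_frontier[OF b]])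
  then have "l * ?I \<le> box_eigenvalue b * ?I" unfolding integral_ground_mode2 by simp
  then show ?thesis using I by simp
qed

end

section \<open>Pointwise upper bound\<close>

text \<open>
  The ground state of the box with \<open>L\<^sup>2\<close> norm one: each factor
  \<open>sin\<^sup>2\<close> has integral \<open>b\<^sub>i\<close>.
\<close>
definition box_ground :: "real^'n \<Rightarrow> real^'n \<Rightarrow> real" where
  "box_ground b x = mode b (\<lambda>_. 1) x / sqrt (\<Prod>i\<in>UNIV. b $ i)"

lemma prod_pos_vec: "(\<And>i. b $ i > 0) \<Longrightarrow> 0 < (\<Prod>i\<in>UNIV. b $ i)" for b :: "real^'n"
  by (intro prod_pos) auto

lemma continuous_box_ground: 
  assumes "\<And>i. b $ i > 0" shows "continuous_on UNIV (box_ground b)"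
proof -
  have "box_ground b = (\<lambda>x. inverse (sqrt (\<Prod>i\<in>UNIV. b $ i)) * mode b (\<lambda>_. 1) x)"
    by (simp add: box_ground_def fun_eq_iff divide_inverse mult.commute)
  then show ?thesis using C2_jet_D(1)[OF mode_jet[OF assms]] by (simp only: continuous_on_mult_left)
qed

lemma box_ground_pos:
  assumes "\<And>i. b $ i > 0" "y \<in> box (- b) b" shows "0 < box_ground b y"
  unfolding box_ground_def using ground_mode_pos[OF assms] prod_pos_vec[OF assms(1)] by simp

lemma box_ground_le:
  assumes "\<And>i. b $ i > 0" shows "box_ground b y \<le> 1 / sqrt (\<Prod>i\<in>UNIV. b $ i)" "(box_ground b y)\<^sup>2 \<le> 1 / (\<Prod>i\<in>UNIV. b $ i)"
proof -
  have "\<bar>mode b (\<lambda>_. 1) y\<bar> \<le> 1"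
    unfolding mode_def abs_prod by (intro prod_le_1) auto
  then have m: "mode b (\<lambda>_. 1) y \<le> 1" "(mode b (\<lambda>_. 1) y)\<^sup>2 \<le> 1"
    by (auto simp: abs_square_le_1)
  have P: "0 < (\<Prod>i\<in>UNIV. b $ i)" by (rule prod_pos_vec[OF assms])
  show "box_ground b y \<le> 1 / sqrt (\<Prod>i\<in>UNIV. b $ i)"
    unfolding box_ground_def using P by (intro divide_right_mono m) simp
  show "(box_ground b y)\<^sup>2 \<le> 1 / (\<Prod>i\<in>UNIV. b $ i)"
    unfolding box_ground_def power_divide real_sqrt_pow2[OF less_imp_le[OF P]]
    using P by (intro divide_right_mono m) simp
qed

lemma mode_mult_mode:
  assumes "\<And>i. b $ i > 0"
  shows "mode b (\<lambda>_. 1) x * mode b (\<lambda>_. 1) y = (\<Prod>i\<in>UNIV. b $ i) * box_ground b x * box_ground b y"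
proof -
  have "m * m' = P * (m / sqrt P) * (m' / sqrt P)" if "P > 0" for m m' P :: real
  proof -
    have "P = sqrt P * sqrt P" using that by simp
    then show ?thesis using that by (simp add: field_simps)
  qed
  then show ?thesis unfolding box_ground_def using prod_pos_vec[OF assms] by blast
qed

lemma prod_exp_rate: "(\<Prod>i\<in>UNIV. exp (- (rate b i * T))) = exp (- box_eigenvalue b * T)"
  by (simp add: box_eigenvalue_def sum_distrib_right sum_negf flip: exp_sum)

text \<open>
  The product over the coordinates of the first-mode bounds. The factor \<open>\<Prod>i\<in>UNIV. b
  $ i\<close> comes from the normalisation of \<open>box_ground\<close> and from the mean value
  \<open>1\<close> of the initial peaks; it cancels against the size of the pairing at time zero.
\<close>
lemma hker_large_time:
  fixes b :: "real^'n"
  assumes b: "\<And>i. b $ i > 0" and x: "x \<in> box (- b) b" and y: "y \<in> box (- b) b"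
    and T: "\<And>i. 5 \<le> rate b i * T" and N: "3 \<le> N"
  shows "hker N b T x y \<le> 5 ^ CARD('n) * exp (- box_eigenvalue b * T) * ((\<Prod>i\<in>UNIV. b $ i) * box_ground b x * box_ground b y)"
    and "2 ^ CARD('n) * exp (- box_eigenvalue b * T) * ((\<Prod>i\<in>UNIV. b $ i) * box_ground b x * box_ground b y) \<le> hker N b T x y"
proof -
  have X: "ang b i x \<in> {0..pi}" "ang b i y \<in> {0..pi}" for i
    using ang_in_0_pi[OF x b] ang_in_0_pi[OF y b] by (auto intro: less_imp_le)
  have e: "(\<Prod>i\<in>UNIV. c * exp (- (rate b i * T)) * (sin (ang b i x) * sin (ang b i y))) =
     c ^ CARD('n) * exp (- box_eigenvalue b * T) * ((\<Prod>i\<in>UNIV. b $ i) * box_ground b x * box_ground b y)" for c :: real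
    by (simp add: prod.distrib prod_exp_rate mode_mult_mode[OF b, symmetric] mode_def)
  have s: "0 \<le> sin (ang b i x) * sin (ang b i y)" for i
    using X by (intro mult_nonneg_nonneg sin_ge_zero) auto
  note k = dker_large_time[OF X T N]
  show "hker N b T x y \<le> 5 ^ CARD('n) * exp (- box_eigenvalue b * T) * ((\<Prod>i\<in>UNIV. b $ i) * box_ground b x * box_ground b y)"
    unfolding e[symmetric] hker_def
  proof (intro prod_mono conjI)
    fix i
    show "dker N (rate b i * T) (ang b i x) (ang b i y) \<le> 5 * exp (- (rate b i * T)) * (sin (ang b i x) * sin (ang b i y))"
      by (rule k(1))
    show "0 \<le> dker N (rate b i * T) (ang b i x) (ang b i y)" using X T[of i] by (intro dker_nonneg) auto
  qed
  show "2 ^ CARD('n) * exp (- box_eigenvalue b * T) * ((\<Prod>i\<in>UNIV. b $ i) * box_ground b x * box_ground b y) \<le> hker N b T x y"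
    unfolding e[symmetric] hker_def
  proof (intro prod_mono conjI)
    fix i
    show "2 * exp (- (rate b i * T)) * (sin (ang b i x) * sin (ang b i y)) \<le> dker N (rate b i * T) (ang b i x) (ang b i y)"
      by (rule k(2))
    show "0 \<le> 2 * exp (- (rate b i * T)) * (sin (ang b i x) * sin (ang b i y))" using s by simp
  qed
qed

lemma ang_diff: "b $ i > 0 \<Longrightarrow> ang b i x - ang b i y = pi * (x $ i - y $ i) / (2 * b $ i)"
  by (simp add: ang_def field_simps)

lemma prod_Basis_cart: "(\<Prod>e\<in>(Basis :: (real^'n) set). g e) = (\<Prod>i\<in>UNIV. g (axis i 1))"
proof -
  have B: "(Basis :: (real^'n) set) = range (\<lambda>i. axis i 1)" by (auto simp: Basis_vec_def)
  have "inj (\<lambda>i::'n. axis i (1::real))" by (auto simp: inj_on_def axis_eq_axis)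
  then show ?thesis unfolding B by (simp add: prod.reindex)
qed

text \<open>
  Every \<open>y\<close> in the box lies within one full period of each of the peaks centred at the
  coordinates of \<open>x\<close>, so the integral factorises into periods of total mass \<open>4
  a\<^sub>i\<close>.
\<close>
lemma integral_prod_peak_le:
  fixes a x :: "real^'n"
  assumes a: "\<And>i. a $ i > 0" and x: "x \<in> box (- a) a"
  shows "integral_on (box (- a) a) (\<lambda>y. \<Prod>i\<in>UNIV. peak N (pi * (x $ i - y $ i) / (2 * a $ i)))
    \<le> (\<Prod>i\<in>UNIV. 4 * a $ i)"
proof -
  let ?V = "box (- a) a"
  define f where "f y = (\<Prod>i\<in>UNIV. peak N (pi * (x $ i - y $ i) / (2 * a $ i)))" for y :: "real^'n"
  have f0: "0 \<le> f y" for y unfolding f_def by (intro prod_nonneg peak_nonneg)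
  have pkm[measurable]: "(\<lambda>s. peak N (pi * (c - s) / (2 * d))) \<in> borel_measurable borel" for c d
    unfolding peak_def by measurable
  have fm[measurable]: "f \<in> borel_measurable borel"
    unfolding f_def[abs_def]
  proof (intro borel_measurable_prod)
    fix i :: 'n
    have "(\<lambda>y::real^'n. y $ i) \<in> borel_measurable borel"
      by (intro borel_measurable_continuous_onI continuous_intros)
    then show "(\<lambda>y. peak N (pi * (x $ i - y $ i) / (2 * a $ i))) \<in> borel_measurable borel"
      using measurable_compose[OF _ pkm] by blast
  qed
  have gm: "(\<lambda>y. if y \<in> ?V then f y else 0) \<in> borel_measurable borel" by measurable
  define F where "F e s = ennreal (indicator {x \<bullet> e - 2 * (a \<bullet> e)..x \<bullet> e + 2 * (a \<bullet> e)} s * peak N (pi * (x \<bullet> e - s) / (2 * (a \<bullet> e))))" for e s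
  have "(\<integral>\<^sup>+ y. ennreal (if y \<in> ?V then f y else 0) \<partial>lborel) \<le> (\<integral>\<^sup>+ y. (\<Prod>e\<in>Basis. F e (y \<bullet> e)) \<partial>lborel)"
  proof (rule nn_integral_mono)
    fix y :: "real^'n"
    show "ennreal (if y \<in> ?V then f y else 0) \<le> (\<Prod>e\<in>Basis. F e (y \<bullet> e))"
    proof (cases "y \<in> ?V")
      case True
      have "y $ i \<in> {x $ i - 2 * a $ i..x $ i + 2 * a $ i}" for i
      proof -
        have "- a $ i < x $ i \<and> x $ i < a $ i" "- a $ i < y $ i \<and> y $ i < a $ i"
          using x True unfolding mem_centred_box by blast+
        then show ?thesis unfolding atLeastAtMost_iff by linarith
      qed
      then have "(\<Prod>e\<in>Basis. F e (y \<bullet> e)) = (\<Prod>i\<in>UNIV. ennreal (peak N (pi * (x $ i - y $ i) / (2 * a $ i))))"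
        by (simp add: prod_Basis_cart F_def inner_axis)
      also have "\<dots> = ennreal (f y)" unfolding f_def by (rule prod_ennreal) (rule peak_nonneg)
      finally show ?thesis using True by simp
    qed simp
  qed
  also have "\<dots> = (\<Prod>e\<in>Basis. (\<integral>\<^sup>+ s. F e s \<partial>lborel))"
    by (rule nn_integral_lborel_prod) (auto simp: F_def intro!: measurable_compose[OF _ measurable_ennreal] borel_measurable_times pkm)
  also have "\<dots> = (\<Prod>i\<in>UNIV. ennreal (4 * a $ i))"
    unfolding prod_Basis_cart F_def by (intro prod.cong refl) (simp only: inner_axis inner_real_def mult_1_right peak_mass[OF a])
  also have "\<dots> = ennreal (\<Prod>i\<in>UNIV. 4 * a $ i)" using a by (intro prod_ennreal) (simp add: less_imp_le)
  finally have le: "(\<integral>\<^sup>+ y. ennreal (if y \<in> ?V then f y else 0) \<partial>lborel) \<le> ennreal (\<Prod>i\<in>UNIV. 4 * a $ i)" .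
  have "integral_on ?V f = integral\<^sup>L lborel (\<lambda>y. if y \<in> ?V then f y else 0)"
    by (rule integral_lebesgue_on_eq_lborel(1)[OF open_box gm])
  also have "\<dots> = enn2real (\<integral>\<^sup>+ y. ennreal (if y \<in> ?V then f y else 0) \<partial>lborel)"
    by (rule integral_eq_nn_integral) (use gm f0 in auto)
  also have "\<dots> \<le> (\<Prod>i\<in>UNIV. 4 * a $ i)"
    using enn2real_mono[OF le] a by (simp add: prod_nonneg less_imp_le)
  finally show ?thesis unfolding f_def .
qed

lemma measure_centred_box:
  fixes b :: "real^'n"
  assumes b: "\<And>i. b $ i > 0"
  shows "measure lebesgue (box (- b) b) = 2 ^ CARD('n) * (\<Prod>i\<in>UNIV. b $ i)"
proof -
  have "0 \<in> cbox (- b) b" using b by (simp add: mem_box_cart less_imp_le)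
  then have ne: "cbox (- b) b \<noteq> {}" by blast
  have "measure lebesgue (box (- b) b) = measure lborel (cbox (- b) b)"
    by (simp add: measure_completion measure_lborel_box_eq measure_lborel_cbox_eq)
  also have "\<dots> = (\<Prod>i\<in>UNIV. b $ i - (- b) $ i)" by (rule content_cbox_cart[OF ne])
  also have "\<dots> = (\<Prod>i\<in>UNIV. 2 * b $ i)" by (intro prod.cong refl) simp
  finally show ?thesis by (simp add: prod.distrib)
qed

lemma norm_less_componentwise:
  fixes z :: "real^'n"
  assumes "\<And>i. \<bar>z $ i\<bar> < d / real CARD('n)"
  shows "norm z < d"
proof -
  have "norm z \<le> (\<Sum>i\<in>UNIV. \<bar>z $ i\<bar>)" by (rule norm_le_l1_cart)
  also have "\<dots> < (\<Sum>i\<in>(UNIV::'n set). d / real CARD('n))" by (intro sum_strict_mono assms) auto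
  also have "\<dots> = d" by simp
  finally show ?thesis .
qed

lemma power_times_geometric_tendsto_0:
  fixes r :: real
  assumes r: "0 \<le> r" "r < 1" and n: "n > 0"
  shows "(\<lambda>N. (2 * real N) ^ n * r ^ N) \<longlonglongrightarrow> 0"
proof -
  define s where "s = root n r"
  have s: "0 \<le> s" "s < 1" "s ^ n = r" using r n by (auto simp: s_def real_root_lt_1_iff)
  have "(\<lambda>N. of_nat N * s ^ N) \<longlonglongrightarrow> 0" by (rule powser_times_n_limit_0) (use s in simp)
  then have "(\<lambda>N. (2 * (real N * s ^ N)) ^ n) \<longlonglongrightarrow> (2 * 0) ^ n" by (intro tendsto_intros)
  moreover have "(2 * (real N * s ^ N)) ^ n = (2 * real N) ^ n * r ^ N" for N
  proof -
    have "r ^ N = (s ^ N) ^ n" unfolding s(3)[symmetric] by (simp only: power_mult[symmetric] mult.commute)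
    then show ?thesis by (simp add: power_mult_distrib)
  qed
  moreover have "(2 * 0 :: real) ^ n = 0" using n by simp
  ultimately show ?thesis by (simp only:)
qed

context positive_eigenfunction
begin

lemma u_continuous_at:
  assumes "x \<in> U" "e > 0"
  obtains d where "d > 0" "ball x d \<subseteq> U" "\<And>y. y \<in> ball x d \<Longrightarrow> \<bar>u y - u x\<bar> < e"
proof -
  obtain r where r: "r > 0" "ball x r \<subseteq> U" using open_U assms(1) open_contains_ball by blast
  have "continuous_on U u" by (rule Ck2_on_D(1)[OF u_facts(1) open_U])
  then obtain s where s: "s > 0" "\<And>y. y \<in> U \<Longrightarrow> dist y x < s \<Longrightarrow> dist (u y) (u x) < e"
    using assms unfolding continuous_on_iff by metis
  show ?thesis
  proof (rule that[of "min r s"])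
    show "min r s > 0" "ball x (min r s) \<subseteq> U" using r s(1) by auto
    show "\<bar>u y - u x\<bar> < e" if "y \<in> ball x (min r s)" for y
      using s(2)[of y] that r(2) by (auto simp: dist_real_def dist_commute)
  qed
qed

lemma integral_u_square: "integral_on U (\<lambda>x. (u x)\<^sup>2) = 1"
  "integrable (lebesgue_on U) (\<lambda>x. (u x)\<^sup>2)"
  using normalized L2_onD(2)[OF u_facts(2)] by (auto simp: L2_norm_on_def)

lemma ground_pairing_le:
  assumes b: "\<And>i. b $ i > 0" and U: "U \<subseteq> box (- b) b"
  shows "integral_on U (\<lambda>y. u y * box_ground b y) \<le> (2 ^ CARD('n) + 1) / 2"
proof -
  interpret finite_measure "lebesgue_on U" by (rule finite_measure_lebesgue_on_bounded[OF open_U bounded_U])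
  define P where "P = (\<Prod>i\<in>UNIV. b $ i)"
  have P: "P > 0" unfolding P_def by (rule prod_pos_vec[OF b])
  have "integral_on U (\<lambda>y. u y * box_ground b y) \<le> integral_on U (\<lambda>y. (u y)\<^sup>2 / 2 + 1 / P / 2)"
  proof (rule integral_mono)
    show "integrable (lebesgue_on U) (\<lambda>y. u y * box_ground b y)"
      by (rule integrable_u_mult[OF continuous_box_ground[OF b]])
    show "integrable (lebesgue_on U) (\<lambda>y. (u y)\<^sup>2 / 2 + 1 / P / 2)"
      using integral_u_square(2) by (intro Bochner_Integration.integrable_add) auto
    fix y
    have "2 * (u y * box_ground b y) \<le> (u y)\<^sup>2 + (box_ground b y)\<^sup>2"
      using sum_squares_bound[of "u y" "box_ground b y"] by simp
    moreover have "a \<le> s / 2 + q / 2" if "2 * a \<le> s + t" "t \<le> q" for a s t q :: real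
      using that by simp
    ultimately show "u y * box_ground b y \<le> (u y)\<^sup>2 / 2 + 1 / P / 2"
      using box_ground_le(2)[OF b, of y] unfolding P_def by blast
  qed
  also have "\<dots> = 1 / 2 + measure lebesgue U / P / 2"
    using integral_u_square open_U by (simp add: measure_restrict_space)
  also have "measure lebesgue U \<le> 2 ^ CARD('n) * P"
    unfolding P_def measure_centred_box[OF b, symmetric] using U open_U
    by (intro measure_mono_fmeasurable) auto
  then have "measure lebesgue U / P / 2 \<le> 2 ^ CARD('n) / 2" using P by (simp add: divide_le_eq)
  finally show ?thesis using P by (simp add: add_divide_distrib)
qed

text \<open>
  The kernel is of order \<open>N\<^sup>n\<^sup>/\<^sup>2\<close> on a box around \<open>x\<close>
  with sides of order \<open>b\<^sub>i / \<surd>N\<close>, on which \<open>u\<close> is at least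
  \<open>u x / 2\<close> for large \<open>N\<close>. The powers of \<open>N\<close> cancel.
\<close>
lemma pairing_0_lower:
  assumes b: "\<And>i. b $ i > 0" and U: "U \<subseteq> box (- b) b" and x: "x \<in> U"
  shows "\<forall>\<^sub>F N in sequentially. u x / 2 * ((\<Prod>i\<in>UNIV. b $ i) / pi ^ CARD('n)) \<le> pairing U N b x 0"
proof -
  have ux: "u x > 0" using pos x .
  have xb: "x \<in> box (- b) b" using x U by blast
  obtain d where d: "d > 0" "ball x d \<subseteq> U" "\<And>y. y \<in> ball x d \<Longrightarrow> \<bar>u y - u x\<bar> < u x / 2"
    using u_continuous_at[OF x, of "u x / 2"] ux by auto
  \<comment> \<open>half-sides of the box that corresponds to the distance \<open>1 / \<surd>N\<close> in the angles\<close>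
  define h where "h N i = 2 * b $ i / pi * (1 / sqrt (real N))" for N i
  have hl: "(\<lambda>N. h N i) \<longlonglongrightarrow> 0" for i
    unfolding h_def by (rule tendsto_mult_right_zero[OF inverse_sqrt_tendsto_0])
  have E1: "\<forall>\<^sub>F N in sequentially. \<forall>i. h N i < d / real CARD('n)"
    by (intro eventually_all_finite order_tendstoD(2)[OF hl]) (use d in simp)
  have E2: "\<forall>\<^sub>F N in sequentially. \<forall>i. \<forall>y. \<bar>y - ang b i x\<bar> \<le> 1 / sqrt (real N) \<longrightarrow> sqrt (real N) / 4 \<le> dker N 0 (ang b i x) y"
    by (intro eventually_all_finite dker_0_local_lower ang_in_0_pi[OF xb b])
  show ?thesis
    using E1 E2 eventually_gt_at_top[of 0]
  proof eventually_elim
    case (elim N)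
    then have hd: "h N i < d / real CARD('n)" and N: "N > 0" for i by auto
    note loc = elim(2)[rule_format]
    have h0: "h N i > 0" for i using b[of i] N by (simp add: h_def)
    define H where "H = (\<chi> i. h N i)"
    define Q where "Q = cbox (x - H) (x + H)"
    have Q: "\<bar>y $ i - x $ i\<bar> \<le> h N i" if "y \<in> Q" for y i
    proof -
      have "x $ i - h N i \<le> y $ i \<and> y $ i \<le> x $ i + h N i"
        using that by (simp add: Q_def H_def mem_box_cart)
      then show ?thesis by linarith
    qed
    have Qball: "Q \<subseteq> ball x d"
    proof
      fix y assume "y \<in> Q"
      then have "norm (y - x) < d"
        using Q hd by (intro norm_less_componentwise) (auto intro: le_less_trans)
      then show "y \<in> ball x d" by (simp add: dist_norm norm_minus_commute)
    qed
    define c where "c = u x / 2 * (sqrt (real N) / 4) ^ CARD('n)"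
    have c0: "c \<ge> 0" using ux by (simp add: c_def)
    have Qs: "Q \<in> sets lebesgue" by (simp add: Q_def)
    have QU: "Q \<subseteq> U" using Qball d(2) by blast
    have fQ: "emeasure lebesgue Q < \<infinity>" unfolding Q_def using emeasure_lborel_cbox_finite by simp
    have Qr: "Q \<in> sets (lebesgue_on U)" using QU Qs open_U by (auto simp: sets_restrict_space_iff)
    have mQ: "measure (lebesgue_on U) Q = measure lebesgue Q"
      using QU open_U by (intro measure_restrict_space) auto
    have point: "c * indicator Q y \<le> u y * hker N b 0 x y" if "y \<in> U" for y
    proof (cases "y \<in> Q")
      case True
      have "u x / 2 \<le> u y" using d(3)[of y] Qball True by (auto simp: abs_if split: if_splits)
      moreover have "(\<Prod>i\<in>(UNIV::'n set). sqrt (real N) / 4) \<le> hker N b 0 x y"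
        unfolding hker_def
      proof (intro prod_mono conjI)
        fix i
        have "\<bar>ang b i y - ang b i x\<bar> = pi / (2 * b $ i) * \<bar>y $ i - x $ i\<bar>"
          using b[of i] by (simp add: ang_diff abs_mult)
        also have "\<dots> \<le> pi / (2 * b $ i) * h N i"
          using b[of i] by (intro mult_left_mono Q True) auto
        also have "\<dots> = 1 / sqrt (real N)" using b[of i] by (simp add: h_def)
        finally show "sqrt (real N) / 4 \<le> dker N (rate b i * 0) (ang b i x) (ang b i y)"
          using loc by simp
      qed simp
      ultimately have "u x / 2 * (\<Prod>i\<in>(UNIV::'n set). sqrt (real N) / 4) \<le> u y * hker N b 0 x y"
        using ux by (intro mult_mono) auto
      then show ?thesis using True by (simp add: c_def)
    next
      case False
      have "0 \<le> u y * hker N b 0 x y"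
        using pos[OF that] hker_nonneg[OF b xb, of y 0 N] U that by (intro mult_nonneg_nonneg) auto
      then show ?thesis using False by simp
    qed
    have "c * measure lebesgue Q = integral_on U (\<lambda>y. c * indicator Q y)"
      using mQ QU by (simp add: Int_absorb2)
    also have "\<dots> \<le> pairing U N b x 0"
      unfolding pairing_def
    proof (rule integral_mono)
      show "integrable (lebesgue_on U) (\<lambda>y. c * indicator Q y)"
        using Qr fQ QU open_U by (intro integrable_mult_right integrable_real_indicator) (auto simp: emeasure_restrict_space)
      show "integrable (lebesgue_on U) (\<lambda>y. u y * hker N b 0 x y)" by (intro integrable_u_mult continuous_hker)
    qed (use point in simp)
    also have "measure lebesgue Q = (\<Prod>i\<in>UNIV. 2 * h N i)"
    proof -
      have "x \<in> Q" using h0 by (simp add: Q_def H_def mem_box_cart less_imp_le)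
      then have ne: "cbox (x - H) (x + H) \<noteq> {}" unfolding Q_def by blast
      have "measure lebesgue Q = (\<Prod>i\<in>UNIV. (x + H) $ i - (x - H) $ i)"
        unfolding Q_def using content_cbox_cart[OF ne] by (simp add: measure_completion)
      also have "\<dots> = (\<Prod>i\<in>UNIV. 2 * h N i)" by (intro prod.cong refl) (simp add: H_def)
      finally show ?thesis .
    qed
    finally have F: "c * (\<Prod>i\<in>UNIV. 2 * h N i) \<le> pairing U N b x 0" .
    have "(sqrt (real N) / 4) ^ CARD('n) * (\<Prod>i\<in>UNIV. 2 * h N i) = (\<Prod>i\<in>UNIV. sqrt (real N) / 4 * (2 * h N i))"
      by (simp only: prod.distrib prod_constant)
    also have "\<dots> = (\<Prod>i\<in>UNIV. b $ i / pi)"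
      using N by (intro prod.cong refl) (simp add: h_def)
    also have "\<dots> = (\<Prod>i\<in>UNIV. b $ i) / pi ^ CARD('n)" by (simp add: prod_dividef)
    finally show ?case using F unfolding c_def by (simp add: mult.assoc)
  qed
qed

text \<open>
  The pairing at time zero bounds \<open>u x\<close> from above, the pairing at time
  \<open>T\<close> is controlled by the first mode, and \<open>pairing_growth\<close> connects the
  two.
\<close>
lemma upper_bound:
  assumes b: "\<And>i. b $ i > 0" and U: "U \<subseteq> box (- b) b" and x: "x \<in> U" and T: "\<And>i. 5 \<le> rate b i * T"
  shows "u x \<le> (5 * pi) ^ CARD('n) * (2 ^ CARD('n) + 1) * exp ((l - box_eigenvalue b) * T) * box_ground b x"
proof -
  define P where "P = (\<Prod>i\<in>UNIV. b $ i)"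
  define I where "I = integral_on U (\<lambda>y. u y * box_ground b y)"
  define E where "E = 5 ^ CARD('n) * exp (- box_eigenvalue b * T)"
  have P: "P > 0" unfolding P_def by (rule prod_pos_vec[OF b])
  have T0: "T \<ge> 0"
  proof (rule ccontr)
    assume "\<not> T \<ge> 0"
    then have "rate b undefined * T \<le> 0" using rate_nonneg by (intro mult_nonneg_nonpos) auto
    then show False using T[of undefined] by linarith
  qed
  have xb: "x \<in> box (- b) b" using x U by blast
  have B: "0 < box_ground b x" by (rule box_ground_pos[OF b xb])
  obtain N where N: "N \<ge> 3" "u x / 2 * (P / pi ^ CARD('n)) \<le> pairing U N b x 0"
    using eventually_conj[OF pairing_0_lower[OF b U x] eventually_ge_at_top[of 3]]
    unfolding P_def eventually_sequentially by blast
  have "pairing U N b x T \<le> integral_on U (\<lambda>y. E * P * box_ground b x * (u y * box_ground b y))"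
    unfolding pairing_def
  proof (rule integral_mono)
    show "integrable (lebesgue_on U) (\<lambda>y. u y * hker N b T x y)" by (intro integrable_u_mult continuous_hker)
    show "integrable (lebesgue_on U) (\<lambda>y. E * P * box_ground b x * (u y * box_ground b y))"
      by (intro integrable_mult_right integrable_u_mult continuous_box_ground b)
    fix y assume "y \<in> space (lebesgue_on U)"
    then have y: "y \<in> U" by simp
    have "hker N b T x y \<le> E * (P * box_ground b x * box_ground b y)"
      unfolding E_def P_def using hker_large_time(1)[OF b xb _ T N(1)] y U by blast
    then have "u y * hker N b T x y \<le> u y * (E * (P * box_ground b x * box_ground b y))"
      using pos[OF y] by (intro mult_left_mono) auto
    then show "u y * hker N b T x y \<le> E * P * box_ground b x * (u y * box_ground b y)" by (simp add: mult_ac)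
  qed
  also have "\<dots> = E * P * box_ground b x * I" by (simp add: I_def)
  also have "\<dots> \<le> E * P * box_ground b x * ((2 ^ CARD('n) + 1) / 2)"
    unfolding I_def using P B by (intro mult_left_mono ground_pairing_le b U) (auto simp: E_def)
  finally have FT: "pairing U N b x T \<le> E * P * box_ground b x * ((2 ^ CARD('n) + 1) / 2)" .
  have "u x / 2 * (P / pi ^ CARD('n)) \<le> exp (l * T) * pairing U N b x T"
    using N(2) pairing_growth[OF b U xb T0, of N] by linarith
  also have "\<dots> \<le> exp (l * T) * (E * P * box_ground b x * ((2 ^ CARD('n) + 1) / 2))"
    by (intro mult_left_mono FT) simp
  also have "\<dots> = P / pi ^ CARD('n) / 2 * ((5 * pi) ^ CARD('n) * (2 ^ CARD('n) + 1) * exp ((l - box_eigenvalue b) * T) * box_ground b x)"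
    by (simp add: E_def power_mult_distrib left_diff_distrib exp_diff exp_minus field_simps)
  finally have "(P / pi ^ CARD('n) / 2) * u x \<le> P / pi ^ CARD('n) / 2 * ((5 * pi) ^ CARD('n) * (2 ^ CARD('n) + 1) * exp ((l - box_eigenvalue b) * T) * box_ground b x)"
    by (simp add: mult.commute)
  then show ?thesis by (rule mult_left_le_imp_le) (use P in simp)
qed

end

section \<open>Pointwise lower bound\<close>

context positive_eigenfunction
begin

text \<open>
  Near \<open>x\<close> one has \<open>u \<le> 2 u x\<close> and the kernel has bounded mass; at a
  distance at least \<open>d\<close> some coordinate differs by a fixed amount, and the kernel is
  smaller than a power of \<open>N\<close> times a geometric sequence, while \<open>u\<close> is
  integrable.
\<close>
lemma pairing_0_upper:
  fixes a x :: "real^'n"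
  assumes a: "\<And>i. a $ i > 0" and V: "box (- a) a \<subseteq> U" and x: "x \<in> box (- a) a"
  shows "\<forall>\<^sub>F N in sequentially. pairing (box (- a) a) N a x 0 \<le> (2 * 4 ^ CARD('n) + 1) * (\<Prod>i\<in>UNIV. a $ i) * u x"
proof -
  let ?V = "box (- a) a"
  let ?M = "lebesgue_on ?V"
  let ?n = "CARD('n)"
  define P where "P = (\<Prod>i\<in>UNIV. a $ i)"
  have P: "P > 0" unfolding P_def by (rule prod_pos_vec[OF a])
  have xU: "x \<in> U" using x V by blast
  have ux: "u x > 0" using pos xU .
  obtain d where d: "d > 0" "\<And>y. y \<in> ball x d \<Longrightarrow> \<bar>u y - u x\<bar> < u x"
    using u_continuous_at[OF xU ux] by metis
  define \<delta> where "\<delta> = d / real ?n"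
  define m where "m = Max (range (\<lambda>i. a $ i))"
  have m: "a $ i \<le> m" for i unfolding m_def by (intro Max_ge) auto
  have m0: "m > 0" using m[of undefined] a[of undefined] by linarith
  \<comment> \<open>the angle seen at distance \<open>\<delta>\<close> in a coordinate, smallest for the longest side; the cap at \<open>pi\<close> keeps \<open>cos \<eta> < 1\<close>\<close>
  define \<eta> where "\<eta> = min pi (pi * \<delta> / (2 * m))"
  have delta: "\<delta> > 0" using d by (simp add: \<delta>_def)
  have eta: "0 < \<eta>" "\<eta> \<le> pi" using delta m0 by (auto simp: \<eta>_def)
  define r where "r = (1 + cos \<eta>) / 2"
  have "cos \<eta> < cos 0" using eta by (intro cos_monotone_0_pi) auto
  then have r: "0 \<le> r" "r < 1" using one_plus_cos_nonneg[of \<eta>] by (auto simp: r_def)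
  define I where "I = integral\<^sup>L ?M u"
  have iu: "integrable ?M u" using integrable_u_mult_subset[OF open_box V continuous_on_const[of _ 1]] by simp
  have X: "ang a i x \<in> {0..pi}" for i using ang_in_0_pi[OF x a] by (auto intro: less_imp_le)
  have "(\<lambda>N. (2 * real N) ^ ?n * r ^ N * I) \<longlonglongrightarrow> 0 * I"
    by (intro tendsto_mult tendsto_const power_times_geometric_tendsto_0 r) simp
  then have E: "\<forall>\<^sub>F N in sequentially. (2 * real N) ^ ?n * r ^ N * I < P * u x"
    by (rule order_tendstoD(2)) (use P ux in simp)
  show ?thesis
    using E eventually_gt_at_top[of 0]
  proof eventually_elim
    case (elim N)
    note tail = elim(1) and N = elim(2)
    define \<tau> where "\<tau> = (2 * real N) ^ ?n * r ^ N"
    have tau: "\<tau> \<ge> 0" using r by (simp add: \<tau>_def)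
    define K where "K y = (\<Prod>i\<in>UNIV. peak N (pi * (x $ i - y $ i) / (2 * a $ i)))" for y
    have K0: "K y \<ge> 0" for y unfolding K_def by (intro prod_nonneg peak_nonneg)
    have Kc: "continuous_on UNIV K"
    proof -
      have "continuous_on UNIV (\<lambda>y. pi / (2 * a $ i) * (x $ i - y $ i))" for i
        by (intro continuous_on_mult_left continuous_intros)
      then have arg: "continuous_on UNIV (\<lambda>y. pi * (x $ i - y $ i) / (2 * a $ i))" for i by simp
      have "continuous_on UNIV (peak N)" unfolding peak_def by (intro continuous_intros) auto
      then have "continuous_on UNIV (\<lambda>y. peak N (pi * (x $ i - y $ i) / (2 * a $ i)))" for i
        using continuous_on_compose2[OF _ arg[of i]] by blast
      then show ?thesis unfolding K_def by (intro continuous_on_prod)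
    qed
    have point: "u y * hker N a 0 x y \<le> 2 * u x * K y + \<tau> * u y" if y: "y \<in> ?V" for y
    proof -
      have uy: "u y > 0" using pos y V by blast
      have Y: "ang a i y \<in> {0..pi}" for i using ang_in_0_pi[OF y a] by (auto intro: less_imp_le)
      have k0: "0 \<le> dker N 0 (ang a i x) (ang a i y)" for i by (intro dker_0_nonneg X Y)
      have kp: "dker N 0 (ang a i x) (ang a i y) \<le> peak N (pi * (x $ i - y $ i) / (2 * a $ i))" for i
        using dker_0_le_peak[of N "ang a i x" "ang a i y"] by (simp add: ang_diff a)
      show ?thesis
      proof (cases "y \<in> ball x d")
        case True
        have "u y \<le> 2 * u x" using d(2)[OF True] by (auto simp: abs_if split: if_splits)
        moreover have "hker N a 0 x y \<le> K y"
          unfolding hker_def K_def using k0 kp by (intro prod_mono) simp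
        moreover have "0 \<le> hker N a 0 x y" unfolding hker_def using k0 by (intro prod_nonneg) simp
        ultimately have "u y * hker N a 0 x y \<le> 2 * u x * K y" using ux by (intro mult_mono) auto
        moreover have "0 \<le> \<tau> * u y" using tau uy by simp
        ultimately show ?thesis by linarith
      next
        case False
        then have "\<not> norm (y - x) < d" by (simp add: dist_norm norm_minus_commute)
        then obtain i where "\<not> \<bar>(y - x) $ i\<bar> < d / real ?n" using norm_less_componentwise by blast
        then have i: "\<delta> \<le> \<bar>x $ i - y $ i\<bar>" by (simp add: \<delta>_def abs_minus_commute)
        have "\<eta> \<le> pi * \<delta> / (2 * m)" by (simp add: \<eta>_def)
        also have "\<dots> \<le> pi * \<bar>x $ i - y $ i\<bar> / (2 * a $ i)"
          using i delta m[of i] a[of i] by (intro frac_le mult_left_mono) auto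
        also have "\<dots> = \<bar>ang a i x - ang a i y\<bar>" using a[of i] by (simp add: ang_diff abs_mult)
        finally have "dker N 0 (ang a i x) (ang a i y) \<le> 2 * real N * r ^ N"
          unfolding r_def using eta by (intro dker_0_tail N X Y) auto
        moreover have "(\<Prod>j\<in>UNIV - {i}. dker N 0 (ang a j x) (ang a j y)) \<le> (2 * real N) ^ (?n - 1)"
        proof -
          have "(\<Prod>j\<in>UNIV - {i}. dker N 0 (ang a j x) (ang a j y)) \<le> (\<Prod>j\<in>UNIV - {i}. 2 * real N)"
            using k0 kp peak_le[OF N] by (intro prod_mono) (auto intro: order_trans)
          also have "\<dots> = (2 * real N) ^ (?n - 1)" by (simp add: card_Diff_singleton)
          finally show ?thesis .
        qed
        moreover have "hker N a 0 x y = dker N 0 (ang a i x) (ang a i y) * (\<Prod>j\<in>UNIV - {i}. dker N 0 (ang a j x) (ang a j y))"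
          unfolding hker_def by (subst prod.remove[of UNIV i]) simp_all
        ultimately have "hker N a 0 x y \<le> (2 * real N * r ^ N) * (2 * real N) ^ (?n - 1)"
          using k0 r by (auto intro!: mult_mono prod_nonneg)
        also have "\<dots> = \<tau>"
        proof -
          have "(2 * real N) ^ ?n = 2 * real N * (2 * real N) ^ (?n - 1)"
            by (rule power_eq_if[of _ ?n, THEN trans]) simp
          then show ?thesis by (simp add: \<tau>_def)
        qed
        finally have "u y * hker N a 0 x y \<le> \<tau> * u y" using uy by (simp add: mult.commute)
        moreover have "0 \<le> 2 * u x * K y" using ux K0 by simp
        ultimately show ?thesis by linarith
      qed
    qed
    have iK: "integrable ?M K"
    proof -
      have fm: "finite_measure ?M" by (rule finite_measure_lebesgue_on_bounded) auto
      obtain B where B: "\<And>y. y \<in> ?V \<Longrightarrow> \<bar>K y\<bar> \<le> B" using bounded_on_bounded[OF bounded_box Kc] by blast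
      show ?thesis
        by (rule finite_measure.integrable_const_bound[OF fm, of _ B])
           (use B continuous_borel_lebesgue_on[OF Kc] in \<open>auto intro!: AE_I2\<close>)
    qed
    have "pairing ?V N a x 0 \<le> integral\<^sup>L ?M (\<lambda>y. 2 * u x * K y + \<tau> * u y)"
      unfolding pairing_def
    proof (rule integral_mono)
      show "integrable ?M (\<lambda>y. u y * hker N a 0 x y)" by (intro integrable_u_mult_subset V continuous_hker open_box)
      show "integrable ?M (\<lambda>y. 2 * u x * K y + \<tau> * u y)" using iK iu by auto
    qed (use point in simp)
    also have "\<dots> = 2 * u x * integral\<^sup>L ?M K + \<tau> * I" using iK iu by (simp add: I_def)
    also have "integral\<^sup>L ?M K \<le> 4 ^ ?n * P"
      using integral_prod_peak_le[OF a x, of N] unfolding K_def P_def by (simp add: prod.distrib)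
    then have "2 * u x * integral\<^sup>L ?M K + \<tau> * I \<le> 2 * u x * (4 ^ ?n * P) + P * u x"
      using ux tail unfolding \<tau>_def by (intro add_mono mult_left_mono) auto
    finally show ?case unfolding P_def[symmetric] by (simp add: algebra_simps)
  qed
qed

text \<open>
  As for the upper bound, with \<open>pairing_decay\<close> and the reversed estimates.
\<close>
lemma lower_bound:
  fixes a x :: "real^'n"
  assumes a: "\<And>i. a $ i > 0" and V: "box (- a) a \<subseteq> U" and x: "x \<in> box (- a) a"
    and T: "\<And>i. 5 \<le> rate a i * T" and T0: "T \<ge> 0"
  shows "2 ^ CARD('n) * exp ((l - box_eigenvalue a) * T) * box_ground a x *
      integral_on (box (- a) a) (\<lambda>y. u y * box_ground a y) \<le> (2 * 4 ^ CARD('n) + 1) * u x"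
proof -
  let ?V = "box (- a) a"
  let ?M = "lebesgue_on ?V"
  define P where "P = (\<Prod>i\<in>UNIV. a $ i)"
  define I where "I = integral\<^sup>L ?M (\<lambda>y. u y * box_ground a y)"
  define E where "E = 2 ^ CARD('n) * exp (- box_eigenvalue a * T)"
  have P: "P > 0" unfolding P_def by (rule prod_pos_vec[OF a])
  obtain N where N: "N \<ge> 3" "pairing ?V N a x 0 \<le> (2 * 4 ^ CARD('n) + 1) * P * u x"
    using eventually_conj[OF pairing_0_upper[OF a V x] eventually_ge_at_top[of 3]]
    unfolding P_def eventually_sequentially by blast
  have "E * P * box_ground a x * I = integral\<^sup>L ?M (\<lambda>y. E * P * box_ground a x * (u y * box_ground a y))"
    by (simp add: I_def)
  also have "\<dots> \<le> pairing ?V N a x T"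
    unfolding pairing_def
  proof (rule integral_mono)
    show "integrable ?M (\<lambda>y. u y * hker N a T x y)" by (intro integrable_u_mult_subset V continuous_hker open_box)
    show "integrable ?M (\<lambda>y. E * P * box_ground a x * (u y * box_ground a y))"
      by (intro integrable_mult_right integrable_u_mult_subset V open_box continuous_box_ground a)
    fix y assume "y \<in> space ?M"
    then have y: "y \<in> ?V" by simp
    have "E * (P * box_ground a x * box_ground a y) \<le> hker N a T x y"
      unfolding E_def P_def using hker_large_time(2)[OF a x y T N(1)] .
    then have "u y * (E * (P * box_ground a x * box_ground a y)) \<le> u y * hker N a T x y"
      using pos[of y] y V by (intro mult_left_mono) (auto intro: less_imp_le)
    then show "E * P * box_ground a x * (u y * box_ground a y) \<le> u y * hker N a T x y" by (simp add: mult_ac)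
  qed
  finally have "exp (l * T) * (E * P * box_ground a x * I) \<le> exp (l * T) * pairing ?V N a x T"
    by (intro mult_left_mono) auto
  also have "\<dots> \<le> pairing ?V N a x 0" by (rule pairing_decay[OF a V x T0])
  also have "\<dots> \<le> (2 * 4 ^ CARD('n) + 1) * P * u x" by (rule N(2))
  finally have "P * (exp (l * T) * (E * box_ground a x * I)) \<le> P * ((2 * 4 ^ CARD('n) + 1) * u x)"
    by (simp add: mult_ac)
  then have "exp (l * T) * (E * box_ground a x * I) \<le> (2 * 4 ^ CARD('n) + 1) * u x"
    by (rule mult_left_le_imp_le) (rule P)
  moreover have "exp (l * T) * E = 2 ^ CARD('n) * exp ((l - box_eigenvalue a) * T)"
    by (simp add: E_def left_diff_distrib flip: exp_add)
  ultimately show ?thesis unfolding I_def by (simp only: mult.assoc[symmetric])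
qed

end

section \<open>Mass of the eigenfunction in the core of the inner box\<close>

lemma integral_lebesgue_on_subset:
  fixes f :: "real^'n \<Rightarrow> real"
  assumes "open U" "open V" "V \<subseteq> U"
  shows "integral_on V f = integral_on U (\<lambda>y. indicator V y * f y)"
proof -
  have s: "U \<in> sets lebesgue" "V \<in> sets lebesgue" using assms by auto
  have "(\<lambda>y. indicator V y *\<^sub>R f y) = (\<lambda>y. indicator U y *\<^sub>R (indicator V y * f y))"
    using assms(3) by (auto simp: fun_eq_iff indicator_def)
  then show ?thesis using s by (simp add: integral_restrict_space del: real_scaleR_def)
qed

text \<open>
  On the box shrunk by the factor \<open>r\<close> the angle stays within \<open>pi r / 2\<close> of
  \<open>pi / 2\<close>.
\<close>
lemma ground_mode_core:
  fixes a y :: "real^'n"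
  assumes a: "\<And>i. a $ i > 0" and r: "0 < r" "r < 1" and y: "y \<in> box (- (r *\<^sub>R a)) (r *\<^sub>R a)"
  shows "cos (pi * r / 2) ^ CARD('n) \<le> mode a (\<lambda>_. 1) y"
proof -
  have pr: "0 \<le> pi * r / 2" "pi * r / 2 \<le> pi / 2" using r by auto
  have "cos (pi * r / 2) \<le> sin (ang a i y)" for i
  proof -
    have "- (r * a $ i) < y $ i \<and> y $ i < r * a $ i" using y by (simp add: mem_centred_box)
    then have "\<bar>y $ i\<bar> < r * a $ i" by linarith
    then have "\<bar>y $ i / a $ i\<bar> < r" using a[of i] by (simp add: divide_less_eq)
    then have "pi * \<bar>y $ i / a $ i\<bar> \<le> pi * r" by (intro mult_left_mono) auto
    moreover have "\<bar>pi * s / 2\<bar> = pi * \<bar>s\<bar> / 2" for s :: real by (simp add: abs_mult)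
    ultimately have z: "\<bar>pi * (y $ i / a $ i) / 2\<bar> \<le> pi * r / 2" by simp
    have "ang a i y = pi / 2 + pi * (y $ i / a $ i) / 2"
      using a[of i] by (simp add: ang_def field_simps)
    then have "sin (ang a i y) = cos (pi * (y $ i / a $ i) / 2)" by (simp add: sin_add)
    also have "\<dots> = cos \<bar>pi * (y $ i / a $ i) / 2\<bar>"
      by (rule cos_abs_real[symmetric])
    also have "\<dots> \<ge> cos (pi * r / 2)"
      using z pr by (intro cos_monotone_0_pi_le) auto
    finally show ?thesis .
  qed
  moreover have "0 \<le> cos (pi * r / 2)" using pr pi_gt_zero by (intro cos_ge_zero) linarith+
  ultimately have "(\<Prod>i\<in>(UNIV::'n set). cos (pi * r / 2)) \<le> (\<Prod>i\<in>UNIV. sin (ang a i y))"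
    by (intro prod_mono) auto
  then show ?thesis by (simp add: mode_def)
qed

context positive_eigenfunction
begin

text \<open>
  On the core \<open>r\<close> times the inner box, \<open>u\<close> is bounded by a multiple of
  \<open>box_ground a\<close>, so \<open>u\<^sup>2\<close> is bounded there by a multiple of
  \<open>u \<cdot> box_ground a\<close>. Outside the core, \<open>u\<^sup>2\<close> is at most
  \<open>D\<^sup>2\<close> over the product of the half-sides of the outer box, on a set whose
  volume relative to that product is at most \<open>2\<^sup>n (1 - r\<^sup>2\<^sup>n)\<close>. One
  factor \<open>r\<^sup>n\<close> comes from the shrinking and one from the ratio of the boxes.
\<close>
lemma ground_pairing_ge_core:
  fixes a b :: "real^'n"
  assumes a: "\<And>i. a $ i > 0" and b: "\<And>i. b $ i > 0" and V: "box (- a) a \<subseteq> U" and U: "U \<subseteq> box (- b) b"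
    and D: "D > 0" "\<And>y. y \<in> U \<Longrightarrow> u y \<le> D * box_ground b y"
    and r: "0 < r" "r < 1" "\<And>i. r * b $ i \<le> a $ i" "\<And>i. a $ i \<le> b $ i"
    and small: "D\<^sup>2 * 2 ^ CARD('n) * (1 - r ^ (2 * CARD('n))) \<le> 1 / 2"
  shows "cos (pi * r / 2) ^ CARD('n) / (2 * D) \<le> integral_on (box (- a) a) (\<lambda>y. u y * box_ground a y)"
proof -
  let ?M = "lebesgue_on U"
  let ?n = "CARD('n)"
  let ?V = "box (- a) a"
  define C where "C = box (- (r *\<^sub>R a)) (r *\<^sub>R a)"
  interpret finite_measure ?M by (rule finite_measure_lebesgue_on_bounded[OF open_U bounded_U])
  define A where "A = (\<Prod>i\<in>UNIV. a $ i)"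
  define B where "B = (\<Prod>i\<in>UNIV. b $ i)"
  have A: "A > 0" and B: "B > 0" unfolding A_def B_def by (rule prod_pos_vec; fact)+
  have AB: "A \<le> B" unfolding A_def B_def using a r(4) by (intro prod_mono) (auto intro: less_imp_le)
  have rBA: "r ^ ?n * B \<le> A"
  proof -
    have "r ^ ?n * B = (\<Prod>i\<in>UNIV. r * b $ i)" by (simp add: B_def prod.distrib)
    also have "\<dots> \<le> A" unfolding A_def using r b by (intro prod_mono) (auto intro: less_imp_le)
    finally show ?thesis .
  qed
  define \<gamma> where "\<gamma> = cos (pi * r / 2) ^ ?n"
  have "pi * r / 2 < pi / 2" using r by simp
  then have g: "\<gamma> > 0" unfolding \<gamma>_def using r by (intro zero_less_power cos_gt_zero) auto
  have CV: "C \<subseteq> ?V"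
  proof
    fix y assume y: "y \<in> C"
    show "y \<in> ?V"
      unfolding mem_centred_box
    proof
      fix i
      have "r * a $ i \<le> a $ i" using r a[of i] by simp
      then show "- a $ i < y $ i \<and> y $ i < a $ i"
        using y unfolding C_def mem_centred_box by (auto dest!: spec[of _ i])
    qed
  qed
  have CU: "C \<subseteq> U" using CV V by blast
  have Cs: "C \<in> sets lebesgue" "U \<in> sets lebesgue" using open_U by (auto simp: C_def)
  have Cr: "C \<in> sets ?M" "U - C \<in> sets ?M" using Cs CU by (auto simp: sets_restrict_space_iff)
  have mU: "measure lebesgue U \<le> 2 ^ ?n * B"
    unfolding B_def measure_centred_box[OF b, symmetric] using U open_U
    by (intro measure_mono_fmeasurable) auto
  have mC: "measure lebesgue C = 2 ^ ?n * (r ^ ?n * A)"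
  proof -
    have "measure lebesgue C = 2 ^ ?n * (\<Prod>i\<in>UNIV. (r *\<^sub>R a) $ i)"
      unfolding C_def by (rule measure_centred_box) (use r a in simp)
    then show ?thesis by (simp add: A_def prod.distrib)
  qed
  have "measure ?M (U - C) = measure ?M U - measure ?M C"
    using Cr finite_measure_Diff[of U C] CU by auto
  also have "\<dots> = measure lebesgue U - measure lebesgue C"
    using Cs CU by (simp add: measure_restrict_space)
  also have "\<dots> \<le> 2 ^ ?n * B - 2 ^ ?n * (r ^ ?n * A)" using mU mC by simp
  also have "\<dots> \<le> 2 ^ ?n * B - 2 ^ ?n * (r ^ ?n * (r ^ ?n * B))"
    using rBA r by (intro diff_left_mono mult_left_mono) auto
  also have "\<dots> = 2 ^ ?n * (1 - r ^ (2 * ?n)) * B"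
  proof -
    have "r ^ (2 * ?n) = r ^ ?n * r ^ ?n" by (simp only: mult_2 power_add)
    then show ?thesis by (simp add: algebra_simps)
  qed
  finally have "D\<^sup>2 / B * measure ?M (U - C) \<le> D\<^sup>2 / B * (2 ^ ?n * (1 - r ^ (2 * ?n)) * B)"
    using B by (intro mult_left_mono) auto
  also have "\<dots> = D\<^sup>2 * 2 ^ ?n * (1 - r ^ (2 * ?n))" using B by simp
  finally have out: "D\<^sup>2 / B * measure ?M (U - C) \<le> 1 / 2" using small by linarith
  define I where "I = integral_on ?V (\<lambda>y. u y * box_ground a y)"
  have I: "I = integral\<^sup>L ?M (\<lambda>y. indicator ?V y * (u y * box_ground a y))"
    unfolding I_def by (rule integral_lebesgue_on_subset[OF open_U open_box V])
  have iV: "integrable ?M (\<lambda>y. indicator ?V y * (u y * box_ground a y))"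
    using integrable_mult_indicator[OF _ integrable_u_mult[OF continuous_box_ground[OF a]], of ?V] V Cs
    by (simp add: sets_restrict_space_iff)
  have "1 = integral\<^sup>L ?M (\<lambda>y. (u y)\<^sup>2)" by (simp add: integral_u_square)
  also have "\<dots> \<le> integral\<^sup>L ?M (\<lambda>y. D / \<gamma> * (indicator ?V y * (u y * box_ground a y)) + D\<^sup>2 / B * indicator (U - C) y)"
  proof (rule integral_mono)
    show "integrable ?M (\<lambda>y. (u y)\<^sup>2)" by (rule integral_u_square)
    show "integrable ?M (\<lambda>y. D / \<gamma> * (indicator ?V y * (u y * box_ground a y)) + D\<^sup>2 / B * indicator (U - C) y)"
      using iV Cr by (intro Bochner_Integration.integrable_add integrable_mult_right integrable_real_indicator) (auto simp: less_top[symmetric])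
    fix y assume "y \<in> space ?M"
    then have y: "y \<in> U" by simp
    have uy: "0 < u y" using pos[OF y] .
    have Db: "u y \<le> D / sqrt B"
    proof -
      have "D * box_ground b y \<le> D * (1 / sqrt B)"
        unfolding B_def using D(1) by (intro mult_left_mono box_ground_le b) auto
      then show ?thesis using D(2)[OF y] by simp
    qed
    have ind: "0 \<le> indicator ?V y * (u y * box_ground a y)"
      using uy box_ground_pos[OF a, of y] by (auto simp: indicator_def less_imp_le)
    show "(u y)\<^sup>2 \<le> D / \<gamma> * (indicator ?V y * (u y * box_ground a y)) + D\<^sup>2 / B * indicator (U - C) y"
    proof (cases "y \<in> C")
      case True
      have "D / sqrt B \<le> D / sqrt A" using D(1) A AB by (intro divide_left_mono) auto
      then have "u y * \<gamma> \<le> D / sqrt A * mode a (\<lambda>_. 1) y"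
        unfolding \<gamma>_def using ground_mode_core[OF a r(1,2)] True Db D(1) A uy g
        by (intro mult_mono) (auto simp: C_def \<gamma>_def)
      also have "\<dots> = D * box_ground a y" by (simp add: box_ground_def A_def)
      finally have "u y \<le> D / \<gamma> * box_ground a y" using g by (simp add: field_simps)
      then have "u y * u y \<le> u y * (D / \<gamma> * box_ground a y)" using uy by (intro mult_left_mono) auto
      then show ?thesis using True CV by (auto simp: indicator_def power2_eq_square mult_ac)
    next
      case False
      have "(u y)\<^sup>2 \<le> (D / sqrt B)\<^sup>2" using Db uy by (intro power_mono) auto
      also have "\<dots> = D\<^sup>2 / B" using B by (simp add: power_divide)
      finally show ?thesis using False y ind D(1) g
        by (simp add: add_increasing)
    qed
  qed
  also have "\<dots> = D / \<gamma> * I + D\<^sup>2 / B * measure ?M (U - C)"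
  proof -
    have "(U - C) \<inter> U = U - C" by blast
    then have "integral\<^sup>L ?M (indicator (U - C)) = measure ?M (U - C)"
      by simp
    then show ?thesis
      unfolding I using iV Cr by (subst Bochner_Integration.integral_add) (auto simp: less_top[symmetric])
  qed
  finally have "1 / 2 \<le> D / \<gamma> * I" using out by linarith
  then show ?thesis using g D(1) unfolding I_def \<gamma>_def by (simp add: field_simps)
qed

end

section \<open>Comparison of eigenfunctions\<close>

lemma principal_eigenfunction_locale:
  assumes "principal_eigenfunction U \<phi>" "open U" "bounded U"
  obtains l where "positive_eigenfunction U l \<phi>"
  using assms unfolding principal_eigenfunction_def positive_eigenfunction_def by blast

lemma centred_box_mono_D:
  fixes a b :: "real^'n"
  assumes "\<And>i. b $ i > 0" "\<And>i. a $ i > 0" "box (- a) a \<subseteq> box (- b) b"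
  shows "a $ i \<le> b $ i"
proof (rule ccontr)
  assume "\<not> a $ i \<le> b $ i"
  then have "(\<chi> j. if j = i then b $ i else 0) \<in> box (- a) a"
    using assms(1,2) by (auto simp: mem_centred_box intro: less_trans[of _ 0])
  then have "(\<chi> j. if j = i then b $ i else 0) \<in> box (- b) b" using assms(3) by blast
  then show False unfolding mem_centred_box by (auto dest!: spec[of _ i])
qed

definition max_square :: "real^'n \<Rightarrow> real" where
  "max_square b = Max (range (\<lambda>j. (b $ j)\<^sup>2))"

lemma max_square_ge: "(b $ i)\<^sup>2 \<le> max_square b"
  unfolding max_square_def by (intro Max_ge) auto

lemma max_square_pos:
  assumes "\<And>i. b $ i > 0" shows "0 < max_square b"
  using max_square_ge[of b undefined] assms[of undefined] by (meson less_le_trans zero_less_power)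

text \<open>
  The time \<open>4 max\<^sub>j b\<^sub>j\<^sup>2\<close> is long enough for all coordinates of both
  boxes, since \<open>pi\<^sup>2 \<ge> 9\<close>.
\<close>
lemma rate_large_time:
  assumes "\<And>i. b $ i > 0" "a $ i > 0" "a $ i \<le> b $ i"
  shows "5 \<le> rate a i * (4 * max_square b)"
proof -
  have "(a $ i)\<^sup>2 \<le> (b $ i)\<^sup>2" using assms by (intro power_mono) auto
  then have "(a $ i)\<^sup>2 \<le> max_square b" using max_square_ge[of b i] by linarith
  then have 1: "1 \<le> max_square b / (a $ i)\<^sup>2" using assms(2) by simp
  have "(3::real)\<^sup>2 \<le> pi\<^sup>2" using pi_gt3 by (intro power_mono) auto
  then have "5 \<le> pi\<^sup>2 * 1" by simp
  also have "\<dots> \<le> pi\<^sup>2 * (max_square b / (a $ i)\<^sup>2)" using 1 by (intro mult_left_mono) auto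
  also have "\<dots> = rate a i * (4 * max_square b)" by (simp add: rate_def power_divide power_mult_distrib)
  finally show ?thesis .
qed

text \<open>
  The condition on the sides bounds each summand of the difference of the eigenvalues by a multiple
  of \<open>1 / max\<^sub>j b\<^sub>j\<^sup>2\<close>, which is the inverse of the chosen time up to
  a constant.
\<close>
lemma eigenvalue_gap:
  fixes a b :: "real^'n"
  assumes b: "\<And>i. b $ i > 0" and c: "cond_i C a b"
  shows "(box_eigenvalue a - box_eigenvalue b) * (4 * max_square b) \<le> real CARD('n) * pi\<^sup>2 * C"
proof -
  have M: "0 < max_square b" by (rule max_square_pos[OF b])
  have "(rate a i - rate b i) * (4 * max_square b) \<le> pi\<^sup>2 * C" for i
  proof -
    have "1 / (a $ i)\<^sup>2 - 1 / (b $ i)\<^sup>2 \<le> C / max_square b"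
      using c unfolding cond_i_def max_square_def by blast
    then have "(1 / (a $ i)\<^sup>2 - 1 / (b $ i)\<^sup>2) * max_square b \<le> C" using M by (simp add: le_divide_eq)
    then have "pi\<^sup>2 * ((1 / (a $ i)\<^sup>2 - 1 / (b $ i)\<^sup>2) * max_square b) \<le> pi\<^sup>2 * C"
      by (intro mult_left_mono) auto
    moreover have "rate c i = pi\<^sup>2 / 4 * (1 / (c $ i)\<^sup>2)" for c :: "real^'n"
      by (simp add: rate_def power_divide power_mult_distrib)
    ultimately show ?thesis by (simp add: algebra_simps)
  qed
  then have "(\<Sum>i\<in>UNIV. (rate a i - rate b i) * (4 * max_square b)) \<le> (\<Sum>i\<in>(UNIV::'n set). pi\<^sup>2 * C)"
    by (intro sum_mono)
  then show ?thesis
    by (simp add: box_eigenvalue_def sum_subtractf sum_distrib_right left_diff_distrib)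
qed

definition upper_const :: "nat \<Rightarrow> real" where
  "upper_const n = (5 * pi) ^ n * (2 ^ n + 1)"

definition lower_const :: "nat \<Rightarrow> real" where
  "lower_const n = (2 * 4 ^ n + 1) / 2 ^ n"

lemma const_pos: "0 < upper_const n" "0 < lower_const n"
  by (simp_all add: upper_const_def lower_const_def add_pos_pos)

lemma upper_const_ge_1: "1 \<le> upper_const n"
proof -
  have "1 \<le> (5 * pi) ^ n" using pi_gt3 by (intro one_le_power) simp
  then have "1 * 1 \<le> (5 * pi) ^ n * (2 ^ n + 1)" by (intro mult_mono) auto
  then show ?thesis by (simp add: upper_const_def)
qed

context positive_eigenfunction
begin

lemma upper_bound_cond_i:
  fixes a b :: "real^'n"
  assumes a: "\<And>i. a $ i > 0" and b: "\<And>i. b $ i > 0" and V: "box (- a) a \<subseteq> U" and U: "U \<subseteq> box (- b) b"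
    and c: "cond_i C a b" and x: "x \<in> U"
  shows "u x \<le> upper_const CARD('n) * exp (real CARD('n) * pi\<^sup>2 * C) * box_ground b x"
proof -
  let ?T = "4 * max_square b"
  have "(l - box_eigenvalue b) * ?T \<le> (box_eigenvalue a - box_eigenvalue b) * ?T"
    using eigenvalue_le_box[OF a V] max_square_pos[OF b] by (intro mult_right_mono) auto
  also have "\<dots> \<le> real CARD('n) * pi\<^sup>2 * C" by (rule eigenvalue_gap[OF b c])
  finally have e: "exp ((l - box_eigenvalue b) * ?T) \<le> exp (real CARD('n) * pi\<^sup>2 * C)" by simp
  have "u x \<le> upper_const CARD('n) * exp ((l - box_eigenvalue b) * ?T) * box_ground b x"
    unfolding upper_const_def by (rule upper_bound[OF b U x rate_large_time[OF b b order_refl]])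
  also have "\<dots> \<le> upper_const CARD('n) * exp (real CARD('n) * pi\<^sup>2 * C) * box_ground b x"
    using const_pos box_ground_pos[OF b, of x] U x
    by (intro mult_right_mono mult_left_mono e) (auto intro: less_imp_le)
  finally show ?thesis .
qed

lemma lower_bound_time:
  fixes a b :: "real^'n"
  assumes a: "\<And>i. a $ i > 0" and b: "\<And>i. b $ i > 0" and V: "box (- a) a \<subseteq> U"
    and ab: "\<And>i. a $ i \<le> b $ i" and x: "x \<in> box (- a) a"
  shows "exp ((l - box_eigenvalue a) * (4 * max_square b)) * box_ground a x *
      integral_on (box (- a) a) (\<lambda>y. u y * box_ground a y) \<le> lower_const CARD('n) * u x"
proof -
  have "2 ^ CARD('n) * (exp ((l - box_eigenvalue a) * (4 * max_square b)) * box_ground a x *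
      integral_on (box (- a) a) (\<lambda>y. u y * box_ground a y)) \<le> (2 * 4 ^ CARD('n) + 1) * u x"
    using lower_bound[OF a V x rate_large_time[OF b a ab]] max_square_pos[OF b]
    by (simp add: mult.assoc)
  then show ?thesis by (simp add: lower_const_def field_simps)
qed

end

text \<open>
  Here the domain is the box itself, so \<open>l\<close> equals the eigenvalue of the box and no
  exponential remains. The integral in the lower bound is controlled by the upper bound, since
  \<open>1 = \<integral> \<phi>\<^sup>2\<close> is at most a constant times \<open>\<integral>
  \<phi> \<cdot> box_ground b\<close>.
\<close>
lemma box_eigenfunction_comparison:
  fixes b :: "real^'n"
  assumes b: "\<And>i. b $ i > 0" and p: "principal_eigenfunction (box (- b) b) \<phi>" and x: "x \<in> box (- b) b"
  shows "\<phi> x \<le> upper_const CARD('n) * box_ground b x"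
    and "box_ground b x \<le> upper_const CARD('n) * lower_const CARD('n) * \<phi> x"
proof -
  let ?V = "box (- b) b"
  let ?T = "4 * max_square b"
  obtain l where "positive_eigenfunction ?V l \<phi>"
    using principal_eigenfunction_locale[OF p open_box bounded_box] .
  then interpret positive_eigenfunction ?V l \<phi> .
  have l: "l = box_eigenvalue b"
    using eigenvalue_le_box[OF b subset_refl] eigenvalue_ge_box[OF b subset_refl] by simp
  have up: "\<phi> y \<le> upper_const CARD('n) * box_ground b y" if "y \<in> ?V" for y
    using upper_bound[OF b subset_refl that rate_large_time[OF b b order_refl]]
    by (simp add: upper_const_def l)
  then show "\<phi> x \<le> upper_const CARD('n) * box_ground b x" using x .
  define I where "I = integral_on ?V (\<lambda>y. \<phi> y * box_ground b y)"
  have iI: "integrable (lebesgue_on ?V) (\<lambda>y. \<phi> y * box_ground b y)"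
    by (rule integrable_u_mult[OF continuous_box_ground[OF b]])
  have "1 = integral_on ?V (\<lambda>y. (\<phi> y)\<^sup>2)" by (simp add: integral_u_square)
  also have "\<dots> \<le> integral_on ?V (\<lambda>y. upper_const CARD('n) * (\<phi> y * box_ground b y))"
  proof (rule integral_mono[OF integral_u_square(2)])
    show "integrable (lebesgue_on ?V) (\<lambda>y. upper_const CARD('n) * (\<phi> y * box_ground b y))"
      using iI by simp
    fix y assume "y \<in> space (lebesgue_on ?V)"
    then have y: "y \<in> ?V" by simp
    have "\<phi> y * \<phi> y \<le> \<phi> y * (upper_const CARD('n) * box_ground b y)"
      using up[OF y] pos[OF y] by (intro mult_left_mono) auto
    then show "(\<phi> y)\<^sup>2 \<le> upper_const CARD('n) * (\<phi> y * box_ground b y)"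
      by (simp add: power2_eq_square mult_ac)
  qed
  also have "\<dots> = upper_const CARD('n) * I" by (simp add: I_def)
  finally have I: "1 \<le> upper_const CARD('n) * I" .
  have "box_ground b x * I \<le> lower_const CARD('n) * \<phi> x"
    using lower_bound_time[OF b b subset_refl order_refl x] by (simp add: l I_def)
  then have "upper_const CARD('n) * (box_ground b x * I) \<le> upper_const CARD('n) * (lower_const CARD('n) * \<phi> x)"
    using const_pos by (intro mult_left_mono) (auto intro: less_imp_le)
  moreover have "box_ground b x * 1 \<le> box_ground b x * (upper_const CARD('n) * I)"
    using I box_ground_pos[OF b x] by (intro mult_left_mono) auto
  ultimately show "box_ground b x \<le> upper_const CARD('n) * lower_const CARD('n) * \<phi> x"
    by (simp add: mult_ac)
qed

lemma between_boxes_D: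
  fixes a b :: "real^'n"
  assumes "between_boxes a b U"
  shows "\<And>i. a $ i > 0" "\<And>i. b $ i > 0" "open U" "bounded U" "box (- a) a \<subseteq> U" "U \<subseteq> box (- b) b"
    "\<And>i. a $ i \<le> b $ i"
proof -
  show 1: "\<And>i. a $ i > 0" "\<And>i. b $ i > 0" "open U" "box (- a) a \<subseteq> U" "U \<subseteq> box (- b) b"
    using assms unfolding between_boxes_def is_domain_def by auto
  show "bounded U" using 1(5) bounded_box bounded_subset by blast
  show "\<And>i. a $ i \<le> b $ i" by (rule centred_box_mono_D) (use 1 in auto)
qed

lemma eigenfunction_upper_comparison:
  assumes M: "C1 \<le> M" and bb: "between_boxes a b U" and ci: "cond_i C1 (a::real^'n) b"
    and pU: "principal_eigenfunction U \<phi>U" and x: "x \<in> U"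
  shows "\<phi>U x \<le> upper_const CARD('n) * exp (real CARD('n) * pi\<^sup>2 * M) * box_ground b x"
proof -
  note B = between_boxes_D[OF bb]
  obtain l where "positive_eigenfunction U l \<phi>U"
    using principal_eigenfunction_locale[OF pU B(3,4)] .
  then interpret positive_eigenfunction U l \<phi>U .
  have "exp (real CARD('n) * pi\<^sup>2 * C1) \<le> exp (real CARD('n) * pi\<^sup>2 * M)"
    using M by (simp add: mult_left_mono)
  then have "upper_const CARD('n) * exp (real CARD('n) * pi\<^sup>2 * C1) * box_ground b x \<le>
      upper_const CARD('n) * exp (real CARD('n) * pi\<^sup>2 * M) * box_ground b x"
    using const_pos box_ground_pos[OF B(2), of x] x B(6)
    by (intro mult_right_mono mult_left_mono) (auto intro: less_imp_le)
  then show ?thesis using upper_bound_cond_i[OF B(1,2,5,6) ci x] by linarith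
qed

text \<open>
  Since \<open>l\<close> is at least the eigenvalue of the outer box, the gap of the two eigenvalues
  bounds the exponential in the lower bound from below; the core estimate supplies the integral,
  with the constant \<open>D\<close> of the upper bound.
\<close>
lemma eigenfunction_lower_comparison:
  fixes a b :: "real^'n"
  assumes bb: "between_boxes a b U" and ci: "cond_i C1 a b" and pU: "principal_eigenfunction U \<phi>U"
    and D: "D = upper_const CARD('n) * exp (real CARD('n) * pi\<^sup>2 * C1)"
    and r: "0 < r" "r < 1" "\<And>i. r * b $ i \<le> a $ i"
    and small: "D\<^sup>2 * 2 ^ CARD('n) * (1 - r ^ (2 * CARD('n))) \<le> 1 / 2"
    and x: "x \<in> box (- a) a"
  shows "exp (- (real CARD('n) * pi\<^sup>2 * C1)) * (cos (pi * r / 2) ^ CARD('n) / (2 * D)) * box_ground a x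
    \<le> lower_const CARD('n) * \<phi>U x"
proof -
  note B = between_boxes_D[OF bb]
  let ?T = "4 * max_square b"
  obtain l where "positive_eigenfunction U l \<phi>U"
    using principal_eigenfunction_locale[OF pU B(3,4)] .
  then interpret positive_eigenfunction U l \<phi>U .
  define I where "I = integral_on (box (- a) a) (\<lambda>y. \<phi>U y * box_ground a y)"
  have D0: "D > 0" using const_pos D by simp
  have I: "cos (pi * r / 2) ^ CARD('n) / (2 * D) \<le> I"
    unfolding I_def
  proof (rule ground_pairing_ge_core[OF B(1,2,5,6) D0 _ r B(7) small])
    show "\<phi>U y \<le> D * box_ground b y" if "y \<in> U" for y
      unfolding D by (rule upper_bound_cond_i[OF B(1,2,5,6) ci that])
  qed
  have "(box_eigenvalue a - l) * ?T \<le> (box_eigenvalue a - box_eigenvalue b) * ?T"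
    using eigenvalue_ge_box[OF B(2,6)] max_square_pos[OF B(2)] by (intro mult_right_mono) auto
  also have "\<dots> \<le> real CARD('n) * pi\<^sup>2 * C1" by (rule eigenvalue_gap[OF B(2) ci])
  finally have e: "exp (- (real CARD('n) * pi\<^sup>2 * C1)) \<le> exp ((l - box_eigenvalue a) * ?T)"
    by (simp add: algebra_simps)
  have g: "0 < box_ground a x" by (rule box_ground_pos[OF B(1) x])
  have "0 \<le> pi * r / 2" "pi * r / 2 \<le> pi / 2" using r by auto
  then have c: "0 \<le> cos (pi * r / 2)" using pi_gt_zero by (intro cos_ge_zero) linarith+
  have "exp (- (real CARD('n) * pi\<^sup>2 * C1)) * (cos (pi * r / 2) ^ CARD('n) / (2 * D)) * box_ground a x
      \<le> exp ((l - box_eigenvalue a) * ?T) * I * box_ground a x"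
  proof (intro mult_mono e I)
    have "0 \<le> cos (pi * r / 2) ^ CARD('n) / (2 * D)" using c D0 by simp
    then have "0 \<le> I" using I by linarith
    then show "0 \<le> exp ((l - box_eigenvalue a) * ?T) * I" by simp
  qed (use g c D0 in auto)
  also have "\<dots> \<le> lower_const CARD('n) * \<phi>U x"
    using lower_bound_time[OF B(1,2,5,7) x] by (simp add: I_def mult_ac)
  finally show ?thesis .
qed

theorem theorem1p1:
  shows
    "(\<forall>M>0. \<exists>C>0. \<forall>C1 (a::real^'n) b U \<phi>\<^sub>U \<phi>\<^sub>2.
        0 < C1 \<and> C1 \<le> M \<and> between_boxes a b U \<and> cond_i C1 a b \<and>
        principal_eigenfunction U \<phi>\<^sub>U \<and> principal_eigenfunction (box (- b) b) \<phi>\<^sub>2 \<longrightarrow>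
        (\<forall>x\<in>U. \<phi>\<^sub>U x \<le> C * \<phi>\<^sub>2 x)) \<and>
     (\<forall>C1>0. \<exists>K>1. \<exists>C>0. \<forall>C2 (a::real^'n) b U \<phi>\<^sub>U \<phi>\<^sub>1.
        1 < C2 \<and> C2 < K \<and> between_boxes a b U \<and> cond_i C1 a b \<and> cond_ii C2 a b \<and>
        principal_eigenfunction U \<phi>\<^sub>U \<and> principal_eigenfunction (box (- a) a) \<phi>\<^sub>1 \<longrightarrow>
        (\<forall>x\<in>box (- a) a. \<phi>\<^sub>1 x \<le> C * \<phi>\<^sub>U x))"
proof (rule conjI; intro allI impI)
  let ?n = "CARD('n)"
  fix M :: real assume "M > 0"
  define D where "D = upper_const ?n * exp (real ?n * pi\<^sup>2 * M)"
  define C where "C = D * (upper_const ?n * lower_const ?n)"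
  have D: "D > 0" using const_pos by (simp add: D_def)
  have C: "C > 0" using const_pos D by (simp add: C_def)
  show "\<exists>C>0. \<forall>C1 (a::real^'n) b U \<phi>\<^sub>U \<phi>\<^sub>2.
        0 < C1 \<and> C1 \<le> M \<and> between_boxes a b U \<and> cond_i C1 a b \<and>
        principal_eigenfunction U \<phi>\<^sub>U \<and> principal_eigenfunction (box (- b) b) \<phi>\<^sub>2 \<longrightarrow>
        (\<forall>x\<in>U. \<phi>\<^sub>U x \<le> C * \<phi>\<^sub>2 x)"
  proof (intro exI[of _ C] conjI C allI impI ballI)
    fix C1 and a b :: "real^'n" and U \<phi>U \<phi>2 x
    assume h: "0 < C1 \<and> C1 \<le> M \<and> between_boxes a b U \<and> cond_i C1 a b \<and>
        principal_eigenfunction U \<phi>U \<and> principal_eigenfunction (box (- b) b) \<phi>2" and x: "x \<in> U"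
    note B = between_boxes_D[of a b U]
    have "\<phi>U x \<le> D * box_ground b x"
      unfolding D_def using h x by (intro eigenfunction_upper_comparison) auto
    also have "\<dots> \<le> D * (upper_const ?n * lower_const ?n * \<phi>2 x)"
      using h x B D by (intro mult_left_mono box_eigenfunction_comparison(2)) auto
    finally show "\<phi>U x \<le> C * \<phi>2 x" by (simp add: C_def mult.assoc)
  qed
next
  let ?n = "CARD('n)"
  fix C1 :: real assume "C1 > 0"
  define D where "D = upper_const ?n * exp (real ?n * pi\<^sup>2 * C1)"
  have D: "1 \<le> D"
    unfolding D_def using upper_const_ge_1[of ?n] \<open>C1 > 0\<close> mult_mono[of 1 "upper_const ?n" 1 "exp (real ?n * pi\<^sup>2 * C1)"] by simp
  \<comment> \<open>\<open>r\<close> is so close to \<open>1\<close> that the mass outside the core is at most one half, by Bernoulli's inequality; nearness of the boxes means \<open>C2 < 1 / r\<close>\<close>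
  define e where "e = 1 / (2 * (D\<^sup>2 * 2 ^ ?n))"
  have Dn: "1 \<le> D\<^sup>2 * 2 ^ ?n"
    using mult_mono[of 1 "D\<^sup>2" 1 "2 ^ ?n"] one_le_power[OF D, of 2] by simp
  have e: "0 < e" "e \<le> 1 / 2" using Dn by (auto simp: e_def divide_le_eq)
  define r where "r = 1 - e / (2 * real ?n)"
  have n1: "1 \<le> real ?n" by simp
  have "e * 1 \<le> e * (2 * real ?n)" using e(1) n1 by (intro mult_left_mono) linarith+
  moreover have "0 < 2 * real ?n" using n1 by linarith
  ultimately have "e / (2 * real ?n) \<le> e" by (simp only: pos_divide_le_eq mult_1_right)
  moreover have "0 < e / (2 * real ?n)" using e(1) by simp
  ultimately have r: "0 < r" "r < 1" using e(2) unfolding r_def by linarith+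
  have small: "D\<^sup>2 * 2 ^ ?n * (1 - r ^ (2 * ?n)) \<le> 1 / 2"
  proof -
    have "1 + real (2 * ?n) * (- (e / (2 * real ?n))) \<le> (1 + - (e / (2 * real ?n))) ^ (2 * ?n)"
      by (rule Bernoulli_inequality) (use r in \<open>simp add: r_def\<close>)
    then have "1 - r ^ (2 * ?n) \<le> e" by (simp add: r_def)
    then have "D\<^sup>2 * 2 ^ ?n * (1 - r ^ (2 * ?n)) \<le> D\<^sup>2 * 2 ^ ?n * e" using Dn by (intro mult_left_mono) auto
    also have "\<dots> = 1 / 2" using D by (simp add: e_def)
    finally show ?thesis .
  qed
  define q where "q = exp (- (real ?n * pi\<^sup>2 * C1)) * (cos (pi * r / 2) ^ ?n / (2 * D))"
  have "pi * r / 2 < pi / 2" using r by simp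
  then have "0 < cos (pi * r / 2)" using r by (intro cos_gt_zero) auto
  then have q: "q > 0" using D by (simp add: q_def)
  define C where "C = upper_const ?n * (lower_const ?n / q)"
  have C: "C > 0" using const_pos q by (simp add: C_def)
  show "\<exists>K>1. \<exists>C>0. \<forall>C2 (a::real^'n) b U \<phi>\<^sub>U \<phi>\<^sub>1.
        1 < C2 \<and> C2 < K \<and> between_boxes a b U \<and> cond_i C1 a b \<and> cond_ii C2 a b \<and>
        principal_eigenfunction U \<phi>\<^sub>U \<and> principal_eigenfunction (box (- a) a) \<phi>\<^sub>1 \<longrightarrow>
        (\<forall>x\<in>box (- a) a. \<phi>\<^sub>1 x \<le> C * \<phi>\<^sub>U x)"
  proof (rule exI[of _ "1 / r"], rule conjI, goal_cases)
    case 1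
    show ?case using r by simp
  next
    case 2
    show ?case
    proof (intro exI[of _ C] conjI C allI impI ballI)
      fix C2 and a b :: "real^'n" and U \<phi>U \<phi>1 x
      assume h: "1 < C2 \<and> C2 < 1 / r \<and> between_boxes a b U \<and> cond_i C1 a b \<and> cond_ii C2 a b \<and>
          principal_eigenfunction U \<phi>U \<and> principal_eigenfunction (box (- a) a) \<phi>1"
        and x: "x \<in> box (- a) a"
      then have bb: "between_boxes a b U" and ci: "cond_i C1 a b" and cii: "cond_ii C2 a b"
        and pU: "principal_eigenfunction U \<phi>U" and p1: "principal_eigenfunction (box (- a) a) \<phi>1" by auto
      note B = between_boxes_D[OF bb]
      have rb: "r * b $ i \<le> a $ i" for i
      proof -
        have "r \<le> 1 / C2" using h r by (simp add: field_simps)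
        then have "r * b $ i \<le> 1 / C2 * b $ i" using B(2)[of i] by (intro mult_right_mono) auto
        also have "\<dots> \<le> a $ i" using cii unfolding cond_ii_def by blast
        finally show ?thesis .
    qed
    have "q * box_ground a x \<le> lower_const ?n * \<phi>U x"
      unfolding q_def by (rule eigenfunction_lower_comparison[OF bb ci pU D_def r rb small x])
    then have "box_ground a x \<le> lower_const ?n / q * \<phi>U x" using q by (simp add: field_simps)
    then have "upper_const ?n * box_ground a x \<le> upper_const ?n * (lower_const ?n / q * \<phi>U x)"
      by (intro mult_left_mono) (simp_all add: const_pos less_imp_le)
    then have "upper_const ?n * box_ground a x \<le> C * \<phi>U x" unfolding C_def by (simp only: mult.assoc)
    moreover have "\<phi>1 x \<le> upper_const ?n * box_ground a x"
      by (rule box_eigenfunction_comparison(1)[OF B(1) p1 x])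
    ultimately show "\<phi>1 x \<le> C * \<phi>U x" by linarith
    qed
  qed
qed

end
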